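(* None of the semi-equivelar maps $\mathcal{K}_1,\mathcal{K}_2,\dots,\mathcal{K}_{17}$ (specified in the context) on the surface of Euler characteristic $-1$ is vertex-transitive.
   Context: A map is a finite connected 2-dimensional cell complex whose underlying space is a closed surface (equivalently, a cellular embedding of a finite connected simple graph in a closed surface). All maps are polyhedral: every face is a closed disc bounded by a cycle of length at least $3$, every vertex has degree at least $3$, and two distinct faces intersect in the empty set, a single vertex or a single edge. Two maps are isomorphic if there is a bijection between their vertex sets which induces a bijection between their face sets; an automorphism of a map is a permutation of its vertices preserving incidence with edges and faces. A map is vertex-transitive if its automorphism group acts transitively on its vertices. A map is semi-equivelar of type $[p_1^{n_1},\dots,p_k^{n_k}]$ if around every vertex the faces are, in cyclic order, $n_1$ consecutive $p_1$-gons, then $n_2$ consecutive $p_2$-gons, ..., then $n_k$ consecutive $p_k$-gons. The surface of Euler characteristic $-1$ is the closed non-orientable surface of Euler genus $3$. A face is written as the cyclic sequence of its vertices. $\mathcal{K}_1$ (type $[4^3,5^1]$, vertices $1,\dots,20$): 5-gons $[1,2,10,9,8]$, $[3,4,18,15,14]$, $[5,12,19,17,16]$, $[6,7,20,13,11]$; 4-gons $[12,3,2,11]$, $[3,4,1,2]$, $[4,5,6,1]$, $[5,12,11,6]$, $[1,6,7,8]$, $[4,5,16,18]$, $[18,16,10,13]$, $[2,11,13,10]$, $[12,3,14,19]$, $[19,7,8,14]$, $[8,9,15,14]$, $[15,18,13,20]$, $[9,17,20,15]$, $[16,17,9,10]$, $[17,19,7,20]$. $\mathcal{K}_2$ (type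 $[4^3,5^1]$, vertices $1,\dots,20$): 5-gons $[1,2,10,9,8]$, $[3,4,19,18,16]$, $[5,11,13,15,14]$, $[6,7,20,17,12]$; 4-gons $[1,6,7,8]$, $[1,4,5,6]$, $[4,5,14,19]$, $[7,8,14,19]$, $[8,9,15,14]$, $[1,2,3,4]$, $[19,7,20,18]$, $[2,10,13,11]$, $[2,3,12,11]$, $[3,16,17,12]$, $[10,16,18,13]$, $[16,10,9,17]$, $[11,12,6,5]$, $[18,20,15,13]$, $[17,9,15,20]$. $\mathcal{K}_3$ (type $[4^3,5^1]$, vertices $1,\dots,20$): 5-gons $[1,2,10,9,8]$, $[3,4,19,17,16]$, $[5,11,13,15,14]$, $[6,7,20,18,12]$; 4-gons $[1,6,7,8]$, $[1,4,5,6]$, $[4,5,14,19]$, $[7,8,14,19]$, $[8,9,15,14]$, $[1,2,3,4]$, $[19,7,20,17]$, $[2,10,13,11]$, $[2,3,12,11]$, $[3,16,18,12]$, $[10,16,18,13]$, $[16,10,9,17]$, $[11,12,6,5]$, $[18,20,15,13]$, $[17,9,15,20]$. $\mathcal{K}_4$ (type $[3^1,4^1,7^1,4^1]$, vertices $1,\dots,42$): 7-gons $[1,2,3,4,5,6,7]$, $[8,9,12,13,14,15,16]$, $[10,21,20,19,18,17,11]$, $[22,23,24,25,26,27,28]$, $[29,30,31,32,33,34,35]$, $[36,37,38,39,40,41,42]$; 4-gons $[1,9,8,7]$, $[13,27,28,14]$, $[14,3,4,15]$, $[7,29,30,6]$, $[8,29,35,16]$, $[9,10,21,12]$, $[1,10,11,2]$,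 $[36,37,20,21]$, $[22,23,17,11]$, $[36,42,13,12]$, $[22,28,3,2]$, $[37,5,6,38]$, $[38,30,31,39]$, $[39,25,24,40]$, $[40,33,32,41]$, $[23,34,33,24]$, $[25,31,32,26]$, $[26,41,42,27]$, $[20,5,4,19]$, $[17,34,35,18]$, $[19,15,16,18]$; triangles $[13,27,42]$, $[14,28,3]$, $[7,8,29]$, $[1,9,10]$, $[12,21,36]$, $[2,11,22]$, $[5,20,37]$, $[6,30,38]$, $[25,31,39]$, $[24,33,40]$, $[17,23,34]$, $[26,32,41]$, $[4,15,19]$, $[16,18,35]$. $\mathcal{K}_5$ (type $[6^2,7^1]$, vertices $1,\dots,42$): 7-gons $[1,2,3,4,5,6,7]$, $[8,16,15,14,13,12,9]$, $[10,21,20,19,18,17,11]$, $[22,23,24,25,26,27,28]$, $[29,30,31,32,33,34,35]$, $[36,42,41,40,39,38,37]$; 6-gons $[2,11,17,22,28,3]$, $[3,28,27,14,15,4]$, $[4,15,16,19,20,5]$, $[5,20,21,37,38,6]$, $[6,38,39,31,30,7]$, $[7,30,29,8,9,1]$, $[1,9,12,10,11,2]$, $[23,34,33,41,40,24]$, $[27,14,13,36,42,26]$, $[8,16,19,18,35,29]$, $[12,13,36,37,21,10]$, $[17,18,35,34,23,22]$, $[31,32,25,24,40,39]$, $[32,33,41,42,26,25]$. $\mathcal{K}_6$ (type $[4^1,6^1,14^1]$, vertices $1,\dots,84$): 14-gons $[1,43,7,44,6,45,5,46,4,47,3,48,2,49]$, $[8,50,16,51,15,52,14,53,13,54,12,55,9,84]$,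 $[10,56,21,57,20,58,19,59,18,60,17,61,11,62]$, $[22,63,23,64,24,65,25,66,26,67,27,68,28,69]$, $[29,70,30,71,31,72,32,73,33,74,34,75,35,76]$, $[36,77,42,78,41,79,40,80,39,81,38,82,37,83]$; 6-gons $[1,9,55,10,62,49]$, $[2,11,61,22,69,48]$, $[3,28,68,14,52,47]$, $[4,46,58,19,51,15]$, $[5,45,82,37,57,20]$, $[6,38,81,71,30,44]$, $[7,70,29,8,84,43]$, $[12,54,36,83,21,56]$, $[24,64,74,33,79,40]$, $[25,65,80,39,31,72]$, $[13,77,42,67,27,53]$, $[26,78,41,73,32,66]$, $[16,50,76,35,18,59]$, $[17,60,75,34,23,63]$; 4-gons $[1,43,84,9]$, $[49,62,11,2]$, $[48,69,28,3]$, $[47,52,15,4]$, $[5,20,58,46]$, $[6,38,82,45]$, $[7,70,30,44]$, $[10,55,12,56]$, $[13,54,36,77]$, $[21,83,37,57]$, $[17,61,22,63]$, $[8,29,76,50]$, $[27,68,14,53]$, $[67,42,78,26]$, $[66,32,72,25]$, $[24,40,80,65]$, $[23,34,74,64]$, $[31,71,81,39]$, $[33,73,41,79]$, $[35,75,60,18]$, $[16,51,19,59]$. $\mathcal{K}_7$ (type $[4^1,8^1,10^1]$, vertices $1,\dots,40$): 10-gons $[1,21,2,22,10,23,9,24,8,25]$, $[3,26,4,27,18,28,15,29,14,30]$, $[6,31,7,32,20,33,13,34,11,35]$, $[5,36,12,37,19,38,17,39,16,40]$; 8-gons $[26,4,40,5,35,6,25,1]$, $[22,13,33,18,27,16,39,10]$,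 $[29,24,8,31,7,19,37,14]$, $[32,38,17,23,9,15,28,20]$, $[12,30,3,21,2,34,11,36]$; 4-gons $[1,26,3,21]$, $[6,25,8,31]$, $[5,35,11,36]$, $[4,27,16,40]$, $[10,39,17,23]$, $[2,22,13,34]$, $[14,37,12,30]$, $[29,24,9,15]$, $[20,28,18,33]$, $[32,38,19,7]$. The maps $\mathcal{K}_8,\dots,\mathcal{K}_{17}$ are the following maps known from the literature, each family being the complete list, up to isomorphism, of pairwise non-isomorphic semi-equivelar maps of the given type on the surface of Euler characteristic $-1$: $\mathcal{K}_8,\mathcal{K}_9$ are the two maps of type $[4^1,6^1,16^1]$; $\mathcal{K}_{10},\mathcal{K}_{11}$ the two maps of type $[3^1,4^1,8^1,4^1]$; $\mathcal{K}_{12},\mathcal{K}_{13}$ the two maps of type $[6^2,8^1]$; $\mathcal{K}_{14}$ the unique map of type $[3^1,4^1,3^1,4^2]$; $\mathcal{K}_{15},\mathcal{K}_{16},\mathcal{K}_{17}$ the three maps of type $[3^5,4^1]$. *)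

theory Defs
  imports "HOL-Combinatorics.Permutations"
begin

text \<open>
  Finite cell complexes are represented combinatorially by their vertices, edges and faces. An edge
  is the set of its two end points. A face is given by its boundary cycle, as the set of the edges
  of that cycle, so that two cyclic sequences of vertices that differ by a rotation or a
  reflection denote the same face.
\<close>

record 'a cell_map =
  Verts :: "'a set"
  Edges :: "'a set set"
  Faces :: "'a set set set"

definition boundary :: "'a list \<Rightarrow> 'a set set" where
  "boundary xs = {{xs ! i, xs ! (Suc i mod length xs)} | i. i < length xs}"

text \<open>
  The list \<open>fs\<close> enumerates the faces around \<open>v\<close> in cyclic order. In a complex all of whose edges
  lie on exactly two faces and all of whose vertices have degree at least 3, its existence says
  that the link of \<open>v\<close> is a single cycle, i.e. that the underlying space is a surface at \<open>v\<close>.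
\<close>

definition face_cycle :: "'a cell_map \<Rightarrow> 'a \<Rightarrow> 'a set set list \<Rightarrow> bool" where
  "face_cycle M v fs \<longleftrightarrow>
     distinct fs \<and> set fs = {f \<in> Faces M. v \<in> \<Union> f} \<and>
     (\<forall>i < length fs. \<exists>e \<in> fs ! i \<inter> fs ! (Suc i mod length fs). v \<in> e)"

text \<open>
  \<open>closed_surface_map\<close>: a finite connected simple graph with discs glued along cycles such that
  the underlying space is a closed surface; \<open>polyhedral_map\<close> adds the conditions on degrees and
  on the intersections of faces.
\<close>

definition closed_surface_map :: "'a cell_map \<Rightarrow> bool" where
  "closed_surface_map M \<longleftrightarrow>
     finite (Verts M) \<and> Edges M \<noteq> {} \<and>
     (\<forall>e \<in> Edges M. e \<subseteq> Verts M \<and> card e = 2) \<and>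
     (\<forall>u \<in> Verts M. \<forall>v \<in> Verts M. (u, v) \<in> {(x, y). {x, y} \<in> Edges M}\<^sup>*) \<and>
     (\<forall>f \<in> Faces M. f \<subseteq> Edges M \<and>
        (\<exists>xs. 3 \<le> length xs \<and> distinct xs \<and> f = boundary xs)) \<and>
     (\<forall>e \<in> Edges M. card {f \<in> Faces M. e \<in> f} = 2) \<and>
     (\<forall>v \<in> Verts M. \<exists>fs. face_cycle M v fs)"

definition polyhedral_map :: "'a cell_map \<Rightarrow> bool" where
  "polyhedral_map M \<longleftrightarrow>
     closed_surface_map M \<and>
     (\<forall>v \<in> Verts M. 3 \<le> card {e \<in> Edges M. v \<in> e}) \<and>
     (\<forall>f \<in> Faces M. \<forall>g \<in> Faces M. f \<noteq> g \<longrightarrow>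
        \<Union> f \<inter> \<Union> g = {} \<or> (\<exists>v. \<Union> f \<inter> \<Union> g = {v}) \<or> (\<exists>e \<in> f \<inter> g. \<Union> f \<inter> \<Union> g = e))"

definition euler_char :: "'a cell_map \<Rightarrow> int" where
  "euler_char M = int (card (Verts M)) - int (card (Edges M)) + int (card (Faces M))"

definition isomorphic :: "'a cell_map \<Rightarrow> 'b cell_map \<Rightarrow> bool" where
  "isomorphic M N \<longleftrightarrow>
     (\<exists>\<phi>. bij_betw \<phi> (Verts M) (Verts N) \<and> bij_betw (image (image \<phi>)) (Faces M) (Faces N))"

definition automorphism :: "'a cell_map \<Rightarrow> ('a \<Rightarrow> 'a) \<Rightarrow> bool" where
  "automorphism M \<phi> \<longleftrightarrow>
     \<phi> permutes Verts M \<and> image \<phi> ` Edges M = Edges M \<and> image (image \<phi>) ` Faces M = Faces M"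

definition vertex_transitive :: "'a cell_map \<Rightarrow> bool" where
  "vertex_transitive M \<longleftrightarrow>
     (\<forall>u \<in> Verts M. \<forall>v \<in> Verts M. \<exists>\<phi>. automorphism M \<phi> \<and> \<phi> u = v)"

text \<open>
  The type \<open>[p\<^sub>1^n\<^sub>1, ..., p\<^sub>k^n\<^sub>k]\<close> is the list of pairs \<open>[(p\<^sub>1, n\<^sub>1), ..., (p\<^sub>k, n\<^sub>k)]\<close>. The number of
  vertices of a face is the number \<open>card f\<close> of its edges.
\<close>

definition semi_equivelar :: "(nat \<times> nat) list \<Rightarrow> 'a cell_map \<Rightarrow> bool" where
  "semi_equivelar t M \<longleftrightarrow>
     polyhedral_map M \<and>
     (\<forall>v \<in> Verts M. \<exists>fs. face_cycle M v fs \<and>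
        map card fs = concat (map (\<lambda>(p, n). replicate n p) t))"

text \<open>
  A closed surface of Euler characteristic \<open>-1\<close> is non-orientable of genus 3, since orientable
  closed surfaces have even Euler characteristic.
\<close>

definition complete_list_of_type :: "(nat \<times> nat) list \<Rightarrow> 'a cell_map list \<Rightarrow> bool" where
  "complete_list_of_type t Ks \<longleftrightarrow>
     (\<forall>K \<in> set Ks. semi_equivelar t K \<and> euler_char K = -1) \<and>
     (\<forall>i < length Ks. \<forall>j < length Ks. i \<noteq> j \<longrightarrow> \<not> isomorphic (Ks ! i) (Ks ! j)) \<and>
     (\<forall>M :: 'a cell_map. semi_equivelar t M \<and> euler_char M = -1 \<longrightarrow>
        (\<exists>K \<in> set Ks. isomorphic M K))"

definition map_of_faces :: "'a list list \<Rightarrow> 'a cell_map" where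
  "map_of_faces L =
     \<lparr>Verts = \<Union> (set ` set L), Edges = \<Union> (boundary ` set L), Faces = boundary ` set L\<rparr>"

definition K1 :: "nat cell_map" where
  "K1 = map_of_faces
    [[1, 2, 10, 9, 8], [3, 4, 18, 15, 14], [5, 12, 19, 17, 16], [6, 7, 20, 13, 11],
     [12, 3, 2, 11], [3, 4, 1, 2], [4, 5, 6, 1], [5, 12, 11, 6], [1, 6, 7, 8],
     [4, 5, 16, 18], [18, 16, 10, 13], [2, 11, 13, 10], [12, 3, 14, 19], [19, 7, 8, 14],
     [8, 9, 15, 14], [15, 18, 13, 20], [9, 17, 20, 15], [16, 17, 9, 10], [17, 19, 7, 20]]"

definition K2 :: "nat cell_map" where
  "K2 = map_of_faces
    [[1, 2, 10, 9, 8], [3, 4, 19, 18, 16], [5, 11, 13, 15, 14], [6, 7, 20, 17, 12],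
     [1, 6, 7, 8], [1, 4, 5, 6], [4, 5, 14, 19], [7, 8, 14, 19], [8, 9, 15, 14],
     [1, 2, 3, 4], [19, 7, 20, 18], [2, 10, 13, 11], [2, 3, 12, 11], [3, 16, 17, 12],
     [10, 16, 18, 13], [16, 10, 9, 17], [11, 12, 6, 5], [18, 20, 15, 13], [17, 9, 15, 20]]"

definition K3 :: "nat cell_map" where
  "K3 = map_of_faces
    [[1, 2, 10, 9, 8], [3, 4, 19, 17, 16], [5, 11, 13, 15, 14], [6, 7, 20, 18, 12],
     [1, 6, 7, 8], [1, 4, 5, 6], [4, 5, 14, 19], [7, 8, 14, 19], [8, 9, 15, 14],
     [1, 2, 3, 4], [19, 7, 20, 17], [2, 10, 13, 11], [2, 3, 12, 11], [3, 16, 18, 12],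
     [10, 16, 18, 13], [16, 10, 9, 17], [11, 12, 6, 5], [18, 20, 15, 13], [17, 9, 15, 20]]"

definition K4 :: "nat cell_map" where
  "K4 = map_of_faces
    [[1, 2, 3, 4, 5, 6, 7], [8, 9, 12, 13, 14, 15, 16], [10, 21, 20, 19, 18, 17, 11],
     [22, 23, 24, 25, 26, 27, 28], [29, 30, 31, 32, 33, 34, 35],
     [36, 37, 38, 39, 40, 41, 42], [1, 9, 8, 7], [13, 27, 28, 14], [14, 3, 4, 15],
     [7, 29, 30, 6], [8, 29, 35, 16], [9, 10, 21, 12], [1, 10, 11, 2], [36, 37, 20, 21],
     [22, 23, 17, 11], [36, 42, 13, 12], [22, 28, 3, 2], [37, 5, 6, 38], [38, 30, 31, 39],
     [39, 25, 24, 40], [40, 33, 32, 41], [23, 34, 33, 24], [25, 31, 32, 26],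
     [26, 41, 42, 27], [20, 5, 4, 19], [17, 34, 35, 18], [19, 15, 16, 18], [13, 27, 42],
     [14, 28, 3], [7, 8, 29], [1, 9, 10], [12, 21, 36], [2, 11, 22], [5, 20, 37],
     [6, 30, 38], [25, 31, 39], [24, 33, 40], [17, 23, 34], [26, 32, 41], [4, 15, 19],
     [16, 18, 35]]"

definition K5 :: "nat cell_map" where
  "K5 = map_of_faces
    [[1, 2, 3, 4, 5, 6, 7], [8, 16, 15, 14, 13, 12, 9], [10, 21, 20, 19, 18, 17, 11],
     [22, 23, 24, 25, 26, 27, 28], [29, 30, 31, 32, 33, 34, 35],
     [36, 42, 41, 40, 39, 38, 37], [2, 11, 17, 22, 28, 3], [3, 28, 27, 14, 15, 4],
     [4, 15, 16, 19, 20, 5], [5, 20, 21, 37, 38, 6], [6, 38, 39, 31, 30, 7],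
     [7, 30, 29, 8, 9, 1], [1, 9, 12, 10, 11, 2], [23, 34, 33, 41, 40, 24],
     [27, 14, 13, 36, 42, 26], [8, 16, 19, 18, 35, 29], [12, 13, 36, 37, 21, 10],
     [17, 18, 35, 34, 23, 22], [31, 32, 25, 24, 40, 39], [32, 33, 41, 42, 26, 25]]"

definition K6 :: "nat cell_map" where
  "K6 = map_of_faces
    [[1, 43, 7, 44, 6, 45, 5, 46, 4, 47, 3, 48, 2, 49],
     [8, 50, 16, 51, 15, 52, 14, 53, 13, 54, 12, 55, 9, 84],
     [10, 56, 21, 57, 20, 58, 19, 59, 18, 60, 17, 61, 11, 62],
     [22, 63, 23, 64, 24, 65, 25, 66, 26, 67, 27, 68, 28, 69],
     [29, 70, 30, 71, 31, 72, 32, 73, 33, 74, 34, 75, 35, 76],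
     [36, 77, 42, 78, 41, 79, 40, 80, 39, 81, 38, 82, 37, 83], [1, 9, 55, 10, 62, 49],
     [2, 11, 61, 22, 69, 48], [3, 28, 68, 14, 52, 47], [4, 46, 58, 19, 51, 15],
     [5, 45, 82, 37, 57, 20], [6, 38, 81, 71, 30, 44], [7, 70, 29, 8, 84, 43],
     [12, 54, 36, 83, 21, 56], [24, 64, 74, 33, 79, 40], [25, 65, 80, 39, 31, 72],
     [13, 77, 42, 67, 27, 53], [26, 78, 41, 73, 32, 66], [16, 50, 76, 35, 18, 59],
     [17, 60, 75, 34, 23, 63], [1, 43, 84, 9], [49, 62, 11, 2], [48, 69, 28, 3],
     [47, 52, 15, 4], [5, 20, 58, 46], [6, 38, 82, 45], [7, 70, 30, 44], [10, 55, 12, 56],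
     [13, 54, 36, 77], [21, 83, 37, 57], [17, 61, 22, 63], [8, 29, 76, 50], [27, 68, 14, 53],
     [67, 42, 78, 26], [66, 32, 72, 25], [24, 40, 80, 65], [23, 34, 74, 64],
     [31, 71, 81, 39], [33, 73, 41, 79], [35, 75, 60, 18], [16, 51, 19, 59]]"

definition K7 :: "nat cell_map" where
  "K7 = map_of_faces
    [[1, 21, 2, 22, 10, 23, 9, 24, 8, 25], [3, 26, 4, 27, 18, 28, 15, 29, 14, 30],
     [6, 31, 7, 32, 20, 33, 13, 34, 11, 35], [5, 36, 12, 37, 19, 38, 17, 39, 16, 40],
     [26, 4, 40, 5, 35, 6, 25, 1], [22, 13, 33, 18, 27, 16, 39, 10],
     [29, 24, 8, 31, 7, 19, 37, 14], [32, 38, 17, 23, 9, 15, 28, 20],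
     [12, 30, 3, 21, 2, 34, 11, 36], [1, 26, 3, 21], [6, 25, 8, 31], [5, 35, 11, 36],
     [4, 27, 16, 40], [10, 39, 17, 23], [2, 22, 13, 34], [14, 37, 12, 30], [29, 24, 9, 15],
     [20, 28, 18, 33], [32, 38, 19, 7]]"

end

theory Submission
  imports Defs
begin

text \<open>
  The maps \<open>K\<^sub>1, \<dots>, K\<^sub>7\<close> are separated by counting: the number of pairs of \<open>p\<close>-gons, the first one
  through a given vertex, that have no common neighbour among the \<open>r\<close>-gons is invariant under
  automorphisms, and for suitable \<open>p\<close> and \<open>r\<close> it differs at two vertices.

  The other five types admit no vertex-transitive map at all on the surface. We work with flags and
  their three switches, and with flag permutations that commute with the switches. Type
  \<open>[3,4,3,4,4]\<close> is excluded by a local parity argument at the triangles. In the other types there are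
  exactly three disjoint largest faces. The types \<open>[4,6,16]\<close>, \<open>[3,4,8,4]\<close> and \<open>[6,6,8]\<close> come from
  triangulations with three vertices of degree 8. Since the neighbours of each vertex alternate
  between the two others, transitivity gives a symmetry that rotates at one vertex by a quarter turn
  and fixes the other two, where it must also rotate by a quarter turn; these rotations cannot be
  matched around the triangles. In type \<open>[3\<^sup>5,4]\<close> every vertex is the apex of exactly
  one triangle over an edge of a square. If this is always the middle triangle at the vertex, then
  sending a square edge to its apex has order three up to the symmetries of the squares and is
  incompatible with a rotation of a square. Otherwise, apices pair the vertices so that all vertices
  of a square have partners in the same other square, which is impossible for three squares.
\<close>

section \<open>Flags of polyhedral maps\<close>

text \<open>The maps \<open>K8\<close>, ..., \<open>K17\<close> come without face lists: they are
  given only through complete lists, so they are excluded by statements about every map of the type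
  with Euler characteristic -1. Shrinking each largest face to a point produces the triangulations:
  the hexagons, or in type [3,4,8,4] the small triangles, become the triangles, while the squares,
  or in type [6,6,8] the edges between two hexagons, become the edges. The main obstacle is that
  transitivity prescribes only the image of a vertex. Even if the vertex lies on a single p-gon, a
  flag of that p-gon has two possible images, which differ by the reflection \<open>r1\<close>. The
  proofs combine several symmetries to obtain a genuine rotation despite this choice, and they
  exclude that it acts as a reflection elsewhere. Flags turn the geometry into identities between
  words in the switches, and commutation with the switches carries the value of a symmetry from one
  flag to its neighbours.\<close>

datatype 'a flag = Flag (vert: 'a) (edge: "'a set") (face: "'a set set")

definition flags :: "'a cell_map \<Rightarrow> 'a flag set" where
  "flags M = {x. face x \<in> Faces M \<and> edge x \<in> face x \<and> vert x \<in> edge x}"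

abbreviation sz :: "'a flag \<Rightarrow> nat" where "sz x \<equiv> card (face x)"

fun r0 :: "'a flag \<Rightarrow> 'a flag" where
  "r0 (Flag v e f) = Flag (THE u. u \<in> e \<and> u \<noteq> v) e f"

fun r1 :: "'a flag \<Rightarrow> 'a flag" where
  "r1 (Flag v e f) = Flag v (THE d. d \<in> f \<and> v \<in> d \<and> d \<noteq> e) f"

definition rot :: "'a flag \<Rightarrow> 'a flag" where "rot x = r1 (r0 x)"

section \<open>Cyclic parametrisation of face boundaries\<close>

text \<open>Indexing a boundary cycle by all integers turns a change of the starting point and a
  reversal into substitutions, without wrap-around cases. The first conjunct makes \<open>h\<close>
  periodic with period \<open>n\<close> and injective on residues.\<close>

definition cyclic_param :: "nat \<Rightarrow> (int \<Rightarrow> 'a) \<Rightarrow> 'a set set \<Rightarrow> bool" where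
  "cyclic_param n h f \<longleftrightarrow>
     (\<forall>i j. h i = h j \<longleftrightarrow> i mod int n = j mod int n) \<and> f = range (\<lambda>i. {h i, h (i + 1)})"

lemma cyclic_param_shift:
  assumes "cyclic_param n h f" shows "cyclic_param n (\<lambda>i. h (i + k)) f"
proof -
  have "h (i + k) = h (j + k) \<longleftrightarrow> i mod int n = j mod int n" for i j
    using assms unfolding cyclic_param_def
    by (metis add_diff_cancel_right' mod_add_cong mod_diff_cong)
  moreover have "range (\<lambda>i. {h i, h (i + 1)}) = range (\<lambda>i. {h (i + k), h (i + 1 + k)})"
  proof -
    have "{h i, h (i + 1)} \<in> range (\<lambda>i. {h (i + k), h (i + 1 + k)})" for i
      by (rule range_eqI[of _ _ "i - k"]) simp
    moreover have "{h (i + k), h (i + 1 + k)} \<in> range (\<lambda>i. {h i, h (i + 1)})" for i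
      by (rule range_eqI[of _ _ "i + k"]) (simp add: add.commute add.left_commute)
    ultimately show ?thesis by blast
  qed
  ultimately show ?thesis using assms by (simp add: cyclic_param_def)
qed

lemma cyclic_param_reflect:
  assumes "cyclic_param n h f" shows "cyclic_param n (\<lambda>i. h (- i)) f"
proof -
  have "h (- i) = h (- j) \<longleftrightarrow> i mod int n = j mod int n" for i j
    using assms unfolding cyclic_param_def by (metis mod_minus_cong add.inverse_inverse)
  moreover have "range (\<lambda>i. {h i, h (i + 1)}) = range (\<lambda>i. {h (- i), h (- (i + 1))})"
  proof -
    have "{h i, h (i + 1)} \<in> range (\<lambda>i. {h (- i), h (- (i + 1))})" for i
      by (rule range_eqI[of _ _ "- i - 1"]) (simp add: add.commute insert_commute)
    moreover have "{h (- i), h (- (i + 1))} \<in> range (\<lambda>i. {h i, h (i + 1)})" for i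
      by (rule range_eqI[of _ _ "- i - 1"]) (simp add: insert_commute)
    ultimately show ?thesis by blast
  qed
  ultimately show ?thesis using assms by (simp add: cyclic_param_def)
qed

lemma nat_mod_Suc: "0 < n \<Longrightarrow> nat ((i + 1) mod int n) = Suc (nat (i mod int n)) mod n"
proof -
  assume "0 < n"
  then have "int (Suc (nat (i mod int n)) mod n) = (i + 1) mod int n"
    by (simp add: zmod_int mod_simps add.commute)
  then show ?thesis by simp
qed

lemma boundary_cyclic_param:
  assumes "xs \<noteq> []" "distinct xs"
  shows "cyclic_param (length xs) (\<lambda>i. xs ! nat (i mod int (length xs))) (boundary xs)"
proof -
  let ?n = "length xs" and ?h = "\<lambda>i. xs ! nat (i mod int (length xs))"
  have n: "?n > 0" using assms by simp
  have lt: "nat (i mod int ?n) < ?n" for i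
    using n by (simp add: nat_less_iff)
  have "?h i = ?h j \<longleftrightarrow> i mod int ?n = j mod int ?n" for i j
    using n by (simp add: nth_eq_iff_index_eq[OF assms(2) lt lt] eq_nat_nat_iff)
  moreover have "boundary xs = range (\<lambda>i. {?h i, ?h (i + 1)})"
  proof (intro equalityI subsetI)
    fix e assume "e \<in> boundary xs"
    then obtain i where i: "i < ?n" "e = {xs ! i, xs ! (Suc i mod ?n)}"
      by (auto simp: boundary_def)
    have "?h (int i) = xs ! i" using i by simp
    moreover have "?h (int i + 1) = xs ! (Suc i mod ?n)"
    proof -
      have "(int i + 1) mod int ?n = int (Suc i mod ?n)" by (simp add: zmod_int add.commute)
      then show ?thesis by simp
    qed
    ultimately show "e \<in> range (\<lambda>i. {?h i, ?h (i + 1)})"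
      using i by (intro range_eqI[of _ _ "int i"]) simp
  next
    fix e assume "e \<in> range (\<lambda>i. {?h i, ?h (i + 1)})"
    then obtain i where e: "e = {?h i, ?h (i + 1)}" by auto
    define k where "k = nat (i mod int ?n)"
    have "nat ((i + 1) mod int ?n) = Suc k mod ?n" unfolding k_def using n by (rule nat_mod_Suc)
    then have "e = {xs ! k, xs ! (Suc k mod ?n)}" using e by (simp only: k_def)
    moreover have "k < ?n" using lt[of i] by (simp only: k_def)
    ultimately show "e \<in> boundary xs" unfolding boundary_def by blast
  qed
  ultimately show ?thesis by (simp add: cyclic_param_def)
qed

lemma cyclic_param_card:
  assumes "cyclic_param n h f" "3 \<le> n"
  shows "card f = n" "\<Union> f = range h" "card (range h) = n"
proof -
  let ?g = "\<lambda>i. {h i, h (i + 1)}"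
  have h: "\<And>i j. h i = h j \<longleftrightarrow> i mod int n = j mod int n" and f: "f = range ?g"
    using assms by (auto simp: cyclic_param_def)
  have n: "0 < int n" using assms by simp
  have red: "h i = h (i mod int n)" "h (i + 1) = h (i mod int n + 1)" for i
    by (simp_all add: h mod_add_left_eq)
  have im: "f = ?g ` {0..<int n}"
  proof -
    have "?g i \<in> ?g ` {0..<int n}" for i
      using red[of i] n by (intro image_eqI[of _ _ "i mod int n"]) simp_all
    then show ?thesis unfolding f by blast
  qed
  have "inj_on ?g {0..<int n}"
  proof (rule inj_onI)
    fix i j assume ij: "i \<in> {0..<int n}" "j \<in> {0..<int n}" "?g i = ?g j"
    show "i = j"
    proof (rule ccontr)
      assume "i \<noteq> j"
      then have "h i \<noteq> h j" using ij h by auto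
      with ij(3) have "h i = h (j + 1)" "h (i + 1) = h j" by (auto simp: doubleton_eq_iff)
      then have "i mod int n = (j + 1) mod int n" "(i + 1) mod int n = j mod int n"
        using h by auto
      then have "int n dvd i - (j + 1)" "int n dvd i + 1 - j" by (auto simp: mod_eq_dvd_iff)
      \<comment> \<open>Equal edges with different first vertices would be traversed in opposite
        directions, which makes \<open>n\<close> a divisor of 2.\<close>
      then have "int n dvd (i + 1 - j) - (i - (j + 1))" using dvd_diff by blast
      then have "int n dvd 2" by simp
      then show False using assms(2) zdvd_imp_le by fastforce
    qed
  qed
  then show "card f = n" by (simp add: im card_image)
  show "\<Union> f = range h" by (auto simp: f)
  have "range h = h ` {0..<int n}"
  proof -
    have "h i \<in> h ` {0..<int n}" for i
      using red[of i] n by (intro image_eqI[of _ _ "i mod int n"]) simp_all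
    then show ?thesis by blast
  qed
  moreover have "inj_on h {0..<int n}" by (rule inj_onI) (auto simp: h)
  ultimately show "card (range h) = n" by (simp add: card_image)
qed

lemma cyclic_param_neq:
  assumes "cyclic_param n h f" "0 < k" "k < int n"
  shows "h i \<noteq> h (i + k)" "h (i + k) \<noteq> h i"
proof -
  have "\<not> int n dvd k" using assms zdvd_not_zless by blast
  then have "i mod int n \<noteq> (i + k) mod int n" by (simp add: mod_eq_dvd_iff dvd_minus_iff)
  then show "h i \<noteq> h (i + k)" "h (i + k) \<noteq> h i" using assms(1) by (auto simp: cyclic_param_def)
qed

lemma cyclic_param_edges_at:
  assumes c: "cyclic_param n h f" and n: "3 \<le> n" and d: "d \<in> f" "h i \<in> d"
  shows "d = {h i, h (i + 1)} \<or> d = {h (i - 1), h i}"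
proof -
  from d c obtain j where j: "d = {h j, h (j + 1)}" by (auto simp: cyclic_param_def)
  with d consider "h i = h j" | "h i = h (j + 1)" by auto
  then show ?thesis
  proof cases
    case 1
    then have "i mod int n = j mod int n" using c by (auto simp: cyclic_param_def)
    then have "(i + 1) mod int n = (j + 1) mod int n" by (rule mod_add_cong) simp
    then have "h (i + 1) = h (j + 1)" using c by (simp add: cyclic_param_def)
    then show ?thesis using 1 j by simp
  next
    case 2
    then have "i mod int n = (j + 1) mod int n" using c by (auto simp: cyclic_param_def)
    then have "(i - 1) mod int n = (j + 1 - 1) mod int n" by (rule mod_diff_cong) simp
    then have "h (i - 1) = h j" using c by (simp add: cyclic_param_def)
    then show ?thesis using 2 j by simp
  qed
qed

lemma cyclic_param_adjacent_edges:
  assumes c: "cyclic_param n h f" and n: "3 \<le> n"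
  shows "{h i, h (i + 1)} \<noteq> {h (i - 1), h i}"
proof -
  have "h (i - 1) \<noteq> h i" "h (i - 1) \<noteq> h (i + 1)"
    using cyclic_param_neq(1)[OF c, of 1 "i - 1"] cyclic_param_neq(1)[OF c, of 2 "i - 1"] n
    by (simp_all add: add.commute)
  then show ?thesis by (metis doubleton_eq_iff)
qed

lemma cyclic_param_not_edge:
  assumes c: "cyclic_param n h f" and n: "4 \<le> n"
  shows "{h i, h (i + 2)} \<notin> f"
proof
  assume "{h i, h (i + 2)} \<in> f"
  then have "{h i, h (i + 2)} = {h i, h (i + 1)} \<or> {h i, h (i + 2)} = {h (i - 1), h i}"
    using cyclic_param_edges_at[OF c] n by auto
  moreover have "h (i + 1) \<noteq> h (i + 2)" "h i \<noteq> h (i + 2)" "h (i - 1) \<noteq> h (i + 2)"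
    using cyclic_param_neq(1)[OF c, of 1 "i + 1"] cyclic_param_neq(1)[OF c, of 2 i]
      cyclic_param_neq(1)[OF c, of 3 "i - 1"] n by (simp_all add: add.commute)
  ultimately show False by (metis doubleton_eq_iff)
qed

section \<open>Switches of flags within faces and across edges\<close>

locale polyhedral =
  fixes M :: "'a cell_map"
  assumes polyhedral_map: "polyhedral_map M"
begin

abbreviation X where "X \<equiv> flags M"

fun r2 :: "'a flag \<Rightarrow> 'a flag" where
  "r2 (Flag v e f) = Flag v e (THE g. g \<in> Faces M \<and> e \<in> g \<and> g \<noteq> f)"

lemma closed_surface: "closed_surface_map M"
  using polyhedral_map by (simp add: polyhedral_map_def)

lemma
  shows edges_card: "\<forall>e \<in> Edges M. e \<subseteq> Verts M \<and> card e = 2"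
    and faces_boundary: "\<forall>f \<in> Faces M. f \<subseteq> Edges M \<and>
      (\<exists>xs. 3 \<le> length xs \<and> distinct xs \<and> f = boundary xs)"
    and edges_two_faces: "\<forall>e \<in> Edges M. card {f \<in> Faces M. e \<in> f} = 2"
proof -
  note c = closed_surface[unfolded closed_surface_map_def]
  show "\<forall>e \<in> Edges M. e \<subseteq> Verts M \<and> card e = 2" using c by (elim conjE)
  show "\<forall>f \<in> Faces M. f \<subseteq> Edges M \<and>
      (\<exists>xs. 3 \<le> length xs \<and> distinct xs \<and> f = boundary xs)" using c by (elim conjE)
  show "\<forall>e \<in> Edges M. card {f \<in> Faces M. e \<in> f} = 2" using c by (elim conjE)
qed

lemma face_boundary:
  assumes "f \<in> Faces M"
  obtains xs where "3 \<le> length xs" "distinct xs" "f = boundary xs"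
  using assms faces_boundary that by meson

lemma face_cyclic_param:
  assumes "f \<in> Faces M"
  obtains h where "cyclic_param (card f) h f" "3 \<le> card f"
proof -
  obtain xs where xs: "3 \<le> length xs" "distinct xs" "f = boundary xs"
    using face_boundary[OF assms] .
  then have "xs \<noteq> []" by auto
  from boundary_cyclic_param[OF this xs(2)] have c: "cyclic_param (length xs) (\<lambda>i. xs ! nat (i mod int (length xs))) f"
    by (simp add: xs(3))
  from that[OF _ ] this show thesis
    unfolding cyclic_param_card(1)[OF c xs(1), symmetric] using xs(1) cyclic_param_card(1)[OF c xs(1)] by metis
qed

lemma face_card: "f \<in> Faces M \<Longrightarrow> 3 \<le> card f \<and> card (\<Union> f) = card f"
  by (metis cyclic_param_card(2,3) face_cyclic_param)

lemma face_param:
  assumes "x \<in> X"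
  obtains h f where "cyclic_param (card f) h f" "3 \<le> card f" "f \<in> Faces M" "x = Flag (h 0) {h 0, h 1} f"
proof -
  obtain v e f where x: "x = Flag v e f" by (cases x)
  with assms have f: "f \<in> Faces M" "e \<in> f" "v \<in> e" by (auto simp: flags_def)
  obtain h where h: "cyclic_param (card f) h f" and n: "3 \<le> card f"
    using face_cyclic_param[OF f(1)] .
  obtain i where i: "e = {h i, h (i + 1)}" using f h by (auto simp: cyclic_param_def)
  with f consider "v = h i" | "v = h (i + 1)" by auto
  then show thesis
  proof cases
    case 1
    then show ?thesis using that[of f "\<lambda>j. h (j + i)"] cyclic_param_shift[OF h] i x n f
      by (simp add: add.commute)
  next
    case 2
    \<comment> \<open>The vertex of the flag is the second end of its edge along \<open>h\<close>,
      so the boundary is read backwards from index \<open>i + 1\<close>.\<close>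
    have "cyclic_param (card f) (\<lambda>j. h (- j + (i + 1))) f"
      using cyclic_param_reflect[OF cyclic_param_shift[OF h, of "i + 1"]] by simp
    then show ?thesis using that[of f "\<lambda>j. h (- j + (i + 1))"] i x 2 n f by (simp add: insert_commute)
  qed
qed

lemma
  assumes c: "cyclic_param n h f" and n: "3 \<le> n"
  shows r0_param: "r0 (Flag (h i) {h i, h (i + 1)} f) = Flag (h (i + 1)) {h i, h (i + 1)} f"
    and r0_param': "r0 (Flag (h (i + 1)) {h i, h (i + 1)} f) = Flag (h i) {h i, h (i + 1)} f"
    and r1_param: "r1 (Flag (h i) {h i, h (i + 1)} f) = Flag (h i) {h (i - 1), h i} f"
    and r1_param': "r1 (Flag (h i) {h (i - 1), h i} f) = Flag (h i) {h i, h (i + 1)} f"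
proof -
  note ne = cyclic_param_neq[OF c, of 1 i]
  show "r0 (Flag (h i) {h i, h (i + 1)} f) = Flag (h (i + 1)) {h i, h (i + 1)} f"
    "r0 (Flag (h (i + 1)) {h i, h (i + 1)} f) = Flag (h i) {h i, h (i + 1)} f"
    using ne n by (auto intro!: the_equality)
  have mem: "{h i, h (i + 1)} \<in> f" for i using c by (auto simp: cyclic_param_def)
  have mem': "{h (i - 1), h i} \<in> f" using mem[of "i - 1"] by simp
  note adj = cyclic_param_adjacent_edges[OF c n, of i]
  note at = cyclic_param_edges_at[OF c n, of _ i]
  have "(THE d. d \<in> f \<and> h i \<in> d \<and> d \<noteq> {h i, h (i + 1)}) = {h (i - 1), h i}"
  proof (rule the_equality)
    show "{h (i - 1), h i} \<in> f \<and> h i \<in> {h (i - 1), h i} \<and> {h (i - 1), h i} \<noteq> {h i, h (i + 1)}"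
      using mem' adj by auto
    show "d = {h (i - 1), h i}" if "d \<in> f \<and> h i \<in> d \<and> d \<noteq> {h i, h (i + 1)}" for d
      using at[of d] that by blast
  qed
  then show "r1 (Flag (h i) {h i, h (i + 1)} f) = Flag (h i) {h (i - 1), h i} f" by simp
  have "(THE d. d \<in> f \<and> h i \<in> d \<and> d \<noteq> {h (i - 1), h i}) = {h i, h (i + 1)}"
  proof (rule the_equality)
    show "{h i, h (i + 1)} \<in> f \<and> h i \<in> {h i, h (i + 1)} \<and> {h i, h (i + 1)} \<noteq> {h (i - 1), h i}"
      using mem adj by auto
    show "d = {h i, h (i + 1)}" if "d \<in> f \<and> h i \<in> d \<and> d \<noteq> {h (i - 1), h i}" for d
      using at[of d] that by blast
  qed
  then show "r1 (Flag (h i) {h (i - 1), h i} f) = Flag (h i) {h i, h (i + 1)} f" by simp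
qed

lemma rot_param:
  assumes c: "cyclic_param n h f" and n: "3 \<le> n"
  shows "(rot ^^ k) (Flag (h 0) {h 0, h 1} f) = Flag (h (int k)) {h (int k), h (int k + 1)} f"
proof (induction k)
  case (Suc k)
  then show ?case
    using r0_param[OF c n, of "int k"] r1_param'[OF c n, of "int k + 1"]
    by (simp add: rot_def add.commute)
qed simp

lemma flags_r01 [simp]:
  assumes "x \<in> X"
  shows "r0 x \<in> X" "r1 x \<in> X" "r0 (r0 x) = x" "r1 (r1 x) = x"
    "face (r0 x) = face x" "face (r1 x) = face x" "vert (r1 x) = vert x"
    "edge (r0 x) = edge x" "vert (r0 x) \<noteq> vert x" "r1 x \<noteq> x" "r0 x \<noteq> x"
    "edge (r1 x) \<noteq> edge x"
proof -
  obtain h f where h: "cyclic_param (card f) h f" and n: "3 \<le> card f" and f: "f \<in> Faces M"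
    and x: "x = Flag (h 0) {h 0, h 1} f" using face_param[OF assms] .
  have [simp]: "h 1 \<noteq> h 0" using cyclic_param_neq[OF h, of 1 0] n by simp
  have mem: "{h i, h (i + 1)} \<in> f" for i using h by (auto simp: cyclic_param_def)
  have mem': "{h (- 1), h 0} \<in> f" using mem[of "- 1"] by simp
  have a: "r0 x = Flag (h 1) {h 0, h 1} f" "r1 x = Flag (h 0) {h (- 1), h 0} f"
    unfolding x using r0_param[OF h n, of 0] r1_param[OF h n, of 0] by (simp_all del: r0.simps r1.simps)
  show "r0 x \<in> X" "r1 x \<in> X" using f mem[of 0] mem' by (auto simp: a flags_def)
  show "r0 (r0 x) = x" "r1 (r1 x) = x"
    unfolding a using r0_param'[OF h n, of 0] r1_param'[OF h n, of 0] x by simp_all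
  have ad: "{h (- 1), h 0} \<noteq> {h 0, h 1}" using cyclic_param_adjacent_edges[OF h n, of 0] by simp
  show "face (r0 x) = face x" "face (r1 x) = face x" "vert (r1 x) = vert x"
    "edge (r0 x) = edge x" "vert (r0 x) \<noteq> vert x" "edge (r1 x) \<noteq> edge x"
    using ad unfolding a by (simp_all add: x)
  then show "r1 x \<noteq> x" "r0 x \<noteq> x" by auto
qed

lemma edge_card: "f \<in> Faces M \<Longrightarrow> e \<in> f \<Longrightarrow> e \<in> Edges M \<and> card e = 2"
proof -
  assume a: "f \<in> Faces M" "e \<in> f"
  then show ?thesis using faces_boundary edges_card by blast
qed

lemma edge_two_faces:
  assumes "f \<in> Faces M" "e \<in> f"
  obtains g where "g \<in> Faces M" "e \<in> g" "g \<noteq> f"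
    "\<And>k. k \<in> Faces M \<Longrightarrow> e \<in> k \<Longrightarrow> k = f \<or> k = g"
proof -
  have "card {f \<in> Faces M. e \<in> f} = 2" using edges_two_faces edge_card[OF assms] by blast
  then obtain a b where ab: "{f \<in> Faces M. e \<in> f} = {a, b}" "a \<noteq> b" by (meson card_2_iff)
  then have f: "f = a \<or> f = b" using assms by blast
  have m: "a \<in> Faces M \<and> e \<in> a" "b \<in> Faces M \<and> e \<in> b" using ab by blast+
  have "k = a \<or> k = b" if "k \<in> Faces M" "e \<in> k" for k using ab that by blast
  with that[of a] that[of b] f m ab(2) show ?thesis by metis
qed

lemma flags_r2 [simp]:
  assumes "x \<in> X"
  shows "r2 x \<in> X" "r2 (r2 x) = x" "vert (r2 x) = vert x" "edge (r2 x) = edge x"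
    "face (r2 x) \<noteq> face x" "r2 (r0 x) = r0 (r2 x)"
proof -
  obtain v e f where x: "x = Flag v e f" by (cases x)
  with assms have f: "f \<in> Faces M" "e \<in> f" "v \<in> e" by (auto simp: flags_def)
  obtain g where g: "g \<in> Faces M" "e \<in> g" "g \<noteq> f"
    "\<And>k. k \<in> Faces M \<Longrightarrow> e \<in> k \<Longrightarrow> k = f \<or> k = g" using edge_two_faces[OF f(1,2)] by metis
  have t: "(THE k. k \<in> Faces M \<and> e \<in> k \<and> k \<noteq> f) = g"
    by (rule the_equality) (use g in blast)+
  have t': "(THE k. k \<in> Faces M \<and> e \<in> k \<and> k \<noteq> g) = f"
    by (rule the_equality) (use g f in blast)+
  show "r2 x \<in> X" "r2 (r2 x) = x" "vert (r2 x) = vert x" "edge (r2 x) = edge x"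
    "face (r2 x) \<noteq> face x" "r2 (r0 x) = r0 (r2 x)"
    using f g by (simp_all add: x t t' flags_def)
qed

lemma flag_simps:
  assumes "x \<in> X"
  shows "face x \<in> Faces M" "edge x \<in> face x" "vert x \<in> edge x" "vert x \<in> \<Union> (face x)"
    "vert x \<in> Verts M" "edge x = {vert x, vert (r0 x)}"
proof -
  show f: "face x \<in> Faces M" "edge x \<in> face x" "vert x \<in> edge x"
    using assms by (auto simp: flags_def)
  then show "vert x \<in> \<Union> (face x)" by blast
  from f edge_card edges_card show "vert x \<in> Verts M" by blast
  have "card (edge x) = 2" using f edge_card by blast
  moreover have "vert (r0 x) \<in> edge x"
    using flags_r01(1,8)[OF assms] by (simp add: flags_def)
  ultimately show "edge x = {vert x, vert (r0 x)}"
    using f(3) flags_r01(9)[OF assms] by (metis card_2_iff doubleton_eq_iff insertE singletonD)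
qed

lemma face_at_edge: "x \<in> X \<Longrightarrow> g \<in> Faces M \<Longrightarrow> edge x \<in> g \<Longrightarrow> g = face x \<or> g = face (r2 x)"
  by (metis edge_two_faces flag_simps(1,2) flags_r2(1,4,5))

lemma flag_eqI: "vert x = vert y \<Longrightarrow> edge x = edge y \<Longrightarrow> face x = face y \<Longrightarrow> x = y"
  by (rule flag.expand) simp

text \<open>With its two companions for \<open>r1\<close> and \<open>r2\<close> this replaces the
  definite descriptions: a flag that agrees with \<open>x\<close> in two components and differs from
  \<open>x\<close> must be the corresponding switch of \<open>x\<close>.\<close>

lemma r0_unique:
  assumes "x \<in> X" "y \<in> X" "edge y = edge x" "face y = face x" "y \<noteq> x" shows "y = r0 x"
proof -
  have "vert y \<in> {vert x, vert (r0 x)}" using flag_simps(3)[OF assms(2)] flag_simps(6)[OF assms(1)] assms by simp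
  then show ?thesis using assms flag_eqI[of y x] flag_eqI[of y "r0 x"] by auto
qed

lemma r1_unique:
  assumes "x \<in> X" "y \<in> X" "vert y = vert x" "face y = face x" "y \<noteq> x" shows "y = r1 x"
proof -
  obtain h f where h: "cyclic_param (card f) h f" and n: "3 \<le> card f" and f: "f \<in> Faces M"
    and x: "x = Flag (h 0) {h 0, h 1} f" using face_param[OF assms(1)] .
  have "edge y \<in> f" "h 0 \<in> edge y" using assms(3,4) flag_simps(2,3)[OF assms(2)] x by auto
  then have "edge y = {h 0, h 1} \<or> edge y = {h (-1), h 0}"
    using cyclic_param_edges_at[OF h n, of _ 0] by simp
  moreover have "r1 x = Flag (h 0) {h (-1), h 0} f" using r1_param[OF h n, of 0] x by simp
  ultimately show ?thesis
    using flag_eqI[of y x] flag_eqI[of y "r1 x"] assms(3-5) x by auto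
qed

lemma r2_unique:
  assumes "x \<in> X" "y \<in> X" "vert y = vert x" "edge y = edge x" "y \<noteq> x" shows "y = r2 x"
proof -
  have "face y = face x \<or> face y = face (r2 x)"
    using assms flag_simps(1,2)[OF assms(2)] face_at_edge by simp
  then show ?thesis using assms flag_eqI[of y x] flag_eqI[of y "r2 x"] by auto
qed

lemma rot_closed [simp]:
  assumes "x \<in> X" shows "rot x \<in> X" "face (rot x) = face x" "(rot ^^ k) x \<in> X" "face ((rot ^^ k) x) = face x"
proof -
  show "rot x \<in> X" "face (rot x) = face x" using assms by (simp_all add: rot_def)
  have "(rot ^^ k) x \<in> X \<and> face ((rot ^^ k) x) = face x"
    by (induction k) (use assms in \<open>simp_all add: rot_def\<close>)
  then show "(rot ^^ k) x \<in> X" "face ((rot ^^ k) x) = face x" by auto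
qed

lemma rot_pow_eq_iff:
  assumes "x \<in> X" shows "(rot ^^ k) x = x \<longleftrightarrow> sz x dvd k"
proof -
  obtain h f where h: "cyclic_param (card f) h f" and n: "3 \<le> card f"
    and x: "x = Flag (h 0) {h 0, h 1} f" using face_param[OF assms] .
  have r: "(rot ^^ k) x = Flag (h (int k)) {h (int k), h (int k + 1)} f"
    using rot_param[OF h n] x by simp
  have e: "h (int k) = h 0 \<longleftrightarrow> card f dvd k"
    using h by (simp add: cyclic_param_def) (metis dvd_eq_mod_eq_0 int_dvd_int_iff)
  moreover have "h (int k + 1) = h 1" if "h (int k) = h 0"
  proof -
    have "int k mod int (card f) = 0 mod int (card f)" using that h by (simp add: cyclic_param_def)
    then have "(int k + 1) mod int (card f) = (0 + 1) mod int (card f)" by (rule mod_add_cong) simp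
    then show ?thesis using h by (simp add: cyclic_param_def)
  qed
  ultimately show ?thesis using r x by auto
qed

text \<open>The flags of an n-gon form one orbit of its dihedral group of order 2n: n rotations and
  n reflections.\<close>

lemma same_face_cases:
  assumes "x \<in> X" "y \<in> X" "face y = face x"
  obtains k where "k < sz x" "y = (rot ^^ k) x \<or> y = r0 ((rot ^^ k) x)"
proof -
  obtain h f where h: "cyclic_param (card f) h f" and n: "3 \<le> card f"
    and x: "x = Flag (h 0) {h 0, h 1} f" using face_param[OF assms(1)] .
  have r: "(rot ^^ k) x = Flag (h (int k)) {h (int k), h (int k + 1)} f" for k
    using rot_param[OF h n] x by simp
  have "edge y \<in> f" using assms flag_simps(2)[OF assms(2)] x by simp
  then obtain j where j: "edge y = {h j, h (j + 1)}" using h by (auto simp: cyclic_param_def)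
  define k where "k = nat (j mod int (card f))"
  have k: "int k = j mod int (card f)" "k < card f" using n by (simp_all add: k_def nat_less_iff)
  have "h j = h (int k)" "h (j + 1) = h (int k + 1)"
    using h by (simp_all add: cyclic_param_def k mod_add_left_eq)
  then have e: "edge y = edge ((rot ^^ k) x)" using j r by simp
  have "y = (rot ^^ k) x \<or> y = r0 ((rot ^^ k) x)"
    using r0_unique[of "(rot ^^ k) x" y] e assms by auto
  then show thesis using that k(2) x by simp
qed

text \<open>On an n-gon the word \<open>rot ^^ n\<close> is trivial. Since the switches are
  involutions, half of this alternating word can be moved to the other side; these are the relations
  used to rewrite paths in triangles, squares and hexagons.\<close>

lemma r0_r1_order:
  assumes "x \<in> X"
  shows "sz x = 3 \<Longrightarrow> r0 (r1 (r0 x)) = r1 (r0 (r1 x))"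
    and "sz x = 4 \<Longrightarrow> r0 (r1 (r0 (r1 x))) = r1 (r0 (r1 (r0 x)))"
    and "sz x = 6 \<Longrightarrow> r0 (r1 (r0 (r1 (r0 (r1 x))))) = r1 (r0 (r1 (r0 (r1 (r0 x)))))"
proof -
  have 3: "r0 (r1 (r0 x)) = r1 (r0 (r1 ((rot ^^ 3) x)))"
    using assms by (simp add: rot_def numeral_eq_Suc)
  have 4: "r1 (r0 (r1 (r0 x))) = r0 (r1 (r0 (r1 ((rot ^^ 4) x))))"
    using assms by (simp add: rot_def numeral_eq_Suc)
  have 6: "r1 (r0 (r1 (r0 (r1 (r0 x))))) = r0 (r1 (r0 (r1 (r0 (r1 ((rot ^^ 6) x))))))"
    using assms by (simp add: rot_def numeral_eq_Suc)
  show "sz x = 3 \<Longrightarrow> r0 (r1 (r0 x)) = r1 (r0 (r1 x))"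
    using 3 rot_pow_eq_iff[OF assms, of 3] by simp
  show "sz x = 4 \<Longrightarrow> r0 (r1 (r0 (r1 x))) = r1 (r0 (r1 (r0 x)))"
    using 4 rot_pow_eq_iff[OF assms, of 4] by simp
  show "sz x = 6 \<Longrightarrow> r0 (r1 (r0 (r1 (r0 (r1 x))))) = r1 (r0 (r1 (r0 (r1 (r0 x)))))"
    using 6 rot_pow_eq_iff[OF assms, of 6] by simp
qed

lemma common_vertices_edge:
  assumes "f \<in> Faces M" "g \<in> Faces M" "f \<noteq> g" "u \<noteq> v" "u \<in> \<Union> f" "u \<in> \<Union> g" "v \<in> \<Union> f" "v \<in> \<Union> g"
  shows "{u, v} \<in> f" "{u, v} \<in> g"
proof -
  have "\<forall>f \<in> Faces M. \<forall>g \<in> Faces M. f \<noteq> g \<longrightarrow>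
      \<Union> f \<inter> \<Union> g = {} \<or> (\<exists>v. \<Union> f \<inter> \<Union> g = {v}) \<or> (\<exists>e \<in> f \<inter> g. \<Union> f \<inter> \<Union> g = e)"
    using polyhedral_map unfolding polyhedral_map_def by (elim conjE)
  then have "\<Union> f \<inter> \<Union> g = {} \<or> (\<exists>v. \<Union> f \<inter> \<Union> g = {v}) \<or> (\<exists>e \<in> f \<inter> g. \<Union> f \<inter> \<Union> g = e)"
    using assms(1-3) by blast
  moreover have u: "u \<in> \<Union> f \<inter> \<Union> g" "v \<in> \<Union> f \<inter> \<Union> g" using assms by blast+
  ultimately obtain e where e: "e \<in> f" "e \<in> g" "\<Union> f \<inter> \<Union> g = e"
    using assms(4) by (metis IntE empty_iff singletonD)
  have "card e = 2" using edge_card[OF assms(1) e(1)] by simp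
  then have "e = {u, v}" using u assms(4) unfolding e(3)
    by (metis card_2_iff doubleton_eq_iff insertE singletonD)
  with e show "{u, v} \<in> f" "{u, v} \<in> g" by auto
qed

lemma common_edge:
  assumes "x \<in> X" "g \<in> Faces M" "vert x \<in> \<Union> g" "vert (r0 x) \<in> \<Union> g"
  shows "g = face x \<or> g = face (r2 x)"
proof (rule ccontr)
  assume n: "\<not> (g = face x \<or> g = face (r2 x))"
  have "vert (r0 x) \<in> \<Union> (face x)" using flag_simps(4)[of "r0 x"] assms(1) by simp
  then have "{vert x, vert (r0 x)} \<in> g"
    using common_vertices_edge(2)[of "face x" g] assms n flag_simps(1,4)[OF assms(1)] flags_r01(9)[OF assms(1)] by metis
  then show False using face_at_edge[OF assms(1,2)] flag_simps(6)[OF assms(1)] n by simp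
qed

text \<open>A second face through both vertices would force the pair to be an edge of
  \<open>face x\<close>, but from length 4 on two vertices at distance two on a boundary are not
  adjacent on it.\<close>

lemma common_diagonal:
  assumes "x \<in> X" "4 \<le> sz x" "g \<in> Faces M" "vert x \<in> \<Union> g" "vert (r0 (r1 (r0 x))) \<in> \<Union> g"
  shows "g = face x"
proof (rule ccontr)
  assume n: "g \<noteq> face x"
  obtain h f where h: "cyclic_param (card f) h f" and n3: "3 \<le> card f"
    and x: "x = Flag (h 0) {h 0, h 1} f" using face_param[OF assms(1)] .
  have "r0 x = Flag (h 1) {h 0, h 1} f" using r0_param[OF h n3, of 0] x by simp
  then have "r1 (r0 x) = Flag (h 1) {h 1, h 2} f" using r1_param'[OF h n3, of 1] by simp
  then have y: "vert (r0 (r1 (r0 x))) = h 2" using r0_param[OF h n3, of 1] by simp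
  have 4: "4 \<le> card f" using assms(2) x by simp
  have ne: "h 0 \<noteq> h 2" using cyclic_param_neq(1)[OF h, of 2 0] 4 by simp
  have fx: "face x = f" by (simp add: x)
  have "vert (r0 (r1 (r0 x))) \<in> \<Union> (face (r0 (r1 (r0 x))))"
    using assms(1) by (intro flag_simps(4)) simp
  then have in2: "h 2 \<in> \<Union> f" using y fx assms(1) by simp
  have "{h 0, h 2} \<in> f"
    using common_vertices_edge(1)[of f g "h 0" "h 2"] ne in2 assms(3-5) y n flag_simps(1,4)[OF assms(1)] x by simp
  then show False using cyclic_param_not_edge[OF h 4, of 0] by simp
qed

declare r2.simps [simp del]

end

declare r0.simps [simp del] r1.simps [simp del]

section \<open>Rotation about a vertex and symmetries of flags\<close>

context polyhedral
begin

definition turn :: "'a flag \<Rightarrow> 'a flag" where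
  "turn x = r1 (r2 x)"

lemma turn_closed [simp]:
  assumes "x \<in> X" shows "turn x \<in> X" "vert (turn x) = vert x" "(turn ^^ k) x \<in> X" "vert ((turn ^^ k) x) = vert x"
proof -
  show "turn x \<in> X" "vert (turn x) = vert x" using assms by (simp_all add: turn_def)
  have "(turn ^^ k) x \<in> X \<and> vert ((turn ^^ k) x) = vert x"
    by (induction k) (use assms in \<open>simp_all add: turn_def\<close>)
  then show "(turn ^^ k) x \<in> X" "vert ((turn ^^ k) x) = vert x" by auto
qed

lemma vertex_param:
  assumes fs: "face_cycle M v fs" and d: "3 \<le> length fs"
  obtains z :: "int \<Rightarrow> 'a flag" where "\<forall>i. z i \<in> X" "\<forall>i. vert (z i) = v"
    "\<forall>i. turn (z i) = z (i + 1)" "\<forall>i. face (z i) = fs ! nat (i mod int (length fs))"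
    "\<forall>i. face (r2 (z i)) = face (z (i + 1))" "\<forall>i. z (i + int (length fs)) = z i"
    "\<forall>x. x \<in> X \<and> vert x = v \<longrightarrow> (\<exists>i. x = z i \<or> x = r1 (z i))"
proof -
  let ?d = "length fs"
  define g where "g i = fs ! nat (i mod int ?d)" for i
  have d0: "0 < int ?d" using d by linarith
  have lt: "nat (i mod int ?d) < ?d" for i using d0 by (simp add: nat_less_iff)
  have dist: "distinct fs" and set: "set fs = {f \<in> Faces M. v \<in> \<Union> f}"
    and adj: "\<And>i. i < ?d \<Longrightarrow> \<exists>e \<in> fs ! i \<inter> fs ! (Suc i mod ?d). v \<in> e"
    using fs by (auto simp: face_cycle_def)
  have geq: "g i = g j \<longleftrightarrow> i mod int ?d = j mod int ?d" for i j
    unfolding g_def using d0 by (simp add: nth_eq_iff_index_eq[OF dist lt lt] eq_nat_nat_iff)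
  have gF: "g i \<in> Faces M" for i using set lt[of i] nth_mem[OF lt, of i] by (simp add: g_def)
  have gne: "g i \<noteq> g (i + k)" if "0 < k" "k < int ?d" for i k
  proof -
    have "\<not> int ?d dvd k" using that zdvd_not_zless by blast
    then show ?thesis by (simp add: geq mod_eq_dvd_iff dvd_minus_iff)
  qed
  have "\<exists>e. e \<in> g i \<and> e \<in> g (i + 1) \<and> v \<in> e" for i
  proof -
    have "nat ((i + 1) mod int ?d) = Suc (nat (i mod int ?d)) mod ?d"
      using d0 by (intro nat_mod_Suc) simp
    then show ?thesis using adj[OF lt[of i]] by (auto simp: g_def)
  qed
  then have "\<exists>e. e \<in> a \<and> e \<in> b \<and> v \<in> e" if "a = g i" "b = g (i + 1)" for a b i using that by blast
  \<comment> \<open>The common edge is chosen as a function of the two faces alone, so that the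
    flags \<open>z i\<close> inherit the periodicity of the faces \<open>g i\<close>.\<close>
  define ed where "ed a b = (SOME e. e \<in> a \<and> e \<in> b \<and> v \<in> e)" for a b :: "'a set set"
  have ed: "ed (g i) (g (i + 1)) \<in> g i" "ed (g i) (g (i + 1)) \<in> g (i + 1)" "v \<in> ed (g i) (g (i + 1))" for i
    using someI_ex[OF \<open>\<exists>e. e \<in> g i \<and> e \<in> g (i + 1) \<and> v \<in> e\<close>] by (simp_all add: ed_def)
  define z where "z i = Flag v (ed (g i) (g (i + 1))) (g i)" for i
  have zX: "z i \<in> X" for i using ed gF by (simp add: z_def flags_def)
  have zv: "vert (z i) = v" and ze: "edge (z i) = ed (g i) (g (i + 1))" and zf: "face (z i) = g i" for i
    by (simp_all add: z_def)
  have r2f: "face (r2 (z i)) = g (i + 1)" for i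
    using face_at_edge[OF zX gF, of i "i + 1"] ed(2)[of i] ze zf gne[of 1 i] d by auto
  have tz: "turn (z i) = z (i + 1)" for i
  proof -
    \<comment> \<open>Otherwise one edge would lie on \<open>g i\<close>, \<open>g (i + 1)\<close>
      and \<open>g (i + 2)\<close>, which are distinct because at least three faces surround the
      vertex.\<close>
    have "edge (z (i + 1)) \<noteq> edge (z i)"
    proof
      assume "edge (z (i + 1)) = edge (z i)"
      then have "edge (z i) \<in> g (i + 1 + 1)" using ed(2)[of "i + 1"] ze by metis
      then have "g (i + 1 + 1) = g i \<or> g (i + 1 + 1) = g (i + 1)"
        using face_at_edge[OF zX gF] r2f zf by metis
      then show False using gne[of 2 i] gne[of 1 "i + 1"] d by (auto simp: add.assoc)
    qed
    then have "z (i + 1) = r1 (r2 (z i))"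
      using r1_unique[of "r2 (z i)" "z (i + 1)"] zX zv zf r2f flags_r2(3,4)[OF zX] flags_r2(1)[OF zX] by metis
    then show ?thesis by (simp add: turn_def)
  qed
  have per: "z (i + int ?d) = z i" for i
  proof -
    have "g (i + int ?d) = g i" by (simp add: geq)
    moreover have "g (i + int ?d + 1) = g (i + 1)"
      using mod_add_self2[of "i + 1" "int ?d"] by (simp add: geq ac_simps del: mod_add_self2)
    ultimately show ?thesis by (simp add: z_def)
  qed
  have all: "\<exists>i. x = z i \<or> x = r1 (z i)" if x: "x \<in> X" "vert x = v" for x
  proof -
    have "face x \<in> set fs" unfolding set using flag_simps(1,4)[OF x(1)] x(2) by simp
    then obtain k where k: "k < ?d" "face x = fs ! k" by (metis in_set_conv_nth)
    then have "face x = g (int k)" by (simp add: g_def)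
    then have "x = z (int k) \<or> x = r1 (z (int k))"
      using r1_unique[OF zX x(1), of "int k"] x(2) zv zf by auto
    then show ?thesis by blast
  qed
  show thesis
    by (rule that[of z]) (use zX zv tz per all in \<open>simp_all add: zf r2f g_def\<close>)
qed

text \<open>This captures the action of automorphisms on flags. It is stable under composition, and
  images of compound flags are computed by pushing the symmetry through the switches.\<close>

definition symm :: "('a flag \<Rightarrow> 'a flag) \<Rightarrow> bool" where
  "symm \<Phi> \<longleftrightarrow> (\<forall>x \<in> X. \<Phi> x \<in> X \<and> \<Phi> (r0 x) = r0 (\<Phi> x) \<and> \<Phi> (r1 x) = r1 (\<Phi> x) \<and>
     \<Phi> (r2 x) = r2 (\<Phi> x) \<and> sz (\<Phi> x) = sz x) \<and> inj_on \<Phi> X"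

lemma symmD:
  assumes "symm \<Phi>" "x \<in> X"
  shows "\<Phi> x \<in> X" "\<Phi> (r0 x) = r0 (\<Phi> x)" "\<Phi> (r1 x) = r1 (\<Phi> x)" "\<Phi> (r2 x) = r2 (\<Phi> x)" "sz (\<Phi> x) = sz x"
  using assms by (auto simp: symm_def)

lemma symm_eq: "symm \<Phi> \<Longrightarrow> x \<in> X \<Longrightarrow> y \<in> X \<Longrightarrow> \<Phi> x = \<Phi> y \<Longrightarrow> x = y"
  by (auto simp: symm_def inj_on_def)

lemma symm_comp:
  assumes "symm \<Phi>" "symm \<Psi>" shows "symm (\<lambda>x. \<Phi> (\<Psi> x))"
proof -
  have "inj_on (\<lambda>x. \<Phi> (\<Psi> x)) X"
  proof (rule inj_onI)
    fix x y assume "x \<in> X" "y \<in> X" "\<Phi> (\<Psi> x) = \<Phi> (\<Psi> y)"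
    then show "x = y" using symm_eq[OF assms(1), of "\<Psi> x" "\<Psi> y"] symm_eq[OF assms(2)] symmD(1)[OF assms(2)] by blast
  qed
  then show ?thesis
    unfolding symm_def[of "\<lambda>x. \<Phi> (\<Psi> x)"]
    using symmD[OF assms(1)] symmD[OF assms(2)] by simp
qed

definition act :: "('a \<Rightarrow> 'a) \<Rightarrow> 'a flag \<Rightarrow> 'a flag" where
  "act \<phi> x = Flag (\<phi> (vert x)) (\<phi> ` edge x) (image \<phi> ` face x)"

text \<open>An injective map that preserves incidence sends two flags differing in one component to
  two such flags, and the uniqueness lemmas identify the second image as a switch of the
  first.\<close>

lemma symm_act:
  assumes "automorphism M \<phi>" shows "symm (act \<phi>)"
proof -
  have p: "\<phi> permutes Verts M" and F: "image (image \<phi>) ` Faces M = Faces M"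
    using assms by (auto simp: automorphism_def)
  have inj: "inj \<phi>" using p by (rule permutes_inj)
  have inj2: "inj (image \<phi>)" by (rule injI) (simp only: inj_image_eq_iff[OF inj])
  have inj3: "inj (image (image \<phi>))" by (rule injI) (simp only: inj_image_eq_iff[OF inj2])
  have aX: "act \<phi> x \<in> X" if "x \<in> X" for x
    using flag_simps(1-3)[OF that] F by (auto simp: act_def flags_def)
  have comp: "vert (act \<phi> x) = \<phi> (vert x)" "edge (act \<phi> x) = \<phi> ` edge x" "face (act \<phi> x) = image \<phi> ` face x" for x
    by (simp_all add: act_def)
  have ne: "act \<phi> x \<noteq> act \<phi> y" if "x \<noteq> y" for x y
  proof
    assume "act \<phi> x = act \<phi> y"
    then have "vert x = vert y" "edge x = edge y" "face x = face y"
      by (simp_all add: act_def inj_eq[OF inj] inj_eq[OF inj2] inj_eq[OF inj3])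
    with that show False using flag_eqI by blast
  qed
  show ?thesis
    unfolding symm_def
  proof (intro ballI conjI)
    show "inj_on (act \<phi>) X" using ne by (meson inj_onI)
    fix x assume x: "x \<in> X"
    note xr = flags_r01[OF x] flags_r2[OF x]
    show "act \<phi> x \<in> X" using aX x .
    show "act \<phi> (r0 x) = r0 (act \<phi> x)"
      by (rule r0_unique) (use x aX comp xr ne in simp_all)
    show "act \<phi> (r1 x) = r1 (act \<phi> x)"
      by (rule r1_unique) (use x aX comp xr ne in simp_all)
    have "r2 x \<noteq> x" using xr by metis
    then show "act \<phi> (r2 x) = r2 (act \<phi> x)"
      by (intro r2_unique) (use x aX comp xr ne in simp_all)
    show "sz (act \<phi> x) = sz x"
      unfolding comp by (rule card_image) (meson inj2 inj_on_subset subset_UNIV)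
  qed
qed

lemma transitiveE:
  assumes "vertex_transitive M" "x \<in> X" "y \<in> X"
  obtains \<Phi> where "symm \<Phi>" "vert (\<Phi> x) = vert y"
proof -
  obtain \<phi> where "automorphism M \<phi>" "\<phi> (vert x) = vert y"
    using assms flag_simps(5) unfolding vertex_transitive_def by blast
  then show thesis using that[OF symm_act] by (simp add: act_def)
qed

lemma finite_parts: "finite (Verts M)" "finite (Edges M)" "finite (Faces M)"
proof -
  note c = closed_surface[unfolded closed_surface_map_def]
  show V: "finite (Verts M)" using c by (elim conjE)
  have "Edges M \<subseteq> Pow (Verts M)" using edges_card by blast
  then show E: "finite (Edges M)" using V finite_subset by blast
  have "Faces M \<subseteq> Pow (Edges M)" using faces_boundary by blast
  then show "finite (Faces M)" using E finite_subset by blast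
qed

end

section \<open>Semi-equivelar maps\<close>

locale semi_equivelar_map =
  fixes M :: "'a cell_map" and t :: "(nat \<times> nat) list"
  assumes semi_equivelar: "semi_equivelar t M"
    and degree: "3 \<le> length (concat (map (\<lambda>(p, n). replicate n p) t))"
begin

sublocale polyhedral M
  using semi_equivelar by unfold_locales (simp add: semi_equivelar_def)

definition ts :: "nat list" where "ts = concat (map (\<lambda>(p, n). replicate n p) t)"

lemma vertex_faces:
  assumes "v \<in> Verts M"
  obtains fs where "face_cycle M v fs" "map card fs = ts" "3 \<le> length fs"
proof -
  obtain fs where "face_cycle M v fs" "map card fs = ts"
    using assms semi_equivelar unfolding semi_equivelar_def ts_def by blast
  moreover from this have "3 \<le> length fs" using degree by (metis length_map ts_def)
  ultimately show thesis using that by blast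
qed

text \<open>The flags \<open>z i\<close> go around the vertex in one sense. The remaining flags
  \<open>r1 (z i)\<close> see the same faces in the opposite sense, hence the two signs in the
  action of \<open>turn\<close>.\<close>

lemma vertex_walk:
  assumes x: "x \<in> X"
  obtains z :: "int \<Rightarrow> 'a flag" where "\<forall>i. z i \<in> X"
    "\<forall>i k. (turn ^^ k) (z i) = z (i + int k)" "\<forall>i k. (turn ^^ k) (r1 (z i)) = r1 (z (i - int k))"
    "\<forall>i. sz (z i) = ts ! nat (i mod int (length ts))" "\<forall>i. z i = z (i mod int (length ts))"
    "\<forall>y. y \<in> X \<and> vert y = vert x \<longrightarrow> (\<exists>i. y = z i \<or> y = r1 (z i))" "0 < int (length ts)"
proof -
  obtain fs where fs: "face_cycle M (vert x) fs" "map card fs = ts" "3 \<le> length fs"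
    using vertex_faces[OF flag_simps(5)[OF x]] .
  obtain z :: "int \<Rightarrow> 'a flag" where z: "\<forall>i. z i \<in> X" "\<forall>i. vert (z i) = vert x"
    "\<forall>i. turn (z i) = z (i + 1)" "\<forall>i. face (z i) = fs ! nat (i mod int (length fs))"
    "\<forall>i. face (r2 (z i)) = face (z (i + 1))" "\<forall>i. z (i + int (length fs)) = z i"
    "\<forall>x'. x' \<in> X \<and> vert x' = vert x \<longrightarrow> (\<exists>i. x' = z i \<or> x' = r1 (z i))"
    using vertex_param[OF fs(1,3)] .
  have len: "length fs = length ts" using fs(2) by (metis length_map)
  have d0: "0 < int (length ts)" using fs(3) len by linarith
  have sz: "sz (z i) = ts ! nat (i mod int (length ts))" for i
  proof -
    have "nat (i mod int (length fs)) < length fs" using d0 len by (simp add: nat_less_iff)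
    then show ?thesis using z(4)[rule_format, of i] fs(2) len nth_map[of _ fs card] by metis
  qed
  have fw: "(turn ^^ k) (z i) = z (i + int k)" for i k
    by (induction k) (simp_all add: z(3) ac_simps)
  have bw1: "turn (r1 (z j)) = r1 (z (j - 1))" for j
  proof -
    have "z j = r1 (r2 (z (j - 1)))" using z(3)[rule_format, of "j - 1"] by (simp add: turn_def)
    then show ?thesis using z(1) by (simp add: turn_def)
  qed
  have bw: "(turn ^^ k) (r1 (z i)) = r1 (z (i - int k))" for i k
    by (induction k) (simp_all add: bw1 diff_diff_eq add.commute)
  have mult: "z (i + int (length ts) * int k) = z i" for i k
  proof (induction k)
    case (Suc k)
    then show ?case using z(6)[rule_format, of "i + int (length ts) * int k"] by (simp add: len algebra_simps)
  qed simp
  \<comment> \<open>\<open>mult\<close> adds only nonnegative multiples of the period, so it is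
    applied to the residue or to \<open>i\<close> itself, according to the sign of the
    quotient.\<close>
  have red: "z i = z (i mod int (length ts))" for i
  proof (cases "0 \<le> i div int (length ts)")
    case True
    then show ?thesis using mult[of "i mod int (length ts)" "nat (i div int (length ts))"]
      by simp
  next
    case False
    then show ?thesis using mult[of i "nat (- (i div int (length ts)))"]
      by (simp add: minus_mult_div_eq_mod)
  qed
  show thesis using that[of z] z(1,7) fw bw sz red d0 by metis
qed

text \<open>A flag sees the cyclic type from an unknown offset and in an unknown sense of rotation.
  For a concrete type this leaves finitely many readings, which are checked one by one.\<close>

lemma vertex_sizes:
  assumes x: "x \<in> X"
  obtains i :: int where "0 \<le> i" "i < int (length ts)"
    "(\<forall>k. sz ((turn ^^ k) x) = ts ! nat ((i + int k) mod int (length ts))) \<or>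
     (\<forall>k. sz ((turn ^^ k) x) = ts ! nat ((i - int k) mod int (length ts)))"
proof -
  obtain z :: "int \<Rightarrow> 'a flag" where z: "\<forall>i. z i \<in> X"
    "\<forall>i k. (turn ^^ k) (z i) = z (i + int k)" "\<forall>i k. (turn ^^ k) (r1 (z i)) = r1 (z (i - int k))"
    "\<forall>i. sz (z i) = ts ! nat (i mod int (length ts))" "\<forall>i. z i = z (i mod int (length ts))"
    "\<forall>y. y \<in> X \<and> vert y = vert x \<longrightarrow> (\<exists>i. y = z i \<or> y = r1 (z i))" "0 < int (length ts)"
    using vertex_walk[OF x] .
  obtain i where i: "x = z i \<or> x = r1 (z i)" using z(6) x by blast
  show thesis
  proof (rule that[of "i mod int (length ts)"])
    show "0 \<le> i mod int (length ts)" "i mod int (length ts) < int (length ts)" using z(7) by auto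
    show "(\<forall>k. sz ((turn ^^ k) x) = ts ! nat ((i mod int (length ts) + int k) mod int (length ts))) \<or>
     (\<forall>k. sz ((turn ^^ k) x) = ts ! nat ((i mod int (length ts) - int k) mod int (length ts)))"
      using i by (elim disjE) (simp_all add: z(1-4) mod_simps)
  qed
qed

lemma turn_order:
  assumes x: "x \<in> X" shows "(turn ^^ length ts) x = x"
proof -
  obtain z :: "int \<Rightarrow> 'a flag" where z: "\<forall>i. z i \<in> X"
    "\<forall>i k. (turn ^^ k) (z i) = z (i + int k)" "\<forall>i k. (turn ^^ k) (r1 (z i)) = r1 (z (i - int k))"
    "\<forall>i. sz (z i) = ts ! nat (i mod int (length ts))" "\<forall>i. z i = z (i mod int (length ts))"
    "\<forall>y. y \<in> X \<and> vert y = vert x \<longrightarrow> (\<exists>i. y = z i \<or> y = r1 (z i))" "0 < int (length ts)"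
    using vertex_walk[OF x] .
  obtain i where i: "x = z i \<or> x = r1 (z i)" using z(6) x by blast
  have "z (i + int (length ts)) = z i" "z (i - int (length ts)) = z i"
    using z(5)[rule_format, of i] z(5)[rule_format, of "i + int (length ts)"] z(5)[rule_format, of "i - int (length ts)"] by simp_all
  then show ?thesis using i z(2,3) by auto
qed

lemma same_vertex_cases:
  assumes x: "x \<in> X" and y: "y \<in> X" "vert y = vert x"
  obtains k where "k < length ts" "y = (turn ^^ k) x \<or> y = r1 ((turn ^^ k) x)"
proof -
  obtain z :: "int \<Rightarrow> 'a flag" where z: "\<forall>i. z i \<in> X"
    "\<forall>i k. (turn ^^ k) (z i) = z (i + int k)" "\<forall>i k. (turn ^^ k) (r1 (z i)) = r1 (z (i - int k))"
    "\<forall>i. sz (z i) = ts ! nat (i mod int (length ts))" "\<forall>i. z i = z (i mod int (length ts))"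
    "\<forall>y. y \<in> X \<and> vert y = vert x \<longrightarrow> (\<exists>i. y = z i \<or> y = r1 (z i))" "0 < int (length ts)"
    using vertex_walk[OF x] .
  obtain i where i: "x = z i \<or> x = r1 (z i)" using z(6) x by blast
  obtain j where j: "y = z j \<or> y = r1 (z j)" using z(6) y by blast
  \<comment> \<open>Two offsets are prepared, as the sense of rotation of \<open>x\<close> relative
    to \<open>z\<close> is unknown: \<open>k\<close> serves \<open>x = z i\<close> and
    \<open>l\<close> serves \<open>x = r1 (z i)\<close>.\<close>
  define k where "k = nat ((j - i) mod int (length ts))"
  define l where "l = nat ((i - j) mod int (length ts))"
  have kl: "k < length ts" "l < length ts" "int k = (j - i) mod int (length ts)" "int l = (i - j) mod int (length ts)"
    using z(7) by (simp_all add: k_def l_def nat_less_iff)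
  have "z (i + int k) = z j" "z (i - int l) = z j"
    using z(5)[rule_format, of "i + int k"] z(5)[rule_format, of "i - int l"] z(5)[rule_format, of j] by (simp_all add: kl mod_simps)
  then have "y = (turn ^^ k) (z i) \<or> y = r1 ((turn ^^ k) (z i))"
    "y = (turn ^^ l) (r1 (z i)) \<or> y = r1 ((turn ^^ l) (r1 (z i)))"
    using j z(1)[rule_format, of j] by (auto simp: z(2,3))
  then show thesis using that[of k] that[of l] kl i by auto
qed

end

text \<open>The pigeonhole step through which the number three acts: a largest face different from
  two given ones can only be the third.\<close>

lemma third_eq:
  assumes "finite S" "card S \<le> 3" "a \<in> S" "b \<in> S" "c \<in> S" "d \<in> S"
    "a \<noteq> b" "a \<noteq> c" "b \<noteq> c" "d \<noteq> a" "d \<noteq> b"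
  shows "d = c"
proof (rule ccontr)
  assume "d \<noteq> c"
  then have "card {a, b, c, d} = 4" using assms by auto
  moreover have "card {a, b, c, d} \<le> card S" by (rule card_mono) (use assms in auto)
  ultimately show False using assms(2) by simp
qed

context semi_equivelar_map
begin

lemma size_mem_ts:
  assumes w: "w \<in> X" shows "sz w \<in> set ts"
proof -
  obtain i :: int where i: "0 \<le> i" "i < int (length ts)"
    "(\<forall>k. sz ((turn ^^ k) w) = ts ! nat ((i + int k) mod int (length ts))) \<or>
     (\<forall>k. sz ((turn ^^ k) w) = ts ! nat ((i - int k) mod int (length ts)))"
    using vertex_sizes[OF w] .
  have "sz ((turn ^^ 0) w) = ts ! nat i" using i(3)
  proof (elim disjE)
    assume h: "\<forall>k. sz ((turn ^^ k) w) = ts ! nat ((i + int k) mod int (length ts))"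
    show ?thesis unfolding h[rule_format] using i(1,2) by simp
  next
    assume h: "\<forall>k. sz ((turn ^^ k) w) = ts ! nat ((i - int k) mod int (length ts))"
    show ?thesis unfolding h[rule_format] using i(1,2) by simp
  qed
  moreover have "ts ! nat i \<in> set ts" using i(1,2) by (intro nth_mem) simp
  ultimately show ?thesis by simp
qed

section \<open>Double counting of incidences\<close>

lemma face_sizes_at:
  assumes "v \<in> Verts M"
  shows "card {f \<in> Faces M. v \<in> \<Union> f} = length ts"
    and "card {f \<in> Faces M. card f = p \<and> v \<in> \<Union> f} = count_list ts p"
proof -
  obtain fs where fs: "face_cycle M v fs" "map card fs = ts" "3 \<le> length fs"
    using vertex_faces[OF assms] .
  then have d: "distinct fs" and s: "set fs = {f \<in> Faces M. v \<in> \<Union> f}"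
    unfolding face_cycle_def by blast+
  show "card {f \<in> Faces M. v \<in> \<Union> f} = length ts"
    unfolding s[symmetric] distinct_card[OF d] fs(2)[symmetric] by simp
  have "{f \<in> Faces M. card f = p \<and> v \<in> \<Union> f} = set (filter (\<lambda>f. card f = p) fs)"
    using s by auto
  then have "card {f \<in> Faces M. card f = p \<and> v \<in> \<Union> f} = length (filter (\<lambda>f. card f = p) fs)"
    by (simp only: distinct_card[OF distinct_filter[OF d]])
  also have "\<dots> = count_list (map card fs) p" by (induction fs) auto
  finally show "card {f \<in> Faces M. card f = p \<and> v \<in> \<Union> f} = count_list ts p" using fs(2) by simp
qed

lemma face_vertices:
  assumes "f \<in> Faces M" shows "{v \<in> Verts M. v \<in> \<Union> f} = \<Union> f"
proof -
  have "e \<subseteq> Verts M" if "e \<in> f" for e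
    using edge_card[OF assms that] edges_card by simp
  then show ?thesis by blast
qed

lemma face_count: "p * card {f \<in> Faces M. card f = p} = count_list ts p * card (Verts M)"
proof -
  have "(\<Sum>v\<in>Verts M. card {f \<in> {f \<in> Faces M. card f = p}. v \<in> \<Union> f}) = p * card {f \<in> Faces M. card f = p}"
    by (rule sum_multicount) (use finite_parts face_vertices face_card in auto)
  moreover have "{f \<in> {f \<in> Faces M. card f = p}. v \<in> \<Union> f} = {f \<in> Faces M. card f = p \<and> v \<in> \<Union> f}" for v
    by blast
  ultimately show ?thesis using face_sizes_at(2) by (simp add: mult.commute)
qed

text \<open>Edge-face incidences number two per edge, vertex-face incidences
  \<open>length ts\<close> per vertex, and the totals agree because a face has as many edges as
  vertices.\<close>

lemma edge_count: "2 * card (Edges M) = length ts * card (Verts M)"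
proof -
  have E: "(\<Sum>f\<in>Faces M. card {e \<in> Edges M. e \<in> f}) = 2 * card (Edges M)"
    by (rule sum_multicount) (use finite_parts edges_two_faces in auto)
  have V: "(\<Sum>f\<in>Faces M. card {v \<in> Verts M. v \<in> \<Union> f}) = length ts * card (Verts M)"
    by (rule sum_multicount) (use finite_parts face_sizes_at(1) in auto)
  have "card {e \<in> Edges M. e \<in> f} = card {v \<in> Verts M. v \<in> \<Union> f}" if f: "f \<in> Faces M" for f
  proof -
    have "{e \<in> Edges M. e \<in> f} = f" using edge_card[OF f] by blast
    then show ?thesis using face_card[OF f] face_vertices[OF f] by simp
  qed
  then have "(\<Sum>f\<in>Faces M. card {e \<in> Edges M. e \<in> f}) = (\<Sum>f\<in>Faces M. card {v \<in> Verts M. v \<in> \<Union> f})"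
    by (intro sum.cong) simp_all
  then show ?thesis using E V by simp
qed

lemma face_total: "card (Faces M) = (\<Sum>p\<in>set ts. card {f \<in> Faces M. card f = p})"
proof -
  have "card ` Faces M \<subseteq> set ts"
  proof
    fix p assume "p \<in> card ` Faces M"
    then obtain f where f: "f \<in> Faces M" "p = card f" by blast
    then have "\<Union> f \<noteq> {}" using face_card[of f] by (metis card.empty not_numeral_le_zero)
    then obtain v where v: "v \<in> \<Union> f" "v \<in> Verts M" using face_vertices[OF f(1)] by blast
    obtain fs where fs: "face_cycle M v fs" "map card fs = ts" "3 \<le> length fs"
      using vertex_faces[OF v(2)] .
    then have "f \<in> set fs" using f v unfolding face_cycle_def by blast
    then show "p \<in> set ts" using fs(2) f(2) by (metis image_eqI list.set_map)
  qed
  then have "(\<Sum>p\<in>set ts. \<Sum>f\<in>{f \<in> Faces M. card f = p}. 1) = (\<Sum>f\<in>Faces M. 1::nat)"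
    by (intro sum.group) (use finite_parts in simp_all)
  then show ?thesis by simp
qed

lemma flag_of_size:
  assumes "p \<in> set ts" "v \<in> Verts M"
  obtains x where "x \<in> X" "vert x = v" "sz x = p"
proof -
  obtain fs where fs: "face_cycle M v fs" "map card fs = ts" "3 \<le> length fs"
    using vertex_faces[OF assms(2)] .
  then have "p \<in> card ` set fs" using assms(1) by (metis list.set_map)
  then obtain f where "f \<in> set fs" "card f = p" by blast
  moreover from this have "f \<in> Faces M" "v \<in> \<Union> f" using fs(1) unfolding face_cycle_def by blast+
  ultimately obtain e where "Flag v e f \<in> X" "card f = p" by (auto simp: flags_def)
  then show thesis using that[of "Flag v e f"] by simp
qed

lemma Verts_nonempty: "Verts M \<noteq> {}"
proof -
  have "Edges M \<noteq> {}" using closed_surface unfolding closed_surface_map_def by (elim conjE)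
  then obtain e where "e \<subseteq> Verts M" "card e = 2" using edges_card by blast
  then show ?thesis by auto
qed

end

section \<open>Quarter turns of triangulations with three vertices of degree 8\<close>

text \<open>\<open>Y\<close> stands for the flags of a triangulation with three vertices of degree 8. The vertex of a flag
  is given by \<open>F\<close>, and \<open>b\<close>, \<open>c\<close> and \<open>a\<close> switch the vertex, the edge and the triangle of a flag.\<close>

lemma no_quarter_turn:
  fixes a b c \<Phi> :: "'x \<Rightarrow> 'x" and Y :: "'x set" and F :: "'x \<Rightarrow> 'f"
  defines "q \<equiv> \<lambda>y. a (c y)"
  assumes closed: "\<And>y. y \<in> Y \<Longrightarrow> a y \<in> Y" "\<And>y. y \<in> Y \<Longrightarrow> b y \<in> Y" "\<And>y. y \<in> Y \<Longrightarrow> c y \<in> Y"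
    and invol: "\<And>y. y \<in> Y \<Longrightarrow> a (a y) = y" "\<And>y. y \<in> Y \<Longrightarrow> b (b y) = y" "\<And>y. y \<in> Y \<Longrightarrow> c (c y) = y"
    and ab: "\<And>y. y \<in> Y \<Longrightarrow> a (b y) = b (a y)"
    and bc: "\<And>y. y \<in> Y \<Longrightarrow> b (c (b y)) = c (b (c y))"
    and order: "\<And>y k. y \<in> Y \<Longrightarrow> (q ^^ k) y = y \<longleftrightarrow> 8 dvd k"
    and F: "\<And>y. y \<in> Y \<Longrightarrow> F (a y) = F y" "\<And>y. y \<in> Y \<Longrightarrow> F (c y) = F y" "\<And>y. y \<in> Y \<Longrightarrow> F (b y) \<noteq> F y"
    and orbit: "\<And>y z. y \<in> Y \<Longrightarrow> z \<in> Y \<Longrightarrow> F z = F y \<Longrightarrow>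
        \<exists>k. \<exists>u \<in> {y, a y}. z = (q ^^ k) u \<or> u = (q ^^ k) z"
    and three: "finite (F ` Y)" "card (F ` Y) \<le> 3"
    and \<Phi>: "\<And>y. y \<in> Y \<Longrightarrow> \<Phi> y \<in> Y" "\<And>y. y \<in> Y \<Longrightarrow> \<Phi> (a y) = a (\<Phi> y)"
      "\<And>y. y \<in> Y \<Longrightarrow> \<Phi> (b y) = b (\<Phi> y)" "\<And>y. y \<in> Y \<Longrightarrow> \<Phi> (c y) = c (\<Phi> y)"
    and x: "x \<in> Y" "\<Phi> x = q (q x)"
  shows False
proof -
  note [simp] = closed invol \<Phi>
  have q [simp]: "q y \<in> Y" "\<Phi> (q y) = q (\<Phi> y)" "F (q y) = F y" if "y \<in> Y" for y
    using that F by (simp_all add: q_def)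
  have qk [simp]: "(q ^^ k) y \<in> Y" if "y \<in> Y" for y k
    using that by (induction k) simp_all
  have \<Phi>qk: "\<Phi> ((q ^^ k) y) = (q ^^ k) (\<Phi> y)" if "y \<in> Y" for y k
    using that by (induction k) simp_all
  have F3: "F y \<noteq> F (b y)" "F y \<noteq> F (b (c y))" "F (b y) \<noteq> F (b (c y))" if y: "y \<in> Y" for y
  proof -
    show "F y \<noteq> F (b y)" using F(3)[of y] y by simp
    show "F y \<noteq> F (b (c y))" using F(3)[of "c y"] F(2)[of y] y by simp
    have "F (b (c y)) = F (b (c (b y)))" using F(2)[of "b (c y)"] bc[of y] y by simp
    moreover have "F (b (c (b y))) \<noteq> F (b y)" using F(3)[of "c (b y)"] F(2)[of "b y"] y by simp
    ultimately show "F (b y) \<noteq> F (b (c y))" by simp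
  qed
  \<comment> \<open>The flag \<open>q y\<close> lies in the next triangle around \<open>F y\<close>,
    which shares the corners \<open>F y\<close> and \<open>F (b (c y))\<close> with the triangle of
    \<open>y\<close>. With only three vertices available, its remaining corner is again
    \<open>F (b y)\<close>.\<close>
  have Fq: "F (b (q y)) = F (b (c y))" "F (b (c (q y))) = F (b y)" if y: "y \<in> Y" for y
  proof -
    show 1: "F (b (q y)) = F (b (c y))" using ab[of "c y"] F(1)[of "b (c y)"] y by (simp add: q_def)
    show "F (b (c (q y))) = F (b y)"
      by (rule third_eq[OF three, of "F y" "F (b (c y))"])
        (use y F3[OF y] F3[of "q y"] 1 in auto)
  qed
  \<comment> \<open>A quarter turn advances two triangles around \<open>F x\<close>, and two steps
    restore the alternating neighbours.\<close>
  have \<Phi>F: "F (\<Phi> (b x)) = F (b x)" "F (\<Phi> (b (c x))) = F (b (c x))"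
    using Fq[of x] Fq[of "q x"] x \<Phi>(3,4) by simp_all
  \<comment> \<open>\<open>q ^^ k\<close> composed with \<open>a\<close> is a reflection of the
    dihedral group at the vertex, hence an involution.\<close>
  have flip: "(q ^^ k) (a ((q ^^ k) (a z))) = z" if z: "z \<in> Y" for z k
  proof (induction k)
    case (Suc k)
    have "q (a (q y)) = a y" if "y \<in> Y" for y using that by (simp add: q_def)
    from this[of "(q ^^ k) (a z)"] show ?case
      using Suc z funpow_swap1[of q k "a ((q ^^ Suc k) (a z))"] by simp
  qed (use z in simp)
  \<comment> \<open>At a vertex that it fixes, the symmetry acts on \<open>z\<close> as a dihedral
    element. Reflections are excluded since its square moves \<open>z\<close>, and as its fourth
    power fixes \<open>z\<close>, the rotation is by 2 or 6 eighths.\<close>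
  have quarter: "\<Phi> z = (q ^^ 2) z \<or> \<Phi> z = (q ^^ 6) z"
    if z: "z \<in> Y" "F (\<Phi> z) = F z" "\<Phi> (\<Phi> z) \<noteq> z" "\<Phi> (\<Phi> (\<Phi> (\<Phi> z))) = z" for z
  proof -
    obtain k u where u: "u \<in> {z, a z}" "\<Phi> z = (q ^^ k) u \<or> u = (q ^^ k) (\<Phi> z)"
      using orbit[of z "\<Phi> z"] z(1,2) by auto
    \<comment> \<open>\<open>7 * k\<close> is inverse to \<open>k\<close> modulo 8, which brings the
      two alternatives of \<open>orbit\<close> into one form.\<close>
    have "(q ^^ (7 * k)) ((q ^^ k) w) = w" if "w \<in> Y" for w
    proof -
      have "(q ^^ (7 * k)) ((q ^^ k) w) = (q ^^ (7 * k + k)) w" by (simp only: funpow_add comp_apply)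
      then show ?thesis using order[OF that, of "7 * k + k"] by simp
    qed
    from this[of "\<Phi> z"] have "\<Phi> z = (q ^^ (7 * k)) u" if "u = (q ^^ k) (\<Phi> z)"
      using that z(1) by simp
    with u(2) have "\<exists>k. \<Phi> z = (q ^^ k) u" by blast
    then obtain k where "\<Phi> z = (q ^^ k) z \<or> \<Phi> z = (q ^^ k) (a z)" using u(1) by auto
    moreover have "\<Phi> z \<noteq> (q ^^ k) (a z)"
    proof
      assume e: "\<Phi> z = (q ^^ k) (a z)"
      then have "\<Phi> (\<Phi> z) = (q ^^ k) (a ((q ^^ k) (a z)))" using z(1) by (simp add: \<Phi>qk)
      then show False using z flip by simp
    qed
    ultimately have k: "\<Phi> z = (q ^^ k) z" by blast
    have "\<Phi> (\<Phi> z) = (q ^^ (2 * k)) z"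
      using z(1) k \<Phi>qk[OF z(1), of k] by (simp add: mult_2 funpow_add)
    moreover from this have "\<Phi> (\<Phi> (\<Phi> (\<Phi> z))) = (q ^^ (2 * k)) ((q ^^ (2 * k)) z)"
      using z(1) \<Phi>qk by (metis \<Phi>(1))
    ultimately have "\<not> 8 dvd 2 * k" "8 dvd 2 * k + 2 * k"
      using z order[of z] by (metis, metis comp_apply funpow_add)
    then have k48: "k mod 8 = 2 \<or> k mod 8 = 6" by presburger
    have "(q ^^ (8 * m)) z = z" for m using order[OF z(1)] by simp
    moreover have "(q ^^ k) z = (q ^^ (k mod 8)) ((q ^^ (8 * (k div 8))) z)"
      by (metis comp_apply funpow_add mod_mult_div_eq mult.commute)
    ultimately show ?thesis using k k48 by auto
  qed
  \<comment> \<open>The flags \<open>y\<close> and \<open>z\<close> sit at the two ends of the edge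
    opposite to \<open>F x\<close> in the triangle of \<open>x\<close>.\<close>
  define y where "y = c (b (c x))"
  define z where "z = b y"
  have yY: "y \<in> Y" and zY: "z \<in> Y" using x by (simp_all add: y_def z_def)
  have z: "z = c (b x)" using bc[of "c x"] bc[of x] x by (simp add: z_def y_def)
  have \<Phi>2: "\<Phi> (\<Phi> x) = (q ^^ 4) x" using x by (simp add: numeral_eq_Suc)
  have "\<Phi> (\<Phi> (\<Phi> (\<Phi> x))) = (q ^^ 4) ((q ^^ 4) x)"
    using \<Phi>2 \<Phi>qk x(1) by (metis \<Phi>(1))
  also have "\<dots> = (q ^^ 8) x" by (simp add: numeral_eq_Suc)
  finally have \<Phi>4: "\<Phi> (\<Phi> (\<Phi> (\<Phi> x))) = x" using order[OF x(1), of 8] by simp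
  have n: "\<Phi> (\<Phi> x) \<noteq> x" using \<Phi>2 order[OF x(1), of 4] by simp
  have ny: "\<Phi> (\<Phi> y) \<noteq> y"
  proof
    assume "\<Phi> (\<Phi> y) = y"
    then have "c (b (c (\<Phi> (\<Phi> x)))) = c (b (c x))" using x(1) by (simp add: y_def)
    then have "c (b (c (c (b (c (\<Phi> (\<Phi> x))))))) = c (b (c (c (b (c x)))))" by simp
    then show False using n x(1) by simp
  qed
  have nz: "\<Phi> (\<Phi> z) \<noteq> z"
  proof
    assume "\<Phi> (\<Phi> z) = z"
    then have "b (\<Phi> (\<Phi> y)) = b y" using yY by (simp add: z_def)
    then have "b (b (\<Phi> (\<Phi> y))) = b (b y)" by simp
    then show False using ny yY by simp
  qed
  have y4: "\<Phi> (\<Phi> (\<Phi> (\<Phi> y))) = y" using \<Phi>4 x(1) by (simp add: y_def)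
  have z4: "\<Phi> (\<Phi> (\<Phi> (\<Phi> z))) = z" using y4 yY by (simp add: z_def)
  have Fy: "F (\<Phi> y) = F y" using \<Phi>F(2) F(2)[of "b (c x)"] F(2)[of "b (c (\<Phi> x))"] x(1) by (simp add: y_def)
  have Fz: "F (\<Phi> z) = F z" using \<Phi>F(1) F(2)[of "b x"] F(2)[of "b (\<Phi> x)"] x(1) by (simp add: z)
  have qy: "\<Phi> y = (q ^^ 2) y \<or> \<Phi> y = (q ^^ 6) y" by (rule quarter) (use yY Fy ny y4 in auto)
  have qz: "\<Phi> z = (q ^^ 2) z \<or> \<Phi> z = (q ^^ 6) z" by (rule quarter) (use zY Fz nz z4 in auto)
  have "b (c (b (a (c x)))) = c (b (c (a (c x))))" using bc x(1) by simp
  moreover have "b (a (c x)) = a (c y)" using ab[of "c x"] x(1) by (simp add: y_def)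
  moreover have "c (a (c x)) = a (\<Phi> x)" using x by (simp add: q_def)
  moreover have "c (b (a (\<Phi> x))) = c (a (c (\<Phi> z)))"
    using ab[of "\<Phi> x"] x(1) by (simp add: z)
  ultimately have "b (c (a (c y))) = c (a (c (\<Phi> z)))" by simp
  \<comment> \<open>The edge opposite to \<open>F x\<close> in the next triangle around
    \<open>F x\<close>, reached once around \<open>F y\<close> from \<open>y\<close> and once around
    \<open>F z\<close> from \<open>\<Phi> z\<close>.\<close>
  then have R: "b (q (q y)) = q (q (\<Phi> z))" using ab[of "c (a (c y))"] yY by (simp add: q_def)
  have bz: "b (\<Phi> y) = \<Phi> z" using yY by (simp add: z_def)
  have no2: "(q ^^ 2) u \<noteq> u" if "u \<in> Y" for u using order[OF that, of 2] by simp
  from qy show False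
  proof
    assume "\<Phi> y = (q ^^ 2) y"
    then have "\<Phi> z = (q ^^ 2) (\<Phi> z)" using R bz by (simp add: numeral_eq_Suc)
    then show False using no2[of "\<Phi> z"] zY by simp
  next
    assume y6: "\<Phi> y = (q ^^ 6) y"
    \<comment> \<open>Now the turn at \<open>y\<close> is backwards. Its cube is a forward quarter
      turn, as 18 is 2 modulo 8, whereas two further applications to \<open>\<Phi> z\<close> give a
      half turn in either sense, so \<open>R\<close> equates a quarter turn with a half
      turn.\<close>
    have "\<Phi> (\<Phi> (\<Phi> y)) = (q ^^ 6) ((q ^^ 6) ((q ^^ 6) y))" using y6 \<Phi>qk yY by simp
    also have "\<dots> = (q ^^ 2) ((q ^^ 16) y)" by (simp add: numeral_eq_Suc)
    also have "(q ^^ 16) y = y" using order[OF yY, of 16] by simp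
    finally have "b (\<Phi> (\<Phi> (\<Phi> y))) = q (q (\<Phi> z))" using R by (simp add: numeral_eq_Suc)
    then have z3: "\<Phi> (\<Phi> (\<Phi> z)) = (q ^^ 2) (\<Phi> z)" using yY by (simp add: numeral_eq_Suc z_def)
    have "\<Phi> (\<Phi> (\<Phi> z)) = (q ^^ 4) (\<Phi> z)"
      using qz
    proof
      assume e: "\<Phi> z = (q ^^ 2) z"
      have "\<Phi> (\<Phi> (\<Phi> z)) = (q ^^ 2) ((q ^^ 2) (\<Phi> z))"
        using \<Phi>qk zY e by (metis \<Phi>(1))
      then show ?thesis by (simp add: numeral_eq_Suc)
    next
      assume e: "\<Phi> z = (q ^^ 6) z"
      have "\<Phi> (\<Phi> (\<Phi> z)) = (q ^^ 6) ((q ^^ 6) (\<Phi> z))"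
        using \<Phi>qk zY e by (metis \<Phi>(1))
      also have "\<dots> = (q ^^ 4) ((q ^^ 8) (\<Phi> z))" by (simp add: numeral_eq_Suc)
      also have "(q ^^ 8) (\<Phi> z) = \<Phi> z" using order[of "\<Phi> z" 8] zY by simp
      finally show ?thesis .
    qed
    then have "(q ^^ 2) ((q ^^ 2) (\<Phi> z)) = (q ^^ 2) (\<Phi> z)" using z3 by (simp add: numeral_eq_Suc)
    then show False using no2[of "(q ^^ 2) (\<Phi> z)"] zY by simp
  qed
qed

section \<open>Passing between largest faces\<close>

context polyhedral
begin

text \<open>\<open>r0 (r1 y)\<close> inverts \<open>rot\<close>, and \<open>r0\<close> conjugates
  the two into each other. Both directions occur below as the rotation about a vertex of the
  triangulation.\<close>

lemma rot_back_pow: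
  assumes "y \<in> X" shows "((\<lambda>y. r0 (r1 y)) ^^ k) y = r0 ((rot ^^ k) (r0 y))"
proof (induction k)
  case (Suc k)
  then show ?case using assms by (simp add: rot_def)
qed (use assms in simp)

lemma rot_back_order:
  assumes "y \<in> X" shows "((\<lambda>y. r0 (r1 y)) ^^ k) y = y \<longleftrightarrow> sz y dvd k"
proof -
  have "((\<lambda>y. r0 (r1 y)) ^^ k) y = y \<longleftrightarrow> (rot ^^ k) (r0 y) = r0 y"
    using rot_back_pow[OF assms, of k] assms
    by (metis flags_r01(1,3) rot_closed(3))
  then show ?thesis using rot_pow_eq_iff[of "r0 y" k] assms by simp
qed

lemma rot_back_rot:
  assumes "y \<in> X" shows "((\<lambda>y. r0 (r1 y)) ^^ k) ((rot ^^ k) y) = y"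
proof (induction k)
  case (Suc k)
  have "((\<lambda>y. r0 (r1 y)) ^^ Suc k) ((rot ^^ Suc k) y) = ((\<lambda>y. r0 (r1 y)) ^^ k) (r0 (r1 (rot ((rot ^^ k) y))))"
    by (subst funpow_Suc_right) simp
  also have "r0 (r1 (rot ((rot ^^ k) y))) = (rot ^^ k) y"
    using rot_closed(3)[OF assms, of k] by (simp add: rot_def)
  finally show ?case using Suc by simp
qed simp

lemma rot_r0_rot:
  assumes "y \<in> X" shows "(rot ^^ Suc k) (r0 ((rot ^^ k) y)) = r1 y"
proof (induction k)
  case (Suc k)
  have "(rot ^^ Suc (Suc k)) (r0 ((rot ^^ Suc k) y)) = (rot ^^ Suc k) (rot (r0 (rot ((rot ^^ k) y))))"
    by (subst funpow_Suc_right) simp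
  also have "rot (r0 (rot ((rot ^^ k) y))) = r0 ((rot ^^ k) y)"
    using rot_closed(3)[OF assms, of k] by (simp add: rot_def)
  finally show ?case using Suc by simp
qed (use assms in \<open>simp add: rot_def\<close>)

lemma vert_r0_r2 [simp]: "w \<in> X \<Longrightarrow> vert (r0 (r2 w)) = vert (r0 w)"
  using flags_r2(3)[of "r0 w"] by simp

text \<open>Enter the face across the edge, follow one of its edges and leave through the one after
  it: this reaches the opposite side of a square and the next side but one of a hexagon. It becomes
  the switch of vertices in the triangulation.\<close>

definition cross :: "'a flag \<Rightarrow> 'a flag" where
  "cross y = r2 (r1 (r0 (r1 (r2 y))))"

lemma cross_simps [simp]:
  assumes "y \<in> X" shows "cross y \<in> X" "cross (cross y) = y"
  using assms by (simp_all add: cross_def)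

text \<open>If both flags lay on one face, that face would contain two vertices at distance two on
  the face of \<open>r2 y\<close>, and \<open>common_diagonal\<close> would identify the faces on
  the two sides of the edge of \<open>y\<close>.\<close>

lemma cross_face:
  assumes "y \<in> X" "4 \<le> sz (r2 y)" shows "face (cross y) \<noteq> face y"
proof
  assume e: "face (cross y) = face y"
  have "vert (cross y) = vert (r0 (r1 (r2 y)))" using assms(1) by (simp add: cross_def)
  moreover have "vert (cross y) \<in> \<Union> (face y)"
    using flag_simps(4)[of "cross y"] assms(1) e by simp
  moreover have "vert (r0 (r2 y)) \<in> \<Union> (face y)"
    using flag_simps(4)[of "r0 y"] flags_r2(3,6)[of "r0 y"] flags_r2(6)[OF assms(1)] assms(1)
    by (metis flags_r01(1,5) flags_r2(3))
  ultimately have "face y = face (r0 (r2 y))"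
    using common_diagonal[of "r0 (r2 y)" "face y"] assms flag_simps(1)[OF assms(1)] by simp
  then show False using assms(1) flags_r2(5)[OF assms(1)] by simp
qed

lemma cross_r0_square:
  assumes "y \<in> X" "sz (r2 y) = 4" shows "r0 (cross y) = cross (r0 y)"
proof -
  have "r1 (r0 (r1 (r0 (r2 y)))) = r0 (r1 (r0 (r1 (r2 y))))"
    using r0_r1_order(2)[of "r2 y"] assms by simp
  then show ?thesis using assms(1) by (simp add: cross_def flip: flags_r2(6))
qed

end

context semi_equivelar_map
begin

text \<open>\<open>turn\<close> has order three at such a vertex, which is the braid relation of
  \<open>r1\<close> and \<open>r2\<close>. The listed triples are the readings of the type from all
  offsets in both senses.\<close>

lemma degree3:
  assumes ts: "ts = [p, q, r]" and x: "x \<in> X"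
  shows "r2 (r1 (r2 x)) = r1 (r2 (r1 x))" (is ?thesis1)
    "(sz x, sz (r2 x), sz (r2 (r1 x))) \<in> {(p, q, r), (q, r, p), (r, p, q), (r, q, p), (q, p, r), (p, r, q)}"
proof -
  have "turn (turn (turn x)) = x" using turn_order[OF x] by (simp add: ts)
  then have t: "r1 (r2 (r1 (r2 (r1 (r2 x))))) = x" by (simp add: turn_def)
  have "r2 (r1 (r2 x)) = r1 (r2 (r1 (r1 (r2 (r1 (r2 (r1 (r2 x))))))))" using x by simp
  then show e: "r2 (r1 (r2 x)) = r1 (r2 (r1 x))" by (simp only: t)
  obtain i :: int where i: "0 \<le> i" "i < int (length ts)"
    "(\<forall>k. sz ((turn ^^ k) x) = ts ! nat ((i + int k) mod int (length ts))) \<or>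
     (\<forall>k. sz ((turn ^^ k) x) = ts ! nat ((i - int k) mod int (length ts)))"
    using vertex_sizes[OF x] .
  have sz: "sz x = sz ((turn ^^ 0) x)" "sz (r2 x) = sz ((turn ^^ 1) x)" "sz (r2 (r1 x)) = sz ((turn ^^ 2) x)"
    using x e by (simp_all add: turn_def numeral_eq_Suc)
  have i01: "i = 0 \<or> i = 1 \<or> i = 2" using i(1,2) by (auto simp: ts)
  show "(sz x, sz (r2 x), sz (r2 (r1 x))) \<in> {(p, q, r), (q, r, p), (r, p, q), (r, q, p), (q, p, r), (p, r, q)}" (is ?thesis2)
    using i(3)
  proof (elim disjE)
    assume h: "\<forall>k. sz ((turn ^^ k) x) = ts ! nat ((i + int k) mod int (length ts))"
    show ?thesis2 unfolding sz h[rule_format] using i01 by (elim disjE) (simp_all add: ts)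
  next
    assume h: "\<forall>k. sz ((turn ^^ k) x) = ts ! nat ((i - int k) mod int (length ts))"
    show ?thesis2 unfolding sz h[rule_format] using i01 by (elim disjE) (simp_all add: ts)
  qed
qed

lemma degree4:
  assumes ts: "ts = [p, q, r, s]" and x: "x \<in> X"
  shows "r1 (r2 (r1 (r2 x))) = r2 (r1 (r2 (r1 x)))" (is ?thesis1)
    "(sz x, sz (r2 x), sz (r2 (r1 (r2 x))), sz (r2 (r1 x))) \<in>
      {(p, q, r, s), (q, r, s, p), (r, s, p, q), (s, p, q, r), (s, r, q, p), (r, q, p, s), (q, p, s, r), (p, s, r, q)}"
proof -
  have "turn (turn (turn (turn x))) = x" using turn_order[OF x] by (simp add: ts)
  then have t: "r1 (r2 (r1 (r2 (r1 (r2 (r1 (r2 x))))))) = x" by (simp add: turn_def)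
  have "r1 (r2 (r1 (r2 x))) = r2 (r1 (r2 (r1 (r1 (r2 (r1 (r2 (r1 (r2 (r1 (r2 x)))))))))))" using x by simp
  then show e: "r1 (r2 (r1 (r2 x))) = r2 (r1 (r2 (r1 x)))" by (simp only: t)
  obtain i :: int where i: "0 \<le> i" "i < int (length ts)"
    "(\<forall>k. sz ((turn ^^ k) x) = ts ! nat ((i + int k) mod int (length ts))) \<or>
     (\<forall>k. sz ((turn ^^ k) x) = ts ! nat ((i - int k) mod int (length ts)))"
    using vertex_sizes[OF x] .
  have "turn (turn (turn x)) = r2 (r1 x)" using t x by (simp add: turn_def) (metis e flags_r01(2,4) flags_r2(1,2))
  then have sz: "sz x = sz ((turn ^^ 0) x)" "sz (r2 x) = sz ((turn ^^ 1) x)"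
    "sz (r2 (r1 (r2 x))) = sz ((turn ^^ 2) x)" "sz (r2 (r1 x)) = sz ((turn ^^ 3) x)"
    using x by (simp_all add: turn_def numeral_eq_Suc)
  have i01: "i = 0 \<or> i = 1 \<or> i = 2 \<or> i = 3" using i(1,2) by (auto simp: ts)
  show "(sz x, sz (r2 x), sz (r2 (r1 (r2 x))), sz (r2 (r1 x))) \<in>
      {(p, q, r, s), (q, r, s, p), (r, s, p, q), (s, p, q, r), (s, r, q, p), (r, q, p, s), (q, p, s, r), (p, s, r, q)}" (is ?thesis2)
    using i(3)
  proof (elim disjE)
    assume h: "\<forall>k. sz ((turn ^^ k) x) = ts ! nat ((i + int k) mod int (length ts))"
    show ?thesis2 unfolding sz h[rule_format] using i01 by (elim disjE) (simp_all add: ts)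
  next
    assume h: "\<forall>k. sz ((turn ^^ k) x) = ts ! nat ((i - int k) mod int (length ts))"
    show ?thesis2 unfolding sz h[rule_format] using i01 by (elim disjE) (simp_all add: ts)
  qed
qed

lemma big_faces:
  assumes "Y \<subseteq> {x \<in> X. sz x = p}" "card {f \<in> Faces M. card f = p} \<le> 3"
  shows "finite (face ` Y)" "card (face ` Y) \<le> 3"
proof -
  have "face ` Y \<subseteq> {f \<in> Faces M. card f = p}" using assms(1) flag_simps(1) by blast
  moreover have fin: "finite {f \<in> Faces M. card f = p}" using finite_parts by simp
  ultimately show "finite (face ` Y)" "card (face ` Y) \<le> 3"
    using finite_subset card_mono assms(2) by (blast, metis le_trans)
qed

lemma same_vertex_same_size:
  assumes "count_list ts p = 1" "y \<in> X" "z \<in> X" "vert y = vert z" "sz y = p" "sz z = p"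
  shows "y = z \<or> y = r1 z"
proof -
  have "card {f \<in> Faces M. card f = p \<and> vert z \<in> \<Union> f} = 1"
    using face_sizes_at(2)[OF flag_simps(5)[OF assms(3)]] assms(1) by simp
  then obtain f where "{f \<in> Faces M. card f = p \<and> vert z \<in> \<Union> f} = {f}"
    using card_1_singletonE by blast
  moreover have "face y \<in> {f \<in> Faces M. card f = p \<and> vert z \<in> \<Union> f}"
    "face z \<in> {f \<in> Faces M. card f = p \<and> vert z \<in> \<Union> f}"
    using flag_simps(1,4)[OF assms(2)] flag_simps(1,4)[OF assms(3)] assms(4-6) by auto
  ultimately have "face y = face z" by (metis singletonD)
  then show ?thesis using r1_unique[OF assms(3,2,4)] by blast
qed

text \<open>Symmetries moving the vertex by one and by two steps may both reverse orientation. In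
  that case their composite is the rotation by one step, whose square is the required one; otherwise
  one of the two already suffices, up to squaring.\<close>

lemma half_rotation:
  assumes tr: "vertex_transitive M" and p: "count_list ts p = 1" and x: "x \<in> X" "sz x = p"
  obtains \<Phi> where "symm \<Phi>" "\<Phi> x = rot (rot x)"
proof -
  have at: "\<Psi> x = y \<or> \<Psi> x = r1 y" if "symm \<Psi>" "y \<in> X" "sz y = p" "vert (\<Psi> x) = vert y" for \<Psi> y
    using same_vertex_same_size[OF p _ that(2,4) _ that(3)] symmD[OF that(1) x(1)] x(2) by simp
  obtain \<Phi>1 where 1: "symm \<Phi>1" "vert (\<Phi>1 x) = vert (r0 x)"
    using transitiveE[OF tr x(1), of "r0 x"] x by auto
  obtain \<Phi>2 where 2: "symm \<Phi>2" "vert (\<Phi>2 x) = vert (rot (rot x))"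
    using transitiveE[OF tr x(1), of "rot (rot x)"] x by auto
  have "\<Phi>1 x = r0 x \<or> \<Phi>1 x = rot x"
    using at[OF 1(1) _ _ 1(2)] x by (simp add: rot_def)
  moreover have "\<Phi>2 x = rot (rot x) \<or> \<Phi>2 x = r1 (rot (rot x))"
    using at[OF 2(1) _ _ 2(2)] x by simp
  moreover have "\<exists>\<Phi>. symm \<Phi> \<and> \<Phi> x = rot (rot x)" if "\<Phi>1 x = rot x"
    using symm_comp[OF 1(1) 1(1)] that symmD[OF 1(1)] x
    by (intro exI[of _ "\<lambda>x. \<Phi>1 (\<Phi>1 x)"]) (simp add: rot_def)
  moreover have "\<exists>\<Phi>. symm \<Phi> \<and> \<Phi> x = rot (rot x)"
    if "\<Phi>1 x = r0 x" "\<Phi>2 x = r1 (rot (rot x))"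
  proof -
    let ?\<Psi> = "\<lambda>x. \<Phi>2 (\<Phi>1 x)"
    have \<Psi>: "symm ?\<Psi>" using symm_comp[OF 2(1) 1(1)] .
    have "?\<Psi> x = rot x" using that symmD[OF 2(1)] x by (simp add: rot_def)
    then show ?thesis using symm_comp[OF \<Psi> \<Psi>] symmD[OF \<Psi>] x
      by (intro exI[of _ "\<lambda>x. ?\<Psi> (?\<Psi> x)"]) (simp add: rot_def)
  qed
  ultimately have "\<exists>\<Phi>. symm \<Phi> \<and> \<Phi> x = rot (rot x)" using 2(1) by blast
  then show thesis using that by blast
qed

lemma cross_r1:
  assumes "ts = [p, q, r]" "y \<in> X" shows "r1 (cross y) = cross (r1 y)"
proof -
  note d = degree3(1)[OF assms(1)]
  have "cross (r1 y) = r2 (r1 (r0 (r1 (r2 (r1 y)))))" by (simp add: cross_def)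
  also have "\<dots> = r2 (r1 (r0 (r2 (r1 (r2 y)))))" using d[of y] assms(2) by simp
  also have "\<dots> = r2 (r1 (r2 (r0 (r1 (r2 y)))))" using assms(2) by simp
  also have "\<dots> = r1 (cross y)" using d[of "r0 (r1 (r2 y))"] assms(2) by (simp add: cross_def)
  finally show ?thesis by simp
qed

text \<open>Alternate sides of the hexagon lead to its three largest neighbours; going around them
  gives the triangle relation demanded of \<open>b\<close> and \<open>c\<close>.\<close>

lemma cross_r0_hexagon:
  assumes "y \<in> X" "sz (r2 y) = 6" shows "cross (r0 (cross y)) = r0 (cross (r0 y))"
proof -
  have "cross (r0 (cross y)) = r2 (r1 (r0 (r1 (r0 (r1 (r0 (r1 (r2 y))))))))"
    using assms(1) by (simp add: cross_def flip: flags_r2(6))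
  also have "\<dots> = r2 (r0 (r1 (r0 (r1 (r0 (r2 y))))))"
    using r0_r1_order(3)[of "r2 y"] assms by simp
  also have "\<dots> = r0 (cross (r0 y))" using assms(1) by (simp add: cross_def)
  finally show ?thesis .
qed

lemma ex_flag_of_size:
  assumes "p \<in> set ts" obtains x where "x \<in> X" "sz x = p"
  using flag_of_size[OF assms] Verts_nonempty by (metis all_not_in_conv)

text \<open>Dictionary: an octagon is a vertex of the triangulation, a corner of the octagon an edge
  there, and a side of the octagon a triangle. Hence \<open>r1\<close> switches triangles,
  \<open>r0\<close> switches edges, and two steps along an octagon form a quarter turn.\<close>

lemma not_transitive_6_6_8:
  assumes ts: "ts = [6, 6, 8]" and three: "card {f \<in> Faces M. card f = 8} \<le> 3"
  shows "\<not> vertex_transitive M"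
proof
  assume tr: "vertex_transitive M"
  define Y where "Y = {x \<in> X. sz x = 8}"
  note s = degree3(2)[OF ts]
  obtain x where x: "x \<in> X" "sz x = 8" using ex_flag_of_size[of 8] ts by auto
  have YX: "y \<in> X" "sz y = 8" if "y \<in> Y" for y using that by (simp_all add: Y_def)
  have r2: "sz (r2 y) = 6" if "y \<in> Y" for y using s[of y] YX[OF that] by simp
  have crY: "cross y \<in> Y" if y: "y \<in> Y" for y
  proof -
    have 1: "sz (r2 y) = 6" "sz (r2 (r1 (r2 y))) = 6"
      using s[of y] s[of "r2 y"] YX[OF y] by auto
    have "sz (r2 (r1 (r0 (r1 (r2 y))))) = 8"
      using s[of "r0 (r1 (r2 y))"] 1 YX[OF y] by auto
    then show ?thesis using YX[OF y] by (simp add: Y_def cross_def)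
  qed
  have q: "(\<lambda>y. r1 (r0 y)) = rot" by (simp add: fun_eq_iff rot_def)
  obtain \<Phi> where \<Phi>: "symm \<Phi>" "\<Phi> x = rot (rot x)"
    using half_rotation[OF tr _ x] ts by auto
  show False
  proof (rule no_quarter_turn[of Y r1 cross r0 face \<Phi> x], unfold q)
    show "\<exists>k. \<exists>u \<in> {y, r1 y}. z = (rot ^^ k) u \<or> u = (rot ^^ k) z"
      if yz: "y \<in> Y" "z \<in> Y" "face z = face y" for y z
    proof -
      obtain k where k: "z = (rot ^^ k) y \<or> z = r0 ((rot ^^ k) y)"
        using same_face_cases[OF YX(1)[OF yz(1)] YX(1)[OF yz(2)] yz(3)] by metis
      then show ?thesis using rot_r0_rot[OF YX(1)[OF yz(1)]] by blast
    qed
    show "cross y \<in> Y" if "y \<in> Y" for y using crY that .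
    show "r1 (cross y) = cross (r1 y)" if "y \<in> Y" for y using cross_r1[OF ts YX(1)[OF that]] .
    show "cross (r0 (cross y)) = r0 (cross (r0 y))" if "y \<in> Y" for y
      using cross_r0_hexagon YX(1) r2 that by blast
    show "finite (face ` Y)" "card (face ` Y) \<le> 3" using big_faces[OF _ three, of Y] by (auto simp: Y_def)
    show "face (cross y) \<noteq> face y" if "y \<in> Y" for y using cross_face YX r2 that by simp
    show "((rot ^^ k) y = y) = (8 dvd k)" if "y \<in> Y" for y k
      using rot_pow_eq_iff[of y k] YX[OF that] by simp
    show "\<Phi> x = r1 (r0 (r1 (r0 x)))" using \<Phi>(2) by (simp add: rot_def)
  qed (use symmD[OF \<Phi>(1)] x in \<open>simp_all add: Y_def cross_def\<close>)
qed

text \<open>Here a side of an octagon borders a square, hence gives an edge of the triangulation,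
  and a corner touches a small triangle. The roles of \<open>r0\<close> and \<open>r1\<close> are
  therefore exchanged in comparison with type [6,6,8].\<close>

lemma not_transitive_3_4_8_4:
  assumes ts: "ts = [3, 4, 8, 4]" and three: "card {f \<in> Faces M. card f = 8} \<le> 3"
  shows "\<not> vertex_transitive M"
proof
  assume tr: "vertex_transitive M"
  define Y where "Y = {x \<in> X. sz x = 8}"
  note s = degree4(2)[OF ts] and d = degree4(1)[OF ts]
  obtain x where x: "x \<in> X" "sz x = 8" using ex_flag_of_size[of 8] ts by auto
  have YX: "y \<in> X" "sz y = 8" if "y \<in> Y" for y using that by (simp_all add: Y_def)
  have r2: "sz (r2 y) = 4" "sz (r2 (r1 (r2 y))) = 3" if "y \<in> Y" for y
    using s[of y] YX[OF that] by auto
  have crY: "cross y \<in> Y" if y: "y \<in> Y" for y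
  proof -
    have "sz (r2 (r1 (r0 (r1 (r2 y))))) = 8"
      using s[of "r0 (r1 (r2 y))"] r2[OF y] YX[OF y] by auto
    then show ?thesis using YX[OF y] by (simp add: Y_def cross_def)
  qed
  have bc: "cross (r1 (cross y)) = r1 (cross (r1 y))" if y: "y \<in> Y" for y
  proof -
    have yX [simp]: "y \<in> X" using YX y by simp
    define t where "t = r2 (r1 (r2 y))"
    have t [simp]: "t \<in> X" "sz t = 3" using r2[OF y] by (simp_all add: t_def)
    define w where "w = r0 (r1 (r2 y))"
    have w [simp]: "w \<in> X" "r2 w = r0 t" by (simp_all add: w_def t_def)
    have "r1 (r2 (r1 (r2 (r1 w)))) = r1 (r1 (r2 (r1 (r2 w))))" using d[of w] by simp
    then have 1: "r1 (r2 (r1 (r2 (r1 w)))) = r2 (r1 (r0 t))" by simp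
    have "cross (r1 (cross y)) = r2 (r1 (r0 (r1 (r2 (r1 (r2 (r1 w)))))))"
      by (simp add: cross_def w_def)
    also have "\<dots> = r2 (r1 (r0 (r2 (r1 (r0 t)))))" by (simp only: 1)
    also have "\<dots> = r2 (r1 (r2 (r0 (r1 (r0 t)))))" by simp
    also have "\<dots> = r2 (r1 (r2 (r1 (r0 (r1 t)))))" using r0_r1_order(1)[of t] by simp
    also have "\<dots> = r1 (r2 (r1 (r2 (r0 (r1 t)))))" using d[of "r0 (r1 t)"] by simp
    finally have 2: "cross (r1 (cross y)) = r1 (r2 (r1 (r0 (r2 (r1 t)))))" by simp
    have "r2 (r1 t) = r2 (r2 (r1 (r2 (r1 y))))" using d[of y] by (simp add: t_def)
    then have "r2 (r1 t) = r1 (r2 (r1 y))" by simp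
    then show ?thesis using 2 by (simp add: cross_def)
  qed
  obtain \<Phi> where \<Phi>: "symm \<Phi>" "\<Phi> x = rot (rot x)"
    using half_rotation[OF tr _ x] ts by auto
  show False
  \<comment> \<open>With these roles \<open>q\<close> is inverse to \<open>rot\<close>. Starting
    from the reflected flag \<open>r0 x\<close> turns the given rotation into two forward steps of
    \<open>q\<close>.\<close>
  proof (rule no_quarter_turn[of Y r0 cross r1 face \<Phi> "r0 x"])
    show "\<exists>k. \<exists>u \<in> {y, r0 y}. z = ((\<lambda>y. r0 (r1 y)) ^^ k) u \<or> u = ((\<lambda>y. r0 (r1 y)) ^^ k) z"
      if yz: "y \<in> Y" "z \<in> Y" "face z = face y" for y z
    proof -
      note yX = YX(1)[OF yz(1)]
      obtain k where k: "z = (rot ^^ k) y \<or> z = r0 ((rot ^^ k) y)"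
        using same_face_cases[OF yX YX(1)[OF yz(2)] yz(3)] by metis
      moreover have "y = ((\<lambda>y. r0 (r1 y)) ^^ k) ((rot ^^ k) y)" using rot_back_rot[OF yX] by simp
      moreover have "r0 ((rot ^^ k) y) = ((\<lambda>y. r0 (r1 y)) ^^ k) (r0 y)"
        using rot_back_pow[of "r0 y" k] yX by simp
      ultimately show ?thesis by auto
    qed
    show "(((\<lambda>y. r0 (r1 y)) ^^ k) y = y) = (8 dvd k)" if "y \<in> Y" for y k
      using rot_back_order[of y k] YX[OF that] by simp
    show "cross y \<in> Y" if "y \<in> Y" for y using crY that .
    show "r0 (cross y) = cross (r0 y)" if "y \<in> Y" for y using cross_r0_square YX r2 that by simp
    show "cross (r1 (cross y)) = r1 (cross (r1 y))" if "y \<in> Y" for y using bc that .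
    show "finite (face ` Y)" "card (face ` Y) \<le> 3" using big_faces[OF _ three, of Y] by (auto simp: Y_def)
    show "face (cross y) \<noteq> face y" if "y \<in> Y" for y using cross_face YX r2 that by simp
    show "\<Phi> (r0 x) = r0 (r1 (r0 (r1 (r0 x))))"
      using \<Phi>(2) x symmD[OF \<Phi>(1)] by (simp add: rot_def)
  qed (use symmD[OF \<Phi>(1)] x in \<open>simp_all add: Y_def cross_def\<close>)
qed

text \<open>Sides of a 16-gon border squares and hexagons alternately. Only flags at squares are
  kept, so two steps along the 16-gon count as one and the degree is 8;
  \<open>r1 (r0 (r1 y))\<close> passes over the side at a hexagon.\<close>

lemma not_transitive_4_6_16:
  assumes ts: "ts = [4, 6, 16]" and three: "card {f \<in> Faces M. card f = 16} \<le> 3"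
  shows "\<not> vertex_transitive M"
proof
  assume tr: "vertex_transitive M"
  define Y where "Y = {x \<in> X. sz x = 16 \<and> sz (r2 x) = 4}"
  define qi :: "'a flag \<Rightarrow> 'a flag" where "qi = (\<lambda>y. r0 (r1 y))"
  note s = degree3(2)[OF ts]
  obtain x0 where x0: "x0 \<in> X" "sz x0 = 16" using ex_flag_of_size[of 16] ts by auto
  have "x0 \<in> Y \<or> r1 x0 \<in> Y" using s[OF x0(1)] x0 by (auto simp: Y_def)
  then obtain x where x: "x \<in> Y" by blast
  have YX: "y \<in> X" "sz y = 16" "sz (r2 y) = 4" "sz (r2 (r1 y)) = 6" if "y \<in> Y" for y
    using that s[of y] by (auto simp: Y_def)
  have r0Y: "r0 y \<in> Y" if y: "y \<in> Y" for y using YX[OF y] by (simp add: Y_def)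
  have cY: "r1 (r0 (r1 y)) \<in> Y" if y: "y \<in> Y" for y
    using YX[OF y] s[of "r0 (r1 y)"] by (auto simp: Y_def)
  have crY: "cross y \<in> Y" if y: "y \<in> Y" for y
  proof -
    have "sz (r2 (r1 (r2 y))) = 6" using s[of "r2 y"] YX[OF y] by auto
    then have "sz (r2 (r1 (r0 (r1 (r2 y))))) = 16"
      using s[of "r0 (r1 (r2 y))"] YX[OF y] by auto
    then show ?thesis using YX[OF y] by (simp add: Y_def cross_def)
  qed
  have bc: "cross (r1 (r0 (r1 (cross y)))) = r1 (r0 (r1 (cross (r1 (r0 (r1 y))))))" if y: "y \<in> Y" for y
  proof -
    note c = cross_r1[OF ts]
    have "cross (r1 (r0 (r1 (cross y)))) = r1 (cross (r0 (cross (r1 y))))"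
      using YX[OF y] by (simp add: c)
    also have "cross (r0 (cross (r1 y))) = r0 (cross (r0 (r1 y)))"
      by (rule cross_r0_hexagon) (use YX[OF y] in simp_all)
    also have "r1 (r0 (cross (r0 (r1 y)))) = r1 (r0 (r1 (cross (r1 (r0 (r1 y))))))"
      using YX[OF y] by (simp add: c)
    finally show ?thesis .
  qed
  have par: "(rot ^^ k) y \<in> Y \<longleftrightarrow> even k" if y: "y \<in> Y" for y k
  proof -
    have "sz ((rot ^^ k) y) = 16 \<and> sz (r2 ((rot ^^ k) y)) = (if even k then 4 else 6)"
    proof (induction k)
      case (Suc k)
      define w where "w = (rot ^^ k) y"
      have w: "w \<in> X" using YX[OF y] by (simp add: w_def)
      have "sz (r2 (r1 (r0 w))) = (if even k then 6 else 4)"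
        using s[of "r0 w"] w Suc by (auto simp: w_def[symmetric] split: if_splits)
      then show ?case using w Suc by (simp add: w_def[symmetric]) (simp add: rot_def)
    qed (use YX[OF y] in simp)
    then show ?thesis using YX[OF y] by (simp add: Y_def)
  qed
  have q: "(\<lambda>y. r0 (r1 (r0 (r1 y)))) = qi ^^ 2" by (simp add: fun_eq_iff qi_def numeral_2_eq_2)
  have qk: "((\<lambda>y. r0 (r1 (r0 (r1 y)))) ^^ k) = qi ^^ (2 * k)" for k
    by (simp add: q funpow_mult)
  obtain \<Phi> where \<Phi>: "symm \<Phi>" "vert (\<Phi> x) = vert (r0 (r1 (r0 (r1 (r0 (r1 (r0 (r1 x))))))))"
    using transitiveE[OF tr, of x "r0 (r1 (r0 (r1 (r0 (r1 (r0 (r1 x)))))))"] YX[OF x] by auto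
  note \<Phi>s = symmD[OF \<Phi>(1)]
  have \<Phi>Y: "\<Phi> y \<in> Y" if y: "y \<in> Y" for y
    using \<Phi>s[of y] \<Phi>s(4,5)[of "r2 y"] \<Phi>s(5)[of "r2 y"] YX[OF y] by (simp add: Y_def)
  define u where "u = r0 (r1 (r0 (r1 (r0 (r1 (r0 (r1 x)))))))"
  have u: "u \<in> Y" using x cY r0Y by (simp add: u_def)
  have "\<Phi> x = u \<or> \<Phi> x = r1 u"
    using same_vertex_same_size[of 16 "\<Phi> x" u] \<Phi>(2) YX[OF u] YX[OF \<Phi>Y[OF x]] by (simp add: ts u_def)
  \<comment> \<open>The reflected candidate borders a hexagon while symmetries preserve
    \<open>Y\<close>, so the image of the vertex already determines the image of the flag. Four
    steps out of 16 make the quarter turn.\<close>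
  moreover have "r1 u \<notin> Y" using YX[OF u] by (simp add: Y_def)
  ultimately have \<Phi>x: "\<Phi> x = u" using \<Phi>Y[OF x] by metis
  show False
  proof (rule no_quarter_turn[of Y r0 cross "\<lambda>y. r1 (r0 (r1 y))" face \<Phi> x], unfold qk)
    show "\<exists>k. \<exists>u \<in> {y, r0 y}. z = (qi ^^ (2 * k)) u \<or> u = (qi ^^ (2 * k)) z"
      if yz: "y \<in> Y" "z \<in> Y" "face z = face y" for y z
    proof -
      note yX = YX(1)[OF yz(1)]
      obtain k where k: "z = (rot ^^ k) y \<or> z = r0 ((rot ^^ k) y)"
        using same_face_cases[OF yX YX(1)[OF yz(2)] yz(3)] by metis
      then have "(rot ^^ k) y \<in> Y" using yz(2) r0Y[OF yz(2)] yX by auto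
      then obtain j where j: "k = 2 * j" using par[OF yz(1)] by blast
      have "y = (qi ^^ k) ((rot ^^ k) y)" using rot_back_rot[OF yX] by (simp add: qi_def)
      moreover have "r0 ((rot ^^ k) y) = (qi ^^ k) (r0 y)"
        using rot_back_pow[of "r0 y" k] yX by (simp add: qi_def)
      ultimately show ?thesis using k j by auto
    qed
    show "((qi ^^ (2 * k)) y = y) = (8 dvd k)" if "y \<in> Y" for y k
      using rot_back_order[of y "2 * k"] YX[OF that] by (auto simp: qi_def)
    show "cross y \<in> Y" if "y \<in> Y" for y using crY that .
    show "r0 (cross y) = cross (r0 y)" if "y \<in> Y" for y using cross_r0_square YX that by simp
    show "cross (r1 (r0 (r1 (cross y)))) = r1 (r0 (r1 (cross (r1 (r0 (r1 y))))))" if "y \<in> Y" for y using bc that .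
    show "finite (face ` Y)" "card (face ` Y) \<le> 3" using big_faces[OF _ three, of Y] by (auto simp: Y_def)
    show "face (cross y) \<noteq> face y" if "y \<in> Y" for y using cross_face YX that by simp
    show "\<Phi> (cross y) = cross (\<Phi> y)" if "y \<in> Y" for y
      using \<Phi>s YX(1)[OF that] by (simp add: cross_def)
    show "\<Phi> x = r0 (r1 (r0 (r1 (r0 (r1 (r0 (r1 x)))))))" using \<Phi>x by (simp add: u_def)
  qed (use YX \<Phi>s \<Phi>Y x r0Y cY in simp_all)
qed

section \<open>Type [3,4,3,4,4]\<close>

lemma degree5:
  assumes ts: "ts = [p, q, r, s, t']" and x: "x \<in> X"
  shows "(sz x, sz (r2 x), sz (r2 (r1 (r2 x))), sz (r2 (r1 (r2 (r1 x)))), sz (r2 (r1 x))) \<in>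
      {(p, q, r, s, t'), (q, r, s, t', p), (r, s, t', p, q), (s, t', p, q, r), (t', p, q, r, s),
       (t', s, r, q, p), (s, r, q, p, t'), (r, q, p, t', s), (q, p, t', s, r), (p, t', s, r, q)}" (is ?thesis2)
proof -
  have "turn (turn (turn (turn (turn x)))) = x" using turn_order[OF x] by (simp add: ts)
  then have t: "r1 (r2 (r1 (r2 (r1 (r2 (r1 (r2 (r1 (r2 x))))))))) = x" by (simp add: turn_def)
  have "r2 (r1 x) = r2 (r1 (r1 (r2 (r1 (r2 (r1 (r2 (r1 (r2 (r1 (r2 x)))))))))))" by (simp only: t)
  then have e1: "r2 (r1 x) = r1 (r2 (r1 (r2 (r1 (r2 (r1 (r2 x)))))))" using x by simp
  then have e2: "r2 (r1 (r2 (r1 x))) = r1 (r2 (r1 (r2 (r1 (r2 x)))))" using x by simp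
  obtain i :: int where i: "0 \<le> i" "i < int (length ts)"
    "(\<forall>k. sz ((turn ^^ k) x) = ts ! nat ((i + int k) mod int (length ts))) \<or>
     (\<forall>k. sz ((turn ^^ k) x) = ts ! nat ((i - int k) mod int (length ts)))"
    using vertex_sizes[OF x] .
  have sz: "sz x = sz ((turn ^^ 0) x)" "sz (r2 x) = sz ((turn ^^ 1) x)"
    "sz (r2 (r1 (r2 x))) = sz ((turn ^^ 2) x)" "sz (r2 (r1 (r2 (r1 x)))) = sz ((turn ^^ 3) x)"
    "sz (r2 (r1 x)) = sz ((turn ^^ 4) x)"
    unfolding e1 e2 using x by (simp_all add: turn_def numeral_eq_Suc)
  have i01: "i = 0 \<or> i = 1 \<or> i = 2 \<or> i = 3 \<or> i = 4" using i(1,2) by (auto simp: ts)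
  show ?thesis2
    using i(3)
  proof (elim disjE)
    assume h: "\<forall>k. sz ((turn ^^ k) x) = ts ! nat ((i + int k) mod int (length ts))"
    show ?thesis2 unfolding sz h[rule_format] using i01 by (elim disjE) (simp_all add: ts)
  next
    assume h: "\<forall>k. sz ((turn ^^ k) x) = ts ! nat ((i - int k) mod int (length ts))"
    show ?thesis2 unfolding sz h[rule_format] using i01 by (elim disjE) (simp_all add: ts)
  qed
qed

lemma not_transitive_3_4_3_4_4:
  assumes ts: "ts = [3, 4, 3, 4, 4]"
  shows "\<not> vertex_transitive M"
proof
  assume tr: "vertex_transitive M"
  \<comment> \<open>The flags of the one square at each vertex that lies between two triangles
    there; the other two squares are adjacent. The set is preserved by symmetries.\<close>
  define Z where "Z = {x \<in> X. sz x = 4 \<and> sz (r2 x) = 3 \<and> sz (r2 (r1 x)) = 3}"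
  note s = degree5[OF ts]
  have ZX: "x \<in> X" if "x \<in> Z" for x using that by (simp add: Z_def)
  have r1Z: "r1 x \<in> Z" if "x \<in> Z" for x using that by (auto simp: Z_def)
  have tri: "r2 y \<in> Z \<longleftrightarrow> r2 (r1 y) \<notin> Z" if "y \<in> X" "sz y = 3" for y
    using s[OF that(1)] that by (auto simp: Z_def)
  have Zr0: "r0 x \<in> Z \<or> sz (r2 (r1 (r0 x))) = 4" if "x \<in> Z" for x
    using s[of "r0 x"] that by (auto simp: Z_def)
  have no444: "\<not> (sz (r2 y) = 4 \<and> sz (r2 (r1 y)) = 4)" if "y \<in> X" "sz y = 4" for y
    using s[OF that(1)] that by auto
  have same: "y = z \<or> y = r1 z" if yz: "y \<in> Z" "z \<in> Z" "vert y = vert z" for y z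
  proof -
    note zX = ZX[OF yz(2)]
    obtain k where k: "k < length ts" "y = (turn ^^ k) z \<or> y = r1 ((turn ^^ k) z)"
      using same_vertex_cases[OF zX ZX[OF yz(1)] yz(3)] .
    then have w: "(turn ^^ k) z \<in> Z" using yz(1) r1Z zX by (metis flags_r01(4) turn_closed(3))
    have "sz (turn z) = 3" using zX yz(2) by (simp add: turn_def Z_def)
    moreover have "sz (turn (turn z)) = 4" "sz (turn (turn (turn z))) = 4" "sz (turn (turn (turn (turn z)))) = 3"
    proof -
      obtain i :: int where i: "0 \<le> i" "i < int (length ts)"
        "(\<forall>k. sz ((turn ^^ k) z) = ts ! nat ((i + int k) mod int (length ts))) \<or>
         (\<forall>k. sz ((turn ^^ k) z) = ts ! nat ((i - int k) mod int (length ts)))"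
        using vertex_sizes[OF zX] .
      have i01: "i = 0 \<or> i = 1 \<or> i = 2 \<or> i = 3 \<or> i = 4" using i(1,2) by (auto simp: ts)
      have a: "sz ((turn ^^ 0) z) = 4" "sz ((turn ^^ 1) z) = 3" "sz (r2 (r1 z)) = 3"
        using yz(2) zX by (simp_all add: Z_def turn_def)
      have "(turn ^^ 4) z = r2 (r1 z)"
      proof -
        have "turn ((turn ^^ 4) z) = z" using turn_order[OF zX] by (simp add: ts numeral_eq_Suc)
        then have "r2 (r1 (turn ((turn ^^ 4) z))) = r2 (r1 z)" by simp
        then show ?thesis using turn_closed(3)[OF zX, of 4] by (simp add: turn_def)
      qed
      then have b: "sz ((turn ^^ 4) z) = 3" using a by simp
      have "sz ((turn ^^ 2) z) = 4 \<and> sz ((turn ^^ 3) z) = 4"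
        using i(3)
      proof (elim disjE)
        assume h: "\<forall>k. sz ((turn ^^ k) z) = ts ! nat ((i + int k) mod int (length ts))"
        show ?thesis using i01 a(1,2) b unfolding h[rule_format] by (elim disjE) (simp_all add: ts)
      next
        assume h: "\<forall>k. sz ((turn ^^ k) z) = ts ! nat ((i - int k) mod int (length ts))"
        show ?thesis using i01 a(1,2) b unfolding h[rule_format] by (elim disjE) (simp_all add: ts)
      qed
      then show "sz (turn (turn z)) = 4" "sz (turn (turn (turn z))) = 4" "sz (turn (turn (turn (turn z)))) = 3"
        using b by (simp_all add: numeral_eq_Suc)
    qed
    moreover have "sz (r2 ((turn ^^ k) z)) = sz (turn ((turn ^^ k) z))"
      using turn_closed(3)[OF zX, of k] by (simp add: turn_def)
    moreover have "r2 (r1 (turn (turn z))) = turn z"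
      "r2 (r1 (turn (turn (turn z)))) = turn (turn z)"
      using zX by (simp_all add: turn_def)
    moreover have "k = 0 \<or> k = 1 \<or> k = 2 \<or> k = 3 \<or> k = 4" using k(1) by (auto simp: ts)
    ultimately have "k = 0" using w by (auto simp: Z_def numeral_eq_Suc)
    then show ?thesis using k(2) by simp
  qed
  have \<Phi>Z: "\<Phi> x \<in> Z \<longleftrightarrow> x \<in> Z" if "symm \<Phi>" "x \<in> X" for \<Phi> x
  proof -
    note d = symmD[OF that(1)]
    have "sz (r2 (\<Phi> x)) = sz (r2 x)" "sz (r2 (r1 (\<Phi> x))) = sz (r2 (r1 x))"
      using d(4)[of x] d(5)[of "r2 x"] d(3)[of x] d(4)[of "r1 x"] d(5)[of "r2 (r1 x)"] that(2) by simp_all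
    then show ?thesis using d(1,5)[OF that(2)] that(2) by (simp add: Z_def)
  qed
  obtain y where y: "y \<in> X" "sz y = 3" using ex_flag_of_size[of 3] ts by auto
  then have "\<exists>x. x \<in> Z" using tri by blast
  then obtain x0 where x0: "x0 \<in> Z" ..
  show False
  proof (cases "\<exists>x \<in> Z. r0 x \<in> Z \<and> r0 (r1 x) \<in> Z")
    case True
    then obtain x where x: "x \<in> Z" "r0 x \<in> Z" "r0 (r1 x) \<in> Z" by blast
    \<comment> \<open>An edge marked by \<open>Z\<close> at one end is then marked at both. By
      \<open>tri\<close> each corner of a triangle has exactly one marked side, while every marked
      side serves two of the three corners, which is the parity conflict.\<close>
    have all: "r0 z \<in> Z" if z: "z \<in> Z" for z
    proof -
      obtain \<Phi> where \<Phi>: "symm \<Phi>" "vert (\<Phi> x) = vert z" using transitiveE[OF tr ZX[OF x(1)] ZX[OF z]] .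
      note d = symmD[OF \<Phi>(1)]
      have xX: "x \<in> X" using ZX x(1) .
      have "z = \<Phi> x \<or> z = r1 (\<Phi> x)" using same[OF z, of "\<Phi> x"] \<Phi>Z[OF \<Phi>(1) xX] x(1) \<Phi>(2) by simp
      moreover have "r0 (\<Phi> x) = \<Phi> (r0 x)" "r0 (r1 (\<Phi> x)) = \<Phi> (r0 (r1 x))" using d xX by simp_all
      ultimately show ?thesis using \<Phi>Z[OF \<Phi>(1)] x xX by auto
    qed
    define y where "y = r2 x"
    have y: "y \<in> X" "sz y = 3" "r2 y = x" using x(1) by (simp_all add: y_def Z_def)
    define z where "z = r0 (r1 y)"
    have z: "z \<in> X" "sz z = 3" using y by (simp_all add: z_def)
    have "r2 (r1 y) \<notin> Z" using tri[OF y(1,2)] y(3) x(1) by simp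
    then have "r2 z \<notin> Z" using all[of "r2 z"] y(1) by (auto simp: z_def)
    then have "r2 (r1 z) \<in> Z" using tri[OF z] by simp
    then have "r0 (r2 (r1 z)) \<in> Z" by (rule all)
    moreover have "r0 (r2 (r1 z)) = r2 (r1 (r0 y))"
      using r0_r1_order(1)[of "r1 y"] y by (simp add: z_def flip: flags_r2(6))
    moreover have "r2 (r0 y) \<in> Z" using all[OF x(1)] y by simp
    ultimately show False using tri[of "r0 y"] y by simp
  next
    case False
    \<comment> \<open>If both neighbours failed, the opposite corner of the square would have
      squares across both of its sides, hence three consecutive squares.\<close>
    have one: "r0 x \<in> Z \<or> r0 (r1 x) \<in> Z" if x: "x \<in> Z" for x
    proof (rule ccontr)
      assume n: "\<not> ?thesis"
      note xX = ZX[OF x]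
      have "sz x = 4" using x by (simp add: Z_def)
      have "sz (r2 (r1 (r0 x))) = 4" "sz (r2 (r1 (r0 (r1 x)))) = 4"
        using Zr0[OF x] Zr0[OF r1Z[OF x]] n by auto
      moreover have "r1 (r0 (r1 (r0 x))) = r0 (r1 (r0 (r1 x)))"
        using r0_r1_order(2)[OF xX] \<open>sz x = 4\<close> by simp
      ultimately show False
        using no444[of "r0 (r1 (r0 x))"] xX \<open>sz x = 4\<close> by simp
    qed
    obtain x where x: "x \<in> Z" "r0 x \<in> Z" using one[OF x0] x0 r1Z by blast
    have xX: "x \<in> X" using ZX x(1) .
    have "r0 (r1 (r0 x)) \<notin> Z" using False x xX by auto
    obtain \<Phi> where \<Phi>: "symm \<Phi>" "vert (\<Phi> x) = vert (r0 x)"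
      using transitiveE[OF tr xX, of "r0 x"] xX by auto
    note d = symmD[OF \<Phi>(1)]
    have "\<Phi> x = r0 x \<or> \<Phi> x = r1 (r0 x)"
      using same[of "\<Phi> x" "r0 x"] \<Phi>Z[OF \<Phi>(1) xX] x \<Phi>(2) by simp
    moreover have "r0 (\<Phi> x) \<in> Z" using \<Phi>Z[OF \<Phi>(1), of "r0 x"] d(2)[OF xX] x(2) xX by simp
    \<comment> \<open>So the symmetry reverses this edge. It also reflects the triangle behind the
      edge and exchanges the two faces beside its far corner, of which only one is marked by
      \<open>tri\<close>.\<close>
    ultimately have \<Phi>x: "\<Phi> x = r0 x" using \<open>r0 (r1 (r0 x)) \<notin> Z\<close> by metis
    define z where "z = r0 (r1 (r2 x))"
    have z: "z \<in> X" "sz z = 3" using x(1) xX by (simp_all add: z_def Z_def)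
    have "r2 (r0 (r1 (r2 (\<Phi> x)))) = \<Phi> (r2 z)" using d xX by (simp add: z_def)
    moreover have "r0 (r1 (r2 (r0 x))) = r1 z"
      using r0_r1_order(1)[of "r2 x"] xX x(1) by (simp add: z_def Z_def)
    ultimately have "\<Phi> (r2 z) = r2 (r1 z)" using \<Phi>x by simp
    then show False using tri[OF z] \<Phi>Z[OF \<Phi>(1), of "r2 z"] z by simp
  qed
qed

end

section \<open>Type $[3^5,4]$\<close>

locale snub = semi_equivelar_map +
  assumes ts: "ts = [3, 3, 3, 3, 3, 4]"
    and transitive: "vertex_transitive M"
    and three: "card {f \<in> Faces M. card f = 4} = 3"
begin

definition Q :: "'a flag set" where "Q = {x \<in> X. sz x = 4}"

text \<open>Around the vertex of a square flag \<open>x\<close>, starting across the edge of \<open>x\<close>, the flags \<open>r2 x\<close>,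
  \<open>t2 x\<close>, \<open>t3 x\<close> and \<open>t4 x\<close> lie in the first, second, third and fourth triangle. A flag of a triangle
  satisfies \<open>apex\<close> if the edge of the triangle opposite to its vertex is an edge of a square.\<close>

definition t2 :: "'a flag \<Rightarrow> 'a flag" where "t2 x = r2 (r1 (r2 x))"
definition t3 :: "'a flag \<Rightarrow> 'a flag" where "t3 x = r2 (r1 (t2 x))"
definition t4 :: "'a flag \<Rightarrow> 'a flag" where "t4 x = r2 (r1 (t3 x))"

definition apex :: "'a flag \<Rightarrow> bool" where "apex w \<longleftrightarrow> sz (r2 (r1 (r0 w))) = 4"

definition sq :: "'a \<Rightarrow> 'a set set" where "sq v = (THE f. f \<in> Faces M \<and> card f = 4 \<and> v \<in> \<Union> f)"

section \<open>Triangles and squares around a vertex\<close>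

lemma QX: "x \<in> Q \<Longrightarrow> x \<in> X" "x \<in> Q \<Longrightarrow> sz x = 4"
  by (simp_all add: Q_def)

lemma Q_closed: "x \<in> Q \<Longrightarrow> r0 x \<in> Q" "x \<in> Q \<Longrightarrow> r1 x \<in> Q"
  by (simp_all add: Q_def)

lemma t_closed [simp]: "x \<in> X \<Longrightarrow> t2 x \<in> X" "x \<in> X \<Longrightarrow> t3 x \<in> X" "x \<in> X \<Longrightarrow> t4 x \<in> X"
  by (simp_all add: t2_def t3_def t4_def)

lemma vert_t [simp]: "x \<in> X \<Longrightarrow> vert (t2 x) = vert x" "x \<in> X \<Longrightarrow> vert (t3 x) = vert x" "x \<in> X \<Longrightarrow> vert (t4 x) = vert x"
  by (simp_all add: t2_def t3_def t4_def)

lemma turn6: "x \<in> X \<Longrightarrow> turn (turn (turn (turn (turn (turn x))))) = x"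
  using turn_order[of x] by (simp add: ts)

lemma t_reverse:
  assumes x: "x \<in> X" shows "t2 (r1 x) = r1 (t4 x)" "t3 (r1 x) = r1 (t3 x)" "t4 (r1 x) = r1 (t2 x)"
proof -
  have t: "r1 (r2 (r1 (r2 (r1 (r2 (r1 (r2 (r1 (r2 (r1 (r2 x))))))))))) = x"
    using turn6[OF x] by (simp add: turn_def)
  have "r2 (r1 x) = r2 (r1 (r1 (r2 (r1 (r2 (r1 (r2 (r1 (r2 (r1 (r2 (r1 (r2 x)))))))))))))"
    by (simp only: t)
  then have e: "r2 (r1 x) = r1 (r2 (r1 (r2 (r1 (r2 (r1 (r2 (r1 (r2 x)))))))))" using x by simp
  show "t2 (r1 x) = r1 (t4 x)" "t3 (r1 x) = r1 (t3 x)" "t4 (r1 x) = r1 (t2 x)"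
    using x by (simp_all add: t2_def t3_def t4_def e)
qed

lemma turn_sizes:
  assumes x: "x \<in> Q" and k: "k < 5" shows "sz ((turn ^^ Suc k) x) = 3"
proof -
  note xX = QX(1)[OF x]
  obtain i :: int where i: "0 \<le> i" "i < int (length ts)"
    "(\<forall>k. sz ((turn ^^ k) x) = ts ! nat ((i + int k) mod int (length ts))) \<or>
     (\<forall>k. sz ((turn ^^ k) x) = ts ! nat ((i - int k) mod int (length ts)))"
    using vertex_sizes[OF xX] .
  have i01: "i = 0 \<or> i = 1 \<or> i = 2 \<or> i = 3 \<or> i = 4 \<or> i = 5" using i(1,2) by (auto simp: ts)
  have a: "sz ((turn ^^ 0) x) = 4" using QX(2)[OF x] by simp
  have i5: "i = 5" using i(3)
  proof (elim disjE)
    assume h: "\<forall>k. sz ((turn ^^ k) x) = ts ! nat ((i + int k) mod int (length ts))"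
    show ?thesis using i01 a unfolding h[rule_format] by (elim disjE) (simp_all add: ts)
  next
    assume h: "\<forall>k. sz ((turn ^^ k) x) = ts ! nat ((i - int k) mod int (length ts))"
    show ?thesis using i01 a unfolding h[rule_format] by (elim disjE) (simp_all add: ts)
  qed
  have k: "k = 0 \<or> k = 1 \<or> k = 2 \<or> k = 3 \<or> k = 4" using k by auto
  show ?thesis using i(3)
  proof (elim disjE)
    assume h: "\<forall>k. sz ((turn ^^ k) x) = ts ! nat ((i + int k) mod int (length ts))"
    show ?thesis unfolding h[rule_format] i5 using k by (elim disjE) (simp_all add: ts)
  next
    assume h: "\<forall>k. sz ((turn ^^ k) x) = ts ! nat ((i - int k) mod int (length ts))"
    show ?thesis unfolding h[rule_format] i5 using k by (elim disjE) (simp_all add: ts)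
  qed
qed

lemma t_sizes:
  assumes x: "x \<in> Q"
  shows "sz (r2 x) = 3" "sz (t2 x) = 3" "sz (t3 x) = 3" "sz (t4 x) = 3"
    "sz (r2 (t2 x)) = 3" "sz (r2 (t3 x)) = 3" "sz (r2 (t4 x)) = 3"
    "sz (r2 (r1 (t2 x))) = 3" "sz (r2 (r1 (t3 x))) = 3"
  using turn_sizes[OF x, of 0] turn_sizes[OF x, of 1] turn_sizes[OF x, of 2] turn_sizes[OF x, of 3] QX(1)[OF x]
  by (simp_all add: t2_def t3_def t4_def turn_def numeral_eq_Suc)

lemma Q_at: assumes "w \<in> X" obtains x where "x \<in> Q" "vert x = vert w"
proof -
  have "4 \<in> set ts" by (simp add: ts)
  from flag_of_size[OF this flag_simps(5)[OF assms]] show thesis using that by (metis (mono_tags, lifting) Q_def mem_Collect_eq)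
qed

lemma Q_same: "y \<in> Q \<Longrightarrow> z \<in> Q \<Longrightarrow> vert y = vert z \<Longrightarrow> y = z \<or> y = r1 z"
  by (rule same_vertex_same_size[of 4]) (simp_all add: Q_def ts)

lemma triangle_cases:
  assumes w: "w \<in> X" "sz w = 3"
  obtains x where "x \<in> Q" "vert x = vert w"
    "w \<in> {r2 x, r1 (r2 x), t2 x, r1 (t2 x), t3 x}"
proof -
  obtain x where x: "x \<in> Q" "vert x = vert w" using Q_at[OF w(1)] .
  note xX = QX(1)[OF x(1)]
  obtain k where k: "k < length ts" "w = (turn ^^ k) x \<or> w = r1 ((turn ^^ k) x)"
    using same_vertex_cases[OF xX w(1) x(2)[symmetric]] .
  have e: "turn x = r1 (r2 x)" "turn (turn x) = r1 (t2 x)" "turn (turn (turn x)) = r1 (t3 x)"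
    "turn (turn (turn (turn x))) = r1 (t4 x)"
    using xX by (simp_all add: turn_def t2_def t3_def t4_def)
  have "r2 (r1 (turn (turn (turn (turn (turn (turn x))))))) = r2 (r1 x)" using turn6[OF xX] by simp
  then have e5: "turn (turn (turn (turn (turn x)))) = r2 (r1 x)" using xX by (simp add: turn_def)
  have "k \<noteq> 0"
  proof
    assume "k = 0"
    then have "w = x \<or> w = r1 x" using k(2) by simp
    then show False using w(2) QX[OF x(1)] by auto
  qed
  then consider "k = 1" | "k = 2" | "k = 3" | "k = 4" | "k = 5" using k(1) by (auto simp: ts) linarith
  then show thesis
  proof cases
    case 1 then show ?thesis using that[OF x] k(2) e(1) xX by auto
  next
    case 2 then show ?thesis using that[OF x] k(2) e(2) xX by (auto simp: numeral_eq_Suc)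
  next
    case 3
    then have "w = r1 (t3 x) \<or> w = t3 x" using k(2) e(3) xX by (auto simp: numeral_eq_Suc)
    then show ?thesis using that[OF x] that[OF Q_closed(2)[OF x(1)]] x(2) xX t_reverse(2)[OF xX] by auto
  next
    case 4
    then have "w = r1 (t4 x) \<or> w = t4 x" using k(2) e(4) xX by (auto simp: numeral_eq_Suc)
    then show ?thesis using that[OF Q_closed(2)[OF x(1)]] x(2) xX t_reverse(1)[OF xX] by auto
  next
    case 5
    then have "w = r2 (r1 x) \<or> w = r1 (r2 (r1 x))" using k(2) e5 xX by (auto simp: numeral_eq_Suc)
    then show ?thesis using that[OF Q_closed(2)[OF x(1)]] x(2) xX by auto
  qed
qed

lemma apex_r1: "w \<in> X \<Longrightarrow> sz w = 3 \<Longrightarrow> apex (r1 w) \<longleftrightarrow> apex w"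
  using r0_r1_order(1)[of w, symmetric] by (simp add: apex_def)

text \<open>The third side of a triangle that borders the square at its vertex leads to the second
  triangle of the neighbouring vertex of that square.\<close>

lemma not_apex_first: "x \<in> Q \<Longrightarrow> \<not> apex (r2 x)"
  using t_sizes(2)[OF Q_closed(1), of x] QX(1)[of x] by (simp add: apex_def t2_def)

lemma apex_cases:
  assumes w: "w \<in> X" "sz w = 3" "apex w"
  obtains x where "x \<in> Q" "vert x = vert w" "w = t2 x \<or> w = r1 (t2 x)" "apex (t2 x)"
  | x where "x \<in> Q" "vert x = vert w" "w = t3 x" "apex (t3 x)"
proof -
  obtain x where x: "x \<in> Q" "vert x = vert w" "w \<in> {r2 x, r1 (r2 x), t2 x, r1 (t2 x), t3 x}"
    using triangle_cases[OF w(1,2)] .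
  have "w \<noteq> r2 x" "w \<noteq> r1 (r2 x)"
    using not_apex_first[OF x(1)] apex_r1[of "r2 x"] t_sizes(1)[OF x(1)] QX(1)[OF x(1)] w(3) by auto
  then consider "w = t2 x" | "w = r1 (t2 x)" | "w = t3 x" using x(3) by blast
  then show thesis
  proof cases
    case 1
    then show ?thesis using that(1)[OF x(1,2)] w(3) by simp
  next
    case 2
    moreover have "apex (t2 x)"
      using apex_r1[of "t2 x"] t_sizes(2)[OF x(1)] QX(1)[OF x(1)] w(3) 2 by simp
    ultimately show ?thesis using that(1)[OF x(1,2)] by simp
  next
    case 3
    then show ?thesis using that(2)[OF x(1,2)] w(3) by simp
  qed
qed

text \<open>If the second triangle at \<open>x\<close> has its third side on a square, this is the
  flag of that square at the apex over the edge of \<open>x\<close>. It pairs the vertices: each is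
  the apex over an edge at the other.\<close>

definition opp :: "'a flag \<Rightarrow> 'a flag" where "opp x = r2 (r1 (r0 (t2 x)))"

lemma t2_opp:
  assumes x: "x \<in> Q" "apex (t2 x)"
  shows "opp x \<in> Q" "t2 (r0 (opp x)) = r0 (t3 x)" "apex (t2 (opp x))" "opp (opp x) = x"
proof -
  note xX = QX(1)[OF x(1)]
  show "opp x \<in> Q" using x xX by (simp add: opp_def Q_def apex_def)
  have "r2 (r0 (opp x)) = r1 (r0 (r1 (t2 x)))"
    using r0_r1_order(1)[of "t2 x"] t_sizes(2)[OF x(1)] xX by (simp add: opp_def)
  then show "t2 (r0 (opp x)) = r0 (t3 x)" using xX by (simp add: t2_def[of "r0 (opp x)"] t3_def)
  have e: "t2 (opp x) = r0 (r1 (r2 x))" using xX by (simp add: opp_def t2_def)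
  then show "apex (t2 (opp x))" using xX QX(2)[OF x(1)] by (simp add: apex_def)
  show "opp (opp x) = x" unfolding opp_def[of "opp x"] e using xX by simp
qed

text \<open>By \<open>t2_opp\<close> the third triangle of \<open>x\<close> is the second triangle
  seen from the other end of the edge of \<open>opp x\<close>, so its remaining sides are surrounded
  by triangles.\<close>

lemma apex_exclusive:
  assumes "x \<in> Q" "apex (t2 x)" shows "\<not> apex (t3 x)" "\<not> apex (t2 (r0 (opp x)))"
proof -
  note xX = QX(1)[OF assms(1)] and o = t2_opp[OF assms]
  have u: "r0 (opp x) \<in> Q" using Q_closed(1) o(1) .
  have "t3 (r0 (opp x)) = r2 (r1 (r0 (t3 x)))" by (simp add: t3_def[of "r0 (opp x)"] o(2))
  then show "\<not> apex (t3 x)" using t_sizes(3)[OF u] by (simp add: apex_def)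
  have "r2 (r1 (r0 (r0 (t3 x)))) = t4 x" using xX by (simp add: t4_def)
  then show "\<not> apex (t2 (r0 (opp x)))" using t_sizes(4)[OF assms(1)] by (simp add: apex_def o(2))
qed

lemma symm_t:
  assumes "symm \<Phi>" "x \<in> X"
  shows "\<Phi> (t2 x) = t2 (\<Phi> x)" "\<Phi> (t3 x) = t3 (\<Phi> x)" "apex (\<Phi> x) \<longleftrightarrow> apex x" "\<Phi> x \<in> Q \<longleftrightarrow> x \<in> Q"
proof -
  note d = symmD[OF assms(1)]
  show "\<Phi> (t2 x) = t2 (\<Phi> x)" "\<Phi> (t3 x) = t3 (\<Phi> x)" using d assms(2) by (simp_all add: t2_def t3_def)
  have "r2 (r1 (r0 (\<Phi> x))) = \<Phi> (r2 (r1 (r0 x)))" using d assms(2) by simp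
  then show "apex (\<Phi> x) \<longleftrightarrow> apex x" using d(5)[of "r2 (r1 (r0 x))"] assms(2) by (simp add: apex_def)
  show "\<Phi> x \<in> Q \<longleftrightarrow> x \<in> Q" using d(1,5)[OF assms(2)] assms(2) by (simp add: Q_def)
qed

lemma move:
  assumes "x \<in> Q" "y \<in> Q"
  obtains \<Phi> where "symm \<Phi>" "\<Phi> x = y \<or> \<Phi> x = r1 y"
proof -
  obtain \<Phi> where \<Phi>: "symm \<Phi>" "vert (\<Phi> x) = vert y"
    using transitiveE[OF transitive QX(1)[OF assms(1)] QX(1)[OF assms(2)]] .
  then show thesis using that[OF \<Phi>(1)] Q_same[of "\<Phi> x" y] symm_t(4)[OF \<Phi>(1) QX(1)[OF assms(1)]] assms by simp
qed

lemma sq_eq: assumes x: "x \<in> Q" shows "sq (vert x) = face x"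
proof -
  note xX = QX(1)[OF x]
  have "card {f \<in> Faces M. card f = 4 \<and> vert x \<in> \<Union> f} = 1"
    using face_sizes_at(2)[OF flag_simps(5)[OF xX], of 4] by (simp add: ts)
  then obtain f where f: "{f \<in> Faces M. card f = 4 \<and> vert x \<in> \<Union> f} = {f}"
    using card_1_singletonE by blast
  moreover have "face x \<in> {f \<in> Faces M. card f = 4 \<and> vert x \<in> \<Union> f}"
    using flag_simps(1,4)[OF xX] QX(2)[OF x] by simp
  ultimately have fx: "f = face x" by blast
  show ?thesis unfolding sq_def
    by (rule the_equality) (use f fx in blast)+
qed

lemma sq_face:
  assumes "w \<in> X" shows "sq (vert w) \<in> {f \<in> Faces M. card f = 4}" "vert w \<in> \<Union> (sq (vert w))"
proof -
  obtain x where x: "x \<in> Q" "vert x = vert w" using Q_at[OF assms] .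
  have "face x = sq (vert w)" using sq_eq[OF x(1)] x(2) by simp
  then show "sq (vert w) \<in> {f \<in> Faces M. card f = 4}" "vert w \<in> \<Union> (sq (vert w))"
    using flag_simps(1,4)[OF QX(1)[OF x(1)]] QX(2)[OF x(1)] x(2) by auto
qed

text \<open>A square through both ends would contain the edge, but both faces at that edge are
  triangles.\<close>

lemma sq_separate:
  assumes "y \<in> X" "sz y = 3" "sz (r2 y) = 3" shows "sq (vert y) \<noteq> sq (vert (r0 y))"
proof
  assume e: "sq (vert y) = sq (vert (r0 y))"
  have "sq (vert y) = face y \<or> sq (vert y) = face (r2 y)"
    using common_edge[OF assms(1), of "sq (vert y)"] sq_face[OF assms(1)] sq_face(2)[of "r0 y"] e assms(1) by simp
  then show False using sq_face(1)[OF assms(1)] assms(2,3) by auto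
qed

lemma third_square:
  assumes "a \<in> X" "b \<in> X" "c \<in> X" "d \<in> X"
    "sq (vert a) \<noteq> sq (vert b)" "sq (vert a) \<noteq> sq (vert c)" "sq (vert b) \<noteq> sq (vert c)"
    "sq (vert d) \<noteq> sq (vert a)" "sq (vert d) \<noteq> sq (vert b)"
  shows "sq (vert d) = sq (vert c)"
proof (rule third_eq[of "{f \<in> Faces M. card f = 4}" "sq (vert a)" "sq (vert b)"])
  show "finite {f \<in> Faces M. card f = 4}" using finite_parts by simp
qed (use assms sq_face(1) three in simp_all)

lemma sizes: "w \<in> X \<Longrightarrow> sz w = 3 \<or> sz w = 4"
  using size_mem_ts[of w] by (simp add: ts)

section \<open>Excluding apices in second triangles\<close>

lemma no_apex_t2:
  assumes x: "x \<in> Q" shows "\<not> apex (t2 x)"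
proof
  assume ap: "apex (t2 x)"
  define P where "P = {x \<in> Q. apex (t2 x)}"
  have xP: "x \<in> P" using x ap by (simp add: P_def)
  have PQ: "y \<in> Q" "y \<in> X" "apex (t2 y)" if "y \<in> P" for y using that QX by (auto simp: P_def)
  have oP: "opp y \<in> P" "opp (opp y) = y" "r0 (opp y) \<notin> P" if "y \<in> P" for y
    using t2_opp[OF PQ(1)[OF that] PQ(3)[OF that]] apex_exclusive(2)[OF PQ(1)[OF that] PQ(3)[OF that]] by (simp_all add: P_def)
  have \<Phi>P: "\<Phi> y \<in> P \<longleftrightarrow> y \<in> P" if "symm \<Phi>" "y \<in> X" for \<Phi> y
    using symm_t[OF that] symm_t(3)[OF that(1), of "t2 y"] that(2) by (simp add: P_def)
  \<comment> \<open>If both flags at one vertex were in \<open>P\<close>, transitivity would put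
    every square flag into \<open>P\<close>, against \<open>oP\<close>. Thus \<open>P\<close>
    selects one of the two flags of a square at each vertex, that is, a sense of rotation.\<close>
  have r1P: "r1 y \<notin> P" if y: "y \<in> P" for y
  proof
    assume r: "r1 y \<in> P"
    have "r0 (opp y) \<in> Q" using oP(1)[OF y] PQ(1) Q_closed(1) by blast
    then obtain \<Phi> where \<Phi>: "symm \<Phi>" "\<Phi> y = r0 (opp y) \<or> \<Phi> y = r1 (r0 (opp y))" using move[OF PQ(1)[OF y]] by blast
    have oX: "opp y \<in> X" using oP(1)[OF y] PQ by blast
    have "\<Phi> y \<in> P" "\<Phi> (r1 y) \<in> P" using \<Phi>P[OF \<Phi>(1)] r y PQ(2)[OF y] by auto
    moreover have "\<Phi> (r1 y) = r1 (\<Phi> y)" using symmD(3)[OF \<Phi>(1) PQ(2)[OF y]] .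
    ultimately have "r0 (opp y) \<in> P" using \<Phi>(2) oX by auto
    then show False using oP(3)[OF y] by simp
  qed
  have move_P: "\<exists>\<Phi>. symm \<Phi> \<and> \<Phi> y = z" if y: "y \<in> P" and z: "z \<in> P" for y z
  proof -
    obtain \<Phi> where \<Phi>: "symm \<Phi>" "\<Phi> y = z \<or> \<Phi> y = r1 z" using move[OF PQ(1)[OF y] PQ(1)[OF z]] .
    then have "\<Phi> y = z" using \<Phi>P[OF \<Phi>(1) PQ(2)[OF y]] y r1P[OF z] by metis
    then show ?thesis using \<Phi>(1) by blast
  qed
  have split: "y \<in> P \<or> r1 y \<in> P" if y: "y \<in> Q" for y
  proof -
    obtain \<Phi> where \<Phi>: "symm \<Phi>" "\<Phi> x = y \<or> \<Phi> x = r1 y" using move[OF x y] .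
    then show ?thesis using \<Phi>P[OF \<Phi>(1) QX(1)[OF x]] xP by auto
  qed
  have r0P: "r0 y \<notin> P" if y: "y \<in> P" for y
  proof
    assume r: "r0 y \<in> P"
    obtain \<Phi> where \<Phi>: "symm \<Phi>" "\<Phi> y = opp y" using move_P[OF y oP(1)[OF y]] by blast
    have "r0 (opp y) \<in> P" using \<Phi>P[OF \<Phi>(1), of "r0 y"] r symmD(2)[OF \<Phi>(1) PQ(2)[OF y]] \<Phi>(2) PQ(2)[OF y] by simp
    then show False using oP(3)[OF y] by simp
  qed
  have rotP: "rot y \<in> P" if y: "y \<in> P" for y
    using split[of "r0 y"] r0P[OF y] Q_closed(1)[OF PQ(1)[OF y]] by (auto simp: rot_def)
  have rotkP: "(rot ^^ k) y \<in> P" if y: "y \<in> P" for y k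
    by (induction k) (use y rotP in auto)
  have ne: "face (opp y) \<noteq> face y" if y: "y \<in> P" for y
  proof -
    note yX = PQ(2)[OF y] and oX = PQ(2)[OF oP(1)[OF y]]
    have "sq (vert (r1 (r2 y))) \<noteq> sq (vert (r0 (r1 (r2 y))))"
      by (rule sq_separate) (use yX t_sizes(1,2)[OF PQ(1)[OF y]] in \<open>simp_all add: t2_def\<close>)
    moreover have "vert (opp y) = vert (r0 (r1 (r2 y)))" using yX by (simp add: opp_def t2_def)
    ultimately show ?thesis
      using sq_eq[OF PQ(1)[OF y]] sq_eq[OF PQ(1)[OF oP(1)[OF y]]] yX by simp
  qed
  \<comment> \<open>The third and fourth triangles at \<open>y\<close> share the neighbour
    \<open>b\<close>, and \<open>c\<close>, \<open>d\<close> are their further corners. No side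
    involved lies on a square, so \<open>c\<close> and \<open>d\<close> both avoid the squares of
    \<open>a\<close> and \<open>b\<close> and belong to the third one.\<close>
  have step: "face (opp (r0 (r1 y))) = face (opp y)" if y: "y \<in> P" and z: "r0 (r1 y) \<in> P" for y
  proof -
    note yX = PQ(2)[OF y] and yQ = PQ(1)[OF y] and oX = PQ(2)[OF oP(1)[OF y]]
    note ts = t_sizes[OF yQ]
    have y': "r1 y \<in> Q" using Q_closed(2)[OF yQ] .
    have n3: "\<not> apex (t3 y)" using apex_exclusive(1)[OF yQ PQ(3)[OF y]] .
    have n4: "\<not> apex (t2 (r1 y))" using r1P[OF y] y' by (simp add: P_def)
    define a where "a = y"
    define b where "b = r0 (r1 (t3 y))"
    define c where "c = r0 (opp y)"
    define d where "d = opp (r0 (r1 y))"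
    have X: "a \<in> X" "b \<in> X" "c \<in> X" "d \<in> X" using yX oX PQ(2)[OF oP(1)[OF z]] by (simp_all add: a_def b_def c_def d_def)
    have c: "vert c = vert (r0 (t3 y))"
    proof -
      have "vert c = vert (t2 c)" using X by simp
      then show ?thesis using t2_opp(2)[OF yQ PQ(3)[OF y]] by (simp add: c_def)
    qed
    have d: "vert d = vert (r0 (r1 (t4 y)))"
    proof -
      have "vert d = vert (r0 (r1 (r2 (r0 (r1 y)))))" using yX by (simp add: d_def opp_def t2_def)
      also have "r0 (r1 (r2 (r0 (r1 y)))) = r0 (r1 (r0 (r2 (r1 y))))" using yX by simp
      also have "\<dots> = r1 (r0 (r1 (r2 (r1 y))))"
        using r0_r1_order(1)[of "r2 (r1 y)"] t_sizes(1)[OF y'] yX by simp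
      also have "vert \<dots> = vert (r0 (r2 (r1 (r2 (r1 y)))))" using yX by simp
      also have "r2 (r1 (r2 (r1 y))) = r1 (t4 y)" using t_reverse(1)[OF yX] by (simp add: t2_def)
      finally show ?thesis .
    qed
    have ab: "sq (vert (r1 (t3 y))) \<noteq> sq (vert (r0 (r1 (t3 y))))"
      by (rule sq_separate) (use yX ts in simp_all)
    have ac: "sq (vert (t3 y)) \<noteq> sq (vert (r0 (t3 y)))"
      by (rule sq_separate) (use yX ts in simp_all)
    have ad: "sq (vert (r1 (t4 y))) \<noteq> sq (vert (r0 (r1 (t4 y))))"
    proof (rule sq_separate)
      show "sz (r2 (r1 (t4 y))) = 3"
        using t_sizes(5)[OF y'] t_reverse(1)[OF yX] by simp
    qed (use yX ts in simp_all)
    have tri: "sz (r2 (r1 (r0 w))) = 3" if w: "w \<in> X" "sz w = 3" "\<not> apex w" for w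
    proof -
      have "sz (r2 (r1 (r0 w))) = 3 \<or> sz (r2 (r1 (r0 w))) = 4" by (rule sizes) (use w in simp)
      then show ?thesis using w(3) by (simp add: apex_def)
    qed
    have bc: "sq (vert (r1 (r0 (t3 y)))) \<noteq> sq (vert (r0 (r1 (r0 (t3 y)))))"
      by (rule sq_separate) (use yX ts tri[of "t3 y"] n3 in simp_all)
    have "r0 (r1 (r0 (t3 y))) = r1 b" using r0_r1_order(1)[of "t3 y"] yX ts by (simp add: b_def)
    then have vb: "vert (r0 (r1 (r0 (t3 y)))) = vert b" using X(2) by simp
    have n4': "\<not> apex (t4 y)"
      using n4 apex_r1[of "t4 y"] t_reverse(1)[OF yX] yX ts by simp
    have bd: "sq (vert (r1 (r0 (t4 y)))) \<noteq> sq (vert (r0 (r1 (r0 (t4 y)))))"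
      by (rule sq_separate) (use yX ts tri[of "t4 y"] n4' in simp_all)
    have "r0 (r1 (r0 (t4 y))) = r1 (r0 (r1 (t4 y)))" using r0_r1_order(1)[of "t4 y"] yX ts by simp
    then have vd: "vert (r0 (r1 (r0 (t4 y)))) = vert d" using d yX by simp
    have "r0 (t4 y) = r2 b" using yX by (simp add: b_def t4_def)
    then have vb': "vert (r1 (r0 (t4 y))) = vert b" using X(2) by simp
    have "sq (vert d) = sq (vert c)"
      by (rule third_square[OF X]) (use ab ac ad bc bd vb vb' vd c d yX in \<open>simp_all add: a_def b_def\<close>)
    then show ?thesis
      using sq_eq[OF PQ(1)[OF oP(1)[OF z]]] sq_eq[OF Q_closed(1)[OF PQ(1)[OF oP(1)[OF y]]]] oX
      by (simp add: c_def d_def)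
  qed
  have bwd: "r0 (r1 y) \<in> P \<and> face (opp (r0 (r1 y))) = face (opp y)" if y: "y \<in> P" for y
  proof -
    have "(rot ^^ 3) y = r0 (r1 y)"
    proof -
      have "(rot ^^ 4) y = y" using rot_pow_eq_iff[of y 4] QX(2)[OF PQ(1)[OF y]] PQ(2)[OF y] by simp
      then have "r0 (r1 (rot ((rot ^^ 3) y))) = r0 (r1 y)" by (simp add: numeral_eq_Suc)
      then show ?thesis using PQ(2)[OF rotkP[OF y, of 3]] by (simp add: rot_def)
    qed
    then have "r0 (r1 y) \<in> P" using rotkP[OF y, of 3] by simp
    then show ?thesis using step[OF y] by simp
  qed
  have same: "face (opp z) = face (opp y)" if yz: "y \<in> P" "z \<in> P" "face z = face y" for y z
  proof -
    have it: "face (opp ((rot ^^ k) y)) = face (opp y)" for k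
    proof (induction k)
      case (Suc k)
      have "r0 (r1 (rot ((rot ^^ k) y))) = (rot ^^ k) y" using PQ(2)[OF rotkP[OF yz(1)]] by (simp add: rot_def)
      then show ?case using bwd[of "rot ((rot ^^ k) y)"] rotP[OF rotkP[OF yz(1)]] Suc by simp
    qed simp
    obtain k where "z = (rot ^^ k) y \<or> z = r0 ((rot ^^ k) y)"
      using same_face_cases[OF PQ(2)[OF yz(1)] PQ(2)[OF yz(2)] yz(3)] by metis
    then have "z = (rot ^^ k) y" using r0P[OF rotkP[OF yz(1)]] yz(2) by metis
    then show ?thesis using it by simp
  qed
  have sqs: "face y \<in> {f \<in> Faces M. card f = 4}" if "y \<in> P" for y
    using flag_simps(1)[OF PQ(2)[OF that]] QX(2)[OF PQ(1)[OF that]] by simp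
  \<comment> \<open>Partners induce an involution on the squares that fixes none of them; among
    three squares one is left over.\<close>
  have "\<not> {f \<in> Faces M. card f = 4} \<subseteq> {face x, face (opp x)}"
  proof
    assume "{f \<in> Faces M. card f = 4} \<subseteq> {face x, face (opp x)}"
    then have "card {f \<in> Faces M. card f = 4} \<le> card {face x, face (opp x)}" by (intro card_mono) auto
    also have "\<dots> \<le> 2" by (simp add: card_insert_if)
    finally show False using three by simp
  qed
  then obtain f where f: "f \<in> Faces M" "card f = 4" "f \<noteq> face x" "f \<noteq> face (opp x)" by blast
  obtain h where h: "cyclic_param (card f) h f" using face_cyclic_param[OF f(1)] by metis
  have w: "Flag (h 0) {h 0, h 1} f \<in> Q" using h f by (auto simp: Q_def flags_def cyclic_param_def)
  then obtain z where z: "z \<in> P" "face z = f"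
    using split[OF w] QX(1)[OF w] by (metis flag.sel(3) flags_r01(6))
  have "face (opp z) = face x \<or> face (opp z) = face (opp x)"
  proof (rule ccontr)
    assume n: "\<not> ?thesis"
    have "face (opp z) = face z"
      by (rule third_eq[of "{f \<in> Faces M. card f = 4}" "face x" "face (opp x)"])
        (use finite_parts three sqs[OF xP] sqs[OF oP(1)[OF xP]] sqs[OF z(1)] sqs[OF oP(1)[OF z(1)]] n f z ne[OF xP] in simp_all)
    then show False using ne[OF z(1)] by simp
  qed
  then have "face (opp (opp z)) = face (opp x) \<or> face (opp (opp z)) = face (opp (opp x))"
    using same[OF xP oP(1)[OF z(1)]] same[OF oP(1)[OF xP] oP(1)[OF z(1)]] by blast
  then show False using oP(2)[OF xP] oP(2)[OF z(1)] f(3,4) z(2) by simp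
qed

section \<open>The apex map on square flags\<close>

text \<open>The word defining \<open>t3\<close> is a palindrome in involutions, hence its own
  inverse. Applied to the flag at the apex over the edge of \<open>x\<close>, it recovers the square
  flag at that apex whose middle triangle this is.\<close>

definition top_flag :: "'a flag \<Rightarrow> 'a flag" where
  "top_flag x = r2 (r1 (r2 (r1 (r2 (r0 (r1 (r2 x)))))))"

lemma t3_top_flag:
  assumes x: "x \<in> Q"
  shows "top_flag x \<in> Q" "t3 (top_flag x) = r0 (r1 (r2 x))"
proof -
  note xX = QX(1)[OF x]
  define z where "z = r0 (r1 (r2 x))"
  have z: "z \<in> X" "sz z = 3" "apex z"
    using xX t_sizes(1)[OF x] QX(2)[OF x] by (simp_all add: z_def apex_def)
  show "top_flag x \<in> Q" "t3 (top_flag x) = r0 (r1 (r2 x))"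
  proof (atomize (full), rule apex_cases[OF z], goal_cases)
    case (1 x')
    then show ?case using no_apex_t2[of x'] by simp
  next
    case (2 x')
    then have "top_flag x = x'" using QX(1)[of x'] by (simp add: top_flag_def z_def[symmetric] t3_def t2_def)
    then show ?case using 2 by (simp add: z_def)
  qed
qed

lemma apex_t3: assumes x: "x \<in> Q" shows "apex (t3 x)"
proof -
  obtain \<Phi> where \<Phi>: "symm \<Phi>" "\<Phi> (top_flag x) = x \<or> \<Phi> (top_flag x) = r1 x"
    using move[OF t3_top_flag(1)[OF x] x] .
  note tX = QX(1)[OF t3_top_flag(1)[OF x]]
  have "apex (t3 (top_flag x))" using t3_top_flag(2)[OF x] QX[OF x] by (simp add: apex_def)
  then have "apex (t3 (\<Phi> (top_flag x)))" using symm_t(3)[OF \<Phi>(1), of "t3 (top_flag x)"] symm_t(2)[OF \<Phi>(1) tX] tX by simp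
  then show ?thesis using \<Phi>(2) t_reverse(2)[of x] apex_r1[of "t3 x"] QX(1)[OF x] t_sizes(3)[OF x] by auto
qed

lemma top_flag_r0:
  assumes x: "x \<in> Q" shows "top_flag (r0 x) = r1 (top_flag x)"
proof -
  note xX = QX(1)[OF x] and b = t3_top_flag[OF x]
  have "r0 (r1 (r2 (r0 x))) = r1 (r0 (r1 (r2 x)))"
    using r0_r1_order(1)[of "r2 x"] t_sizes(1)[OF x] xX by simp
  also have "\<dots> = t3 (r1 (top_flag x))" using b(2) t_reverse(2)[OF QX(1)[OF b(1)]] by simp
  finally show ?thesis unfolding top_flag_def[of "r0 x"]
    using QX(1)[OF Q_closed(2)[OF b(1)]] by (simp add: t3_def t2_def)
qed

text \<open>Transported by \<open>t2\<close>, the apex map becomes one step of rotation in the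
  second triangle, and a triangle has three corners.\<close>

lemma top_flag_cubed:
  assumes x: "x \<in> Q" shows "top_flag (top_flag (top_flag x)) = x"
proof -
  have step: "t2 (top_flag x) = r1 (r0 (t2 x))" if x: "x \<in> Q" for x
  proof -
    have "r1 (r2 (t3 (top_flag x))) = r1 (r2 (r0 (r1 (r2 x))))" using t3_top_flag(2)[OF x] by simp
    then show ?thesis using QX(1)[OF x] QX(1)[OF t3_top_flag(1)[OF x]] by (simp add: t3_def) (simp add: t2_def)
  qed
  let ?b = top_flag
  have Q: "?b x \<in> Q" "?b (?b x) \<in> Q" "?b (?b (?b x)) \<in> Q" using t3_top_flag(1) x by blast+
  have "t2 (?b (?b (?b x))) = (rot ^^ 3) (t2 x)"
    using step x Q by (simp add: numeral_eq_Suc rot_def)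
  also have "\<dots> = t2 x" using rot_pow_eq_iff[of "t2 x" 3] t_sizes(2)[OF x] QX(1)[OF x] by simp
  finally have "r2 (r1 (r2 (t2 (?b (?b (?b x)))))) = r2 (r1 (r2 (t2 x)))" by simp
  then show ?thesis using QX(1)[OF x] QX(1)[OF Q(3)] by (simp add: t2_def)
qed

text \<open>The square beyond the middle triangle at \<open>x\<close> is common to \<open>x\<close>
  and \<open>r1 x\<close>. Both apices avoid it and the square of \<open>x\<close>, which leaves
  only the third square.\<close>

lemma top_flag_face:
  assumes x: "x \<in> Q" shows "face (top_flag (r1 x)) = face (top_flag x)"
proof -
  note xX = QX(1)[OF x] and xs = t_sizes[OF x]
  have y: "r1 x \<in> Q" using Q_closed(2)[OF x] .
  note yX = QX(1)[OF y] and ys = t_sizes[OF y]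
  define m where "m = r2 (r1 (r0 (t3 x)))"
  have m: "m \<in> Q" using apex_t3[OF x] xX by (simp add: m_def apex_def Q_def)
  have vt: "vert (top_flag x) = vert (r0 (r1 (r2 x)))" if "x \<in> Q" for x
    using t3_top_flag[OF that] by (metis QX(1) vert_t(2))
  have tri: "sz (r2 (r1 (r0 (t2 x)))) = 3" if "x \<in> Q" for x
    using sizes[of "r2 (r1 (r0 (t2 x)))"] no_apex_t2[OF that] QX(1)[OF that] by (simp add: apex_def)
  have a: "sq (vert x) \<noteq> sq (vert (r0 (t3 x)))" if "x \<in> Q" for x
    using sq_separate[of "t3 x"] QX(1)[OF that] t_sizes[OF that] by simp
  have b: "sq (vert x) \<noteq> sq (vert (top_flag x))" if "x \<in> Q" for x
    using sq_separate[of "r1 (r2 x)"] QX(1)[OF that] t_sizes[OF that] vt[OF that] by (simp add: t2_def)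
  have c: "sq (vert (top_flag x)) \<noteq> sq (vert (r0 (t3 x)))" if x: "x \<in> Q" for x
  proof -
    note xX = QX(1)[OF x]
    have "vert (r0 (t2 x)) = vert (top_flag x)" using xX vt[OF x] by (simp add: t2_def)
    moreover have "r0 (r1 (r0 (t2 x))) = r1 (r0 (r1 (t2 x)))"
      using r0_r1_order(1)[of "t2 x"] xX t_sizes(2)[OF x] by simp
    moreover have "vert (r0 (r1 (t2 x))) = vert (r0 (t3 x))" using xX by (simp add: t3_def)
    ultimately show ?thesis
      using sq_separate[of "r1 (r0 (t2 x))"] xX t_sizes[OF x] tri[OF x] by simp
  qed
  have "sq (vert (r0 (t3 (r1 x)))) = sq (vert (r0 (t3 x)))"
  proof -
    have "vert (r0 (t3 x)) = vert m" using xX by (simp add: m_def)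
    moreover have "vert (r0 (t3 (r1 x))) = vert (r0 m)"
    proof -
      have "r0 (r1 (r0 (t3 x))) = r1 (r0 (r1 (t3 x)))"
        using r0_r1_order(1)[of "t3 x"] xX xs by simp
      then show ?thesis using xX t_reverse(2)[OF xX] by (simp add: m_def)
    qed
    ultimately show ?thesis using sq_eq[OF m] sq_eq[OF Q_closed(1)[OF m]] QX(1)[OF m] by simp
  qed
  then have "sq (vert (top_flag (r1 x))) = sq (vert (top_flag x))"
    using third_square[of x "r0 (t3 x)" "top_flag x" "top_flag (r1 x)"]
      a[OF x] b[OF x] c[OF x] b[OF y] c[OF y] xX QX(1)[OF t3_top_flag(1)[OF x]] QX(1)[OF t3_top_flag(1)[OF y]]
    by simp
  then show ?thesis using sq_eq[OF t3_top_flag(1)[OF x]] sq_eq[OF t3_top_flag(1)[OF y]] by simp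
qed

text \<open>A symmetry that reverses an edge acts at the apex over this edge as the reflection
  \<open>r1\<close>. Composed with a symmetry reversing an edge there it gives a rotation.\<close>

lemma rotation_exists:
  obtains x \<Phi> where "x \<in> Q" "symm \<Phi>" "\<Phi> x = r1 (r0 x)"
proof -
  obtain w where "w \<in> X" "sz w = 4" using ex_flag_of_size[of 4] ts by auto
  then have x: "w \<in> Q" by (simp add: Q_def)
  note xX = QX(1)[OF x]
  obtain \<Phi>1 where 1: "symm \<Phi>1" "\<Phi>1 w = r0 w \<or> \<Phi>1 w = r1 (r0 w)"
    using move[OF x Q_closed(1)[OF x]] .
  show thesis
  proof (cases "\<Phi>1 w = r1 (r0 w)")
    case True
    then show ?thesis using that x 1 by blast
  next
    case False
    then have e: "\<Phi>1 w = r0 w" using 1 by blast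
    define y where "y = top_flag w"
    have y: "y \<in> Q" using t3_top_flag(1)[OF x] by (simp add: y_def)
    have "\<Phi>1 y = top_flag (\<Phi>1 w)" using symmD[OF 1(1)] xX by (simp add: y_def top_flag_def)
    then have \<Phi>1y: "\<Phi>1 y = r1 y" using e top_flag_r0[OF x] by (simp add: y_def)
    obtain \<Phi>2 where 2: "symm \<Phi>2" "\<Phi>2 y = r0 y \<or> \<Phi>2 y = r1 (r0 y)"
      using move[OF y Q_closed(1)[OF y]] .
    show ?thesis
    proof (cases "\<Phi>2 y = r1 (r0 y)")
      case True
      then show ?thesis using that y 2 by blast
    next
      case False
      then have "\<Phi>2 (\<Phi>1 y) = r1 (r0 y)" using 2 \<Phi>1y symmD(3)[OF 2(1) QX(1)[OF y]] by simp
      then show ?thesis using that y symm_comp[OF 2(1) 1(1)] by blast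
    qed
  qed
qed

lemma snub_False: False
proof -
  obtain x \<Phi> where x: "x \<in> Q" and \<Phi>: "symm \<Phi>" and \<Phi>x: "\<Phi> x = r1 (r0 x)"
    by (rule rotation_exists)
  note d = symmD[OF \<Phi>]
  let ?b = top_flag
  \<comment> \<open>The symmetry turns the square of \<open>y\<close> by a quarter; the sense is
    left open because it may change along the apex map.\<close>
  define good where "good y \<longleftrightarrow> y \<in> Q \<and> (\<Phi> y = r1 (r0 y) \<or> \<Phi> y = r0 (r1 y))" for y
  have gQ: "y \<in> Q" "y \<in> X" "?b y \<in> Q" "?b y \<in> X" if "good y" for y
    using that QX(1) t3_top_flag(1) by (auto simp: good_def)
  have good01: "good (r0 y)" "good (r1 y)" if "good y" for y
    using that Q_closed[OF gQ(1)[OF that]] d(2,3) gQ(2)[OF that] by (auto simp: good_def)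
  have sq4: "r1 (r0 (r1 (r0 y))) = r0 (r1 (r0 (r1 y)))" if "y \<in> Q" for y
    using r0_r1_order(2)[OF QX[OF that]] by simp
  have \<Phi>b: "\<Phi> (?b y) = ?b (\<Phi> y)" if "y \<in> X" for y
    using that d by (simp add: top_flag_def)
  have goodb: "good (?b y)" if g: "good y" for y
  proof -
    note yQ = gQ[OF g]
    define z where "z = ?b y"
    have z: "z \<in> Q" "z \<in> X" using yQ by (simp_all add: z_def)
    have \<Phi>z: "\<Phi> z = ?b (\<Phi> y)" using \<Phi>b yQ by (simp add: z_def)
    \<comment> \<open>Apices over adjacent edges lie in one square, so the square of
      \<open>z\<close> is mapped to itself; since the square of the symmetry moves \<open>z\<close>,
      only a quarter turn remains.\<close>
    have "face (\<Phi> z) = face z"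
    proof (cases "\<Phi> y = r1 (r0 y)")
      case True
      then show ?thesis
        using \<Phi>z top_flag_face[OF Q_closed(1)[OF yQ(1)]] top_flag_r0[OF yQ(1)] z by (simp add: z_def)
    next
      case False
      then have "\<Phi> y = r0 (r1 y)" using g by (simp add: good_def)
      then show ?thesis
        using \<Phi>z top_flag_face[OF yQ(1)] top_flag_r0[OF Q_closed(2)[OF yQ(1)]]
          QX(1)[OF t3_top_flag(1)[OF Q_closed(2)[OF yQ(1)]]] by (simp add: z_def)
    qed
    then obtain k where k: "k < sz z" "\<Phi> z = (rot ^^ k) z \<or> \<Phi> z = r0 ((rot ^^ k) z)"
      using same_face_cases[OF z(2) d(1)[OF z(2)]] by metis
    have "\<Phi> (\<Phi> y) \<noteq> y"
    proof
      assume e: "\<Phi> (\<Phi> y) = y"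
      have "\<Phi> (\<Phi> y) = r1 (r0 (r1 (r0 y)))"
        using g yQ(2) d(2,3) sq4[OF yQ(1)] by (auto simp: good_def)
      then have "(rot ^^ 2) y = y" using e by (simp add: numeral_eq_Suc rot_def)
      then show False using rot_pow_eq_iff[OF yQ(2), of 2] QX(2)[OF yQ(1)] by simp
    qed
    then have n: "\<Phi> (\<Phi> z) \<noteq> z"
    proof -
      have "\<Phi> (\<Phi> z) = ?b (\<Phi> (\<Phi> y))" using \<Phi>z \<Phi>b d(1) yQ by simp
      moreover have "\<Phi> (\<Phi> y) \<in> Q" using symm_t(4)[OF \<Phi>] yQ d(1) by simp
      ultimately show ?thesis
        using \<open>\<Phi> (\<Phi> y) \<noteq> y\<close> top_flag_cubed[OF yQ(1)] top_flag_cubed[of "\<Phi> (\<Phi> y)"] by (metis z_def)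
    qed
    have \<Phi>rot: "\<Phi> ((rot ^^ k) w) = (rot ^^ k) (\<Phi> w)" if "w \<in> X" for w k
      using that by (induction k) (simp_all add: rot_def d)
    have "k = 0 \<or> k = 1 \<or> k = 2 \<or> k = 3" using k(1) QX(2)[OF z(1)] by auto
    have s4: "r1 (r0 (r1 (r0 (r1 (r0 (r1 (r0 z))))))) = z"
      using rot_pow_eq_iff[OF z(2), of 4] QX(2)[OF z(1)] by (simp add: numeral_eq_Suc rot_def)
    have "\<Phi> z \<noteq> r0 ((rot ^^ k) z)"
    proof
      assume e: "\<Phi> z = r0 ((rot ^^ k) z)"
      have "\<Phi> (\<Phi> z) = r0 ((rot ^^ k) (r0 ((rot ^^ k) z)))"
        using e \<Phi>rot[OF z(2), of k] d(2) rot_closed(3)[OF z(2)] by simp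
      also have "\<dots> = ((\<lambda>y. r0 (r1 y)) ^^ k) ((rot ^^ k) z)"
        using rot_back_pow[of "(rot ^^ k) z" k] rot_closed(3)[OF z(2)] by simp
      also have "\<dots> = z" by (rule rot_back_rot[OF z(2)])
      finally show False using n by simp
    qed
    then have \<Phi>zk: "\<Phi> z = (rot ^^ k) z" using k(2) by blast
    have \<Phi>\<Phi>: "\<Phi> (\<Phi> z) = (rot ^^ k) ((rot ^^ k) z)" using \<Phi>zk \<Phi>rot[OF z(2), of k] by simp
    have "k \<noteq> 0" using \<Phi>\<Phi> n by (cases k) simp_all
    moreover have "k \<noteq> 2" using \<Phi>\<Phi> n s4 by (auto simp: numeral_eq_Suc rot_def)
    moreover have "(rot ^^ 3) z = r0 (r1 z)"
      using sq4[OF z(1)] z(2) by (simp add: numeral_eq_Suc rot_def)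
    ultimately have "\<Phi> z = r1 (r0 z) \<or> \<Phi> z = r0 (r1 z)"
      using \<Phi>zk \<open>k = 0 \<or> k = 1 \<or> k = 2 \<or> k = 3\<close> by (auto simp: rot_def)
    then show ?thesis using z(1) by (simp add: good_def z_def)
  qed
  \<comment> \<open>One of the flags \<open>r1 y\<close>, \<open>r0 y\<close> is the image of the
    other up to the quarter turn, and \<open>top_flag_r0\<close> gives the value at
    \<open>r0 y\<close>. The unknown sense at \<open>top_flag y\<close> accounts for the two
    alternatives.\<close>
  have top_r1: "?b (r1 y) = r0 (?b y) \<or> ?b (r1 y) = r1 (r0 (r1 (?b y)))" if g: "good y" for y
  proof -
    note yQ = gQ[OF g]
    define z where "z = ?b y"
    have gz: "good z" using goodb[OF g] by (simp add: z_def)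
    note zQ = gQ[OF gz]
    have \<Phi>z: "\<Phi> z = ?b (\<Phi> y)" using \<Phi>b yQ by (simp add: z_def)
    have gX: "?b (r1 y) \<in> X" using gQ(4)[OF good01(2)[OF g]] .
    show ?thesis
    proof (cases "\<Phi> y = r0 (r1 y)")
      case True
      then have "r1 y = r0 (\<Phi> y)" using yQ by simp
      then have "?b (r1 y) = r1 (\<Phi> z)"
        using top_flag_r0[of "\<Phi> y"] symm_t(4)[OF \<Phi> yQ(2)] yQ(1) \<Phi>z by simp
      moreover have "\<Phi> z = r1 (r0 z) \<or> \<Phi> z = r0 (r1 z)" using gz by (simp add: good_def)
      ultimately show ?thesis using zQ(2) unfolding z_def[symmetric] by (elim disjE) simp_all
    next
      case False
      then have "\<Phi> (r1 y) = r0 y" using g d(3)[OF yQ(2)] yQ by (simp add: good_def)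
      then have e: "\<Phi> (?b (r1 y)) = r1 z" using \<Phi>b[of "r1 y"] top_flag_r0[OF yQ(1)] yQ by (simp add: z_def)
      show ?thesis
      proof (cases "\<Phi> z = r0 (r1 z)")
        case True
        then have "\<Phi> (r0 z) = r1 z" using d(2)[OF zQ(2)] zQ by simp
        then have "?b (r1 y) = r0 z" using symm_eq[OF \<Phi> gX, of "r0 z"] e zQ by simp
        then show ?thesis by (simp add: z_def)
      next
        case False
        then have "\<Phi> (r1 (r0 (r1 z))) = r1 z" using gz d zQ sq4[OF zQ(1)] by (simp add: good_def)
        then have "?b (r1 y) = r1 (r0 (r1 z))" using symm_eq[OF \<Phi> gX, of "r1 (r0 (r1 z))"] e zQ by simp
        then show ?thesis by (simp add: z_def)
      qed
    qed
  qed
  have g0: "good x" using x \<Phi>x by (simp add: good_def)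
  define x1 where "x1 = ?b x"
  define x2 where "x2 = ?b x1"
  have g1: "good x1" and g2: "good x2" using goodb g0 by (simp_all add: x1_def x2_def)
  note X0 = gQ[OF g0] and X1 = gQ[OF g1] and X2 = gQ[OF g2]
  have b2: "?b x2 = x" using top_flag_cubed[OF x] by (simp add: x1_def x2_def)
  \<comment> \<open>Order three of the apex map expresses \<open>r0 x\<close> through two
    applications to \<open>r1 x1\<close>. Evaluating these by \<open>top_r1\<close> in all cases
    identifies \<open>r0 x\<close> with another flag of the same square.\<close>
  have r0x: "r0 x = ?b (?b (r1 x1))"
  proof -
    have "?b (?b (?b (r0 x))) = r0 x" using top_flag_cubed Q_closed(1)[OF x] by simp
    then show ?thesis using top_flag_r0[OF x] by (simp add: x1_def)
  qed
  have r01: "r0 x \<noteq> r1 x" using flags_r01(8,12)[OF X0(2)] by metis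
  have rot1: "r0 x \<noteq> r0 (r1 (r0 x))"
  proof
    assume "r0 x = r0 (r1 (r0 x))"
    then have "r0 (r0 x) = r0 (r0 (r1 (r0 x)))" by simp
    then have "(rot ^^ 1) x = x" using X0 by (simp add: rot_def)
    then show False using rot_pow_eq_iff[OF X0(2), of 1] QX(2)[OF x] by simp
  qed
  have "?b (r1 x1) = r0 x2 \<or> ?b (r1 x1) = r1 (r0 (r1 x2))" using top_r1[OF g1] by (simp add: x2_def)
  then show False
  proof
    assume "?b (r1 x1) = r0 x2"
    then have "r0 x = r1 x" using r0x top_flag_r0[OF X2(1)] b2 by simp
    then show False using r01 by simp
  next
    assume e: "?b (r1 x1) = r1 (r0 (r1 x2))"
    define h where "h = r0 (r1 x2)"
    have gh: "good h" using good01 g2 by (simp add: h_def)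
    have bh: "?b h = r1 (?b (r1 x2))" using top_flag_r0[OF Q_closed(2)[OF X2(1)]] by (simp add: h_def)
    then have c1: "?b h = r1 (r0 x) \<or> ?b h = r0 (r1 x)" using top_r1[OF g2] b2 X0 by auto
    have c2: "r0 x = r0 (?b h) \<or> r0 x = r1 (r0 (r1 (?b h)))"
      using top_r1[OF gh] r0x e by (simp add: h_def)
    have c3: "r1 (r0 (r1 (r0 (r1 x)))) = r0 (r1 (r0 x))"
      using sq4[OF x] X0 by (metis flags_r01(1-4))
    from c1 show False
    proof
      assume "?b h = r1 (r0 x)"
      then have "r0 x = r0 (r1 (r0 x)) \<or> r0 x = r1 x" using c2 X0 by simp
      then show False using r01 rot1 by blast
    next
      assume "?b h = r0 (r1 x)"
      then have "r0 x = r1 x \<or> r0 x = r0 (r1 (r0 x))" using c2 c3 X0 by simp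
      then show False using r01 rot1 by blast
    qed
  qed
qed

end

section \<open>Euler characteristic $-1$\<close>

lemma not_transitive_type_4_6_16:
  assumes "semi_equivelar [(4, 1), (6, 1), (16, 1)] M" "euler_char M = -1"
  shows "\<not> vertex_transitive M"
proof -
  interpret semi_equivelar_map M "[(4, 1), (6, 1), (16, 1)]"
    using assms(1) by unfold_locales simp_all
  have ts: "ts = [4, 6, 16]" unfolding ts_def by simp
  \<comment> \<open>The characteristic equals V (1 - 3/2 + 1/4 + 1/6 + 1/16) = -V/48, so V = 48 and
    there are 48/16 largest faces.\<close>
  have "card {f \<in> Faces M. card f = 16} = 3"
    using assms(2) edge_count[unfolded ts] face_total[unfolded ts]
      face_count[of 4, unfolded ts] face_count[of 6, unfolded ts] face_count[of 16, unfolded ts]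
    by (simp add: euler_char_def)
  then show ?thesis using not_transitive_4_6_16[OF ts] by simp
qed

lemma not_transitive_type_3_4_8_4:
  assumes "semi_equivelar [(3, 1), (4, 1), (8, 1), (4, 1)] M" "euler_char M = -1"
  shows "\<not> vertex_transitive M"
proof -
  interpret semi_equivelar_map M "[(3, 1), (4, 1), (8, 1), (4, 1)]"
    using assms(1) by unfold_locales simp_all
  have ts: "ts = [3, 4, 8, 4]" unfolding ts_def by simp
  have s: "set ts = {3, 4, 8}" unfolding ts by auto
  \<comment> \<open>Here V (1 - 2 + 1/3 + 2/4 + 1/8) = -V/24, so V = 24.\<close>
  have "card {f \<in> Faces M. card f = 8} = 3"
    using assms(2) edge_count[unfolded ts] face_total[unfolded s]
      face_count[of 3, unfolded ts] face_count[of 4, unfolded ts] face_count[of 8, unfolded ts]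
    by (simp add: euler_char_def)
  then show ?thesis using not_transitive_3_4_8_4[OF ts] by simp
qed

lemma not_transitive_type_6_6_8:
  assumes "semi_equivelar [(6, 2), (8, 1)] M" "euler_char M = -1"
  shows "\<not> vertex_transitive M"
proof -
  interpret semi_equivelar_map M "[(6, 2), (8, 1)]"
    using assms(1) by unfold_locales (simp_all add: numeral_eq_Suc)
  have ts: "ts = [6, 6, 8]" unfolding ts_def by (simp add: numeral_2_eq_2)
  \<comment> \<open>Here V (1 - 3/2 + 2/6 + 1/8) = -V/24, so V = 24.\<close>
  have "card {f \<in> Faces M. card f = 8} = 3"
    using assms(2) edge_count[unfolded ts] face_total[unfolded ts]
      face_count[of 6, unfolded ts] face_count[of 8, unfolded ts]
    by (simp add: euler_char_def)
  then show ?thesis using not_transitive_6_6_8[OF ts] by simp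
qed

lemma not_transitive_type_3_4_3_4_4:
  assumes "semi_equivelar [(3, 1), (4, 1), (3, 1), (4, 2)] M"
  shows "\<not> vertex_transitive M"
proof -
  interpret semi_equivelar_map M "[(3, 1), (4, 1), (3, 1), (4, 2)]"
    using assms(1) by unfold_locales simp_all
  have "ts = [3, 4, 3, 4, 4]" unfolding ts_def by (simp add: numeral_2_eq_2)
  then show ?thesis by (rule not_transitive_3_4_3_4_4)
qed

lemma not_transitive_type_3_3_3_3_3_4:
  assumes "semi_equivelar [(3, 5), (4, 1)] M" "euler_char M = -1"
  shows "\<not> vertex_transitive M"
proof
  assume tr: "vertex_transitive M"
  interpret semi_equivelar_map M "[(3, 5), (4, 1)]"
    using assms(1) by unfold_locales simp_all
  have "replicate 5 (3 :: nat) = [3, 3, 3, 3, 3]" by (simp add: eval_nat_numeral)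
  then have ts: "ts = [3, 3, 3, 3, 3, 4]" unfolding ts_def by simp
  \<comment> \<open>Here V (1 - 3 + 5/3 + 1/4) = -V/12, so V = 12.\<close>
  have "card {f \<in> Faces M. card f = 4} = 3"
    using assms(2) edge_count[unfolded ts] face_total[unfolded ts]
      face_count[of 3, unfolded ts] face_count[of 4, unfolded ts]
    by (simp add: euler_char_def)
  with ts tr interpret snub M "[(3, 5), (4, 1)]" by unfold_locales
  show False by (rule snub_False)
qed

section \<open>Counting pairs of faces\<close>

text \<open>\<open>H\<close> is the set of the vertex sets of the faces.\<close>

definition remote_pairs :: "nat \<Rightarrow> nat \<Rightarrow> 'a set set \<Rightarrow> 'a \<Rightarrow> nat" where
  "remote_pairs p r H v = card {x \<in> H \<times> H. v \<in> fst x \<and> card (fst x) = p \<and> card (snd x) = p \<and>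
     (\<forall>h \<in> H. card h = r \<longrightarrow> fst x \<inter> h = {} \<or> snd x \<inter> h = {})}"

lemma remote_pairs_image:
  assumes inj: "inj \<phi>" and H: "image \<phi> ` H = H"
  shows "remote_pairs p r H (\<phi> v) = remote_pairs p r H v"
proof -
  let ?P = "\<lambda>v x. v \<in> fst x \<and> card (fst x) = p \<and> card (snd x) = p \<and>
     (\<forall>h \<in> H. card h = r \<longrightarrow> fst x \<inter> h = {} \<or> snd x \<inter> h = {})"
  let ?\<psi> = "map_prod (image \<phi>) (image \<phi>)"
  have card: "card (\<phi> ` f) = card f" for f using inj by (simp add: card_image inj_on_subset)
  have disj: "\<phi> ` f \<inter> \<phi> ` h = {} \<longleftrightarrow> f \<inter> h = {}" for f h
    using image_Int[OF inj, of f h] by (metis image_is_empty)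
  have "(\<forall>h \<in> H. card h = r \<longrightarrow> \<phi> ` f \<inter> h = {} \<or> \<phi> ` g \<inter> h = {}) \<longleftrightarrow>
      (\<forall>h \<in> image \<phi> ` H. card h = r \<longrightarrow> \<phi> ` f \<inter> h = {} \<or> \<phi> ` g \<inter> h = {})" for f g
    unfolding H ..
  then have P: "?P (\<phi> v) (?\<psi> x) \<longleftrightarrow> ?P v x" for x
    by (cases x) (simp add: card disj inj_image_mem_iff[OF inj])
  have S: "?\<psi> ` (H \<times> H) = H \<times> H" using H by (metis map_prod_surj_on)
  have gen: "{x \<in> g ` A. R x} = g ` {x \<in> A. R' x}" if "\<And>x. R (g x) = R' x"
    for g :: "'b \<Rightarrow> 'c" and A R R' using that by auto
  have "{x \<in> ?\<psi> ` (H \<times> H). ?P (\<phi> v) x} = ?\<psi> ` {x \<in> H \<times> H. ?P v x}"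
    by (rule gen) (rule P)
  then have e: "{x \<in> H \<times> H. ?P (\<phi> v) x} = ?\<psi> ` {x \<in> H \<times> H. ?P v x}" unfolding S .
  have "inj (image \<phi>)" by (rule injI) (simp only: inj_image_eq_iff[OF inj])
  then have "inj ?\<psi>" using prod.inj_map by blast
  then have "card (?\<psi> ` {x \<in> H \<times> H. ?P v x}) = card {x \<in> H \<times> H. ?P v x}"
    by (intro card_image) (rule inj_on_subset[OF _ subset_UNIV])
  moreover have "remote_pairs p r H w = card {x \<in> H \<times> H. ?P w x}" for w
    by (simp only: remote_pairs_def)
  ultimately show ?thesis unfolding e[symmetric] by simp
qed

lemma Union_boundary: assumes "xs \<noteq> []" shows "\<Union> (boundary xs) = set xs"
proof
  show "\<Union> (boundary xs) \<subseteq> set xs" using assms by (auto simp: boundary_def)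
  show "set xs \<subseteq> \<Union> (boundary xs)"
  proof
    fix v assume "v \<in> set xs"
    then obtain i where "i < length xs" "v = xs ! i" by (metis in_set_conv_nth)
    then show "v \<in> \<Union> (boundary xs)" unfolding boundary_def by blast
  qed
qed

lemma not_vertex_transitive_map_of_faces:
  assumes ne: "[] \<notin> set L" and uv: "u \<in> \<Union> (set ` set L)" "v \<in> \<Union> (set ` set L)"
    and "remote_pairs p r (set (map set L)) u \<noteq> remote_pairs p r (set (map set L)) v"
  shows "\<not> vertex_transitive (map_of_faces L)"
proof
  let ?M = "map_of_faces L"
  assume "vertex_transitive ?M"
  then obtain \<phi> where \<phi>: "automorphism ?M \<phi>" "\<phi> u = v"
    using uv unfolding vertex_transitive_def by (metis cell_map.select_convs(1) map_of_faces_def)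
  then have p: "\<phi> permutes Verts ?M" and F: "image (image \<phi>) ` Faces ?M = Faces ?M"
    by (auto simp: automorphism_def)
  have f: "Faces ?M = boundary ` set L" by (simp add: map_of_faces_def)
  have H: "Union ` Faces ?M = set (map set L)"
    unfolding f image_image set_map
    by (rule image_cong[OF refl], rule Union_boundary) (use ne in blast)
  \<comment> \<open>Faces are sets of edges; taking unions turns the action on faces into one on
    their vertex sets, where the invariant is defined.\<close>
  have "image \<phi> ` Union ` Faces ?M = Union ` image (image \<phi>) ` Faces ?M"
    by (simp add: image_image image_Union)
  then have "image \<phi> ` set (map set L) = set (map set L)" unfolding F H .
  from remote_pairs_image[OF permutes_inj[OF p] this, of p r u] show False
    using assms(4) \<phi>(2) by simp
qed

text \<open>An executable form of \<open>remote_pairs\<close> on face lists, phrased through list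
  predicates so that it can be evaluated inside the logic.\<close>

definition remote_count :: "nat \<Rightarrow> nat \<Rightarrow> 'a list list \<Rightarrow> 'a \<Rightarrow> nat" where
  "remote_count p r L v = length (filter
     (\<lambda>x. list_all (\<lambda>h. length h = r \<longrightarrow>
        list_all (\<lambda>u. u \<notin> set h) (fst x) \<or> list_all (\<lambda>u. u \<notin> set h) (snd x)) L)
     (List.product (filter (\<lambda>f. length f = p \<and> v \<in> set f) L) (filter (\<lambda>g. length g = p) L)))"

lemma remote_pairs_eq_count:
  assumes d: "distinct (map set L)" and dL: "list_all distinct L"
  shows "remote_pairs p r (set (map set L)) v = remote_count p r L v"
proof -
  let ?A = "filter (\<lambda>x. list_all (\<lambda>h. length h = r \<longrightarrow>
        list_all (\<lambda>u. u \<notin> set h) (fst x) \<or> list_all (\<lambda>u. u \<notin> set h) (snd x)) L)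
     (List.product (filter (\<lambda>f. length f = p \<and> v \<in> set f) L) (filter (\<lambda>g. length g = p) L))"
  have len: "card (set xs) = length xs" if "xs \<in> set L" for xs
    using dL that by (simp add: list_all_iff distinct_card)
  have inj: "inj_on set (set L)" and dL': "distinct L" using d by (simp_all add: distinct_map)
  have disj: "list_all (\<lambda>u. u \<notin> set h) f \<longleftrightarrow> set f \<inter> set h = {}" for f h :: "'a list"
    by (auto simp: list_all_iff)
  have "{x \<in> set (map set L) \<times> set (map set L). v \<in> fst x \<and> card (fst x) = p \<and> card (snd x) = p \<and>
     (\<forall>h \<in> set (map set L). card h = r \<longrightarrow> fst x \<inter> h = {} \<or> snd x \<inter> h = {})} = map_prod set set ` set ?A"
    (is "?B = _")
  proof
    show "?B \<subseteq> map_prod set set ` set ?A"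
    proof
      fix x assume x: "x \<in> ?B"
      then obtain f g where fg: "f \<in> set L" "g \<in> set L" "x = map_prod set set (f, g)" by auto
      then have "(f, g) \<in> set ?A" using x len by (auto simp: list_all_iff disj)
      then show "x \<in> map_prod set set ` set ?A" using fg(3) by blast
    qed
    show "map_prod set set ` set ?A \<subseteq> ?B" using len by (auto simp: list_all_iff disj)
  qed
  moreover have "inj_on (map_prod set set) (set ?A)"
    by (rule inj_on_subset[OF map_prod_inj_on[OF inj inj]]) auto
  moreover have "distinct ?A" using dL' by (intro distinct_filter distinct_product) auto
  ultimately show ?thesis
    unfolding remote_pairs_def remote_count_def by (simp only: card_image distinct_card)
qed

lemma not_vertex_transitive_by_count:
  assumes "list_all (\<lambda>xs. xs \<noteq> [] \<and> distinct xs) L" "distinct (map set L)"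
    and "list_ex (\<lambda>xs. u \<in> set xs) L" "list_ex (\<lambda>xs. v \<in> set xs) L"
    and "remote_count p r L u \<noteq> remote_count p r L v"
  shows "\<not> vertex_transitive (map_of_faces L)"
proof (rule not_vertex_transitive_map_of_faces[where p = p and r = r])
  have "list_all distinct L" using assms(1) by (auto simp: list_all_iff)
  then show "remote_pairs p r (set (map set L)) u \<noteq> remote_pairs p r (set (map set L)) v"
    using remote_pairs_eq_count[OF assms(2)] assms(5) by metis
qed (use assms(1,3,4) in \<open>auto simp: list_all_iff list_ex_iff\<close>)

section \<open>The seven explicit maps\<close>

text \<open>Every vertex lies on one of four pentagons, and each square meets two or all of them.
  Remote squares are those with complementary pairs of pentagons: there are four such pairs at
  vertex 1 and three at vertex 9.\<close>

lemma K1_not_vertex_transitive: "\<not> vertex_transitive K1"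
  unfolding K1_def
  by (rule not_vertex_transitive_by_count[where u = 1 and v = 9 and p = 4 and r = 5]) code_simp+

lemma K2_not_vertex_transitive: "\<not> vertex_transitive K2"
  unfolding K2_def
  \<comment> \<open>With \<open>p = r\<close> the two squares themselves are among the tested faces,
    so a remote pair is disjoint and has no square meeting both.\<close>
  by (rule not_vertex_transitive_by_count[where u = 1 and v = 9 and p = 4 and r = 4]) code_simp+

text \<open>As for \<open>K1\<close>, complementary pairs of pentagons are counted: three at vertex
  1, four at vertex 2.\<close>

lemma K3_not_vertex_transitive: "\<not> vertex_transitive K3"
  unfolding K3_def
  by (rule not_vertex_transitive_by_count[where u = 1 and v = 2 and p = 4 and r = 5]) code_simp+

text \<open>Three triangles avoid all 7-gons that meet the triangle at vertex 1, and none does so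
  for the triangle at vertex 2.\<close>

lemma K4_not_vertex_transitive: "\<not> vertex_transitive K4"
  unfolding K4_def
  by (rule not_vertex_transitive_by_count[where u = 1 and v = 2 and p = 3 and r = 7]) code_simp+

lemma K5_not_vertex_transitive: "\<not> vertex_transitive K5"
  unfolding K5_def
  by (rule not_vertex_transitive_by_count[where u = 1 and v = 24 and p = 6 and r = 6]) code_simp+

text \<open>A square meets two of the six 14-gons; nine squares avoid those of the square at vertex
  1, eight those of the square at vertex 3.\<close>

lemma K6_not_vertex_transitive: "\<not> vertex_transitive K6"
  unfolding K6_def
  by (rule not_vertex_transitive_by_count[where u = 1 and v = 3 and p = 4 and r = 14]) code_simp+

text \<open>A square meets two of the five 8-gons; four squares avoid those of the square at vertex
  1, three those of the square at vertex 2.\<close>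

lemma K7_not_vertex_transitive: "\<not> vertex_transitive K7"
  unfolding K7_def
  by (rule not_vertex_transitive_by_count[where u = 1 and v = 2 and p = 4 and r = 8]) code_simp+

theorem theorem1p3:
  shows "\<not> vertex_transitive K1 \<and> \<not> vertex_transitive K2 \<and> \<not> vertex_transitive K3 \<and>
    \<not> vertex_transitive K4 \<and> \<not> vertex_transitive K5 \<and> \<not> vertex_transitive K6 \<and>
    \<not> vertex_transitive K7 \<and>
    (\<forall>K8 K9 :: nat cell_map. complete_list_of_type [(4, 1), (6, 1), (16, 1)] [K8, K9] \<longrightarrow>
       \<not> vertex_transitive K8 \<and> \<not> vertex_transitive K9) \<and>
    (\<forall>K10 K11 :: nat cell_map. complete_list_of_type [(3, 1), (4, 1), (8, 1), (4, 1)] [K10, K11] \<longrightarrow>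
       \<not> vertex_transitive K10 \<and> \<not> vertex_transitive K11) \<and>
    (\<forall>K12 K13 :: nat cell_map. complete_list_of_type [(6, 2), (8, 1)] [K12, K13] \<longrightarrow>
       \<not> vertex_transitive K12 \<and> \<not> vertex_transitive K13) \<and>
    (\<forall>K14 :: nat cell_map. complete_list_of_type [(3, 1), (4, 1), (3, 1), (4, 2)] [K14] \<longrightarrow>
       \<not> vertex_transitive K14) \<and>
    (\<forall>K15 K16 K17 :: nat cell_map. complete_list_of_type [(3, 5), (4, 1)] [K15, K16, K17] \<longrightarrow>
       \<not> vertex_transitive K15 \<and> \<not> vertex_transitive K16 \<and> \<not> vertex_transitive K17)"
  by (auto simp: complete_list_of_type_def K1_not_vertex_transitive K2_not_vertex_transitive
      K3_not_vertex_transitive K4_not_vertex_transitive K5_not_vertex_transitive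
      K6_not_vertex_transitive K7_not_vertex_transitive not_transitive_type_4_6_16
      not_transitive_type_3_4_8_4 not_transitive_type_6_6_8 not_transitive_type_3_4_3_4_4
      not_transitive_type_3_3_3_3_3_4)

end
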